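(* Let $\mathfrak g$ and $V$ be vector spaces over $\mathbb K$, let $L'=\bigoplus_{n\ge 0}L'^{\,n}$ and $\mathfrak h=\bigoplus_{n\geq 1}\mathrm{Hom}(\wedge^{n-1}\mathfrak g\otimes\mathfrak g,V)$ be the graded spaces described in the context, and let $P$ be the projection onto $\mathfrak h$ described in the context. Then $(s^{-1}L'\oplus\mathfrak h,\{l_k\}_{k=1}^{+\infty})$ is an $L_\infty$-algebra, where the $l_k$ are given by $$l_2(s^{-1}f,s^{-1}g)=(-1)^{|f|}s^{-1}[f,g]^{MN},\qquad l_2(s^{-1}f,\theta)=P([f,\theta]^{MN}),\qquad l_k(s^{-1}f,\theta_1,\dots,\theta_{k-1})=0\ (k\ge 3),$$ for homogeneous $\theta,\theta_1,\dots,\theta_{k-1}\in\mathfrak h$ and $f,g\in L'$, and all the other possible combinations (not obtained from these by permutation of arguments) vanish. Moreover, for all $\pi\in\mathrm{Hom}(\mathfrak g\otimes\mathfrak g,\mathfrak g)$, $\rho\in\mathrm{Hom}(\mathfrak g\otimes V,V)$, $\mu\in\mathrm{Hom}(V\otimes\mathfrak g,V)$ and $D\in\mathrm{Hom}(\mathfrak g,V)$, the element $(s^{-1}(\pi+\rho+\mu),D)$ is a Maurer-Cartan element of the $L_\infty$-algebra $(s^{-1}L'\oplus\mathfrak h,\{l_k\}_{k=1}^{+\infty})$ if and only if $(\mathfrak g,D,\rho,\mu)$ is a pre-LieDer pair (with pre-Lie product $\pi$).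
   Context: All vector spaces are over an algebraically closed field $\mathbb K$ of characteristic $0$. Pre-Lie algebra: a vector space $\mathfrak g$ with a bilinear product $\cdot$ (also denoted $\pi$) such that $(x\cdot y)\cdot z-x\cdot(y\cdot z)=(y\cdot x)\cdot z-y\cdot(x\cdot z)$. Its sub-adjacent Lie algebra $\mathfrak g^C$ has bracket $[x,y]_C=x\cdot y-y\cdot x$. A representation $(V;\rho,\mu)$ consists of a representation $\rho:\mathfrak g\to\mathfrak{gl}(V)$ of the Lie algebra $\mathfrak g^C$ and a linear map $\mu:\mathfrak g\to\mathfrak{gl}(V)$ with $\mu(y)\mu(x)-\mu(x\cdot y)=\mu(y)\rho(x)-\rho(x)\mu(y)$. A pre-LieDer pair $(\mathfrak g,D,\rho,\mu)$ is a pre-Lie algebra $(\mathfrak g,\cdot)$ with a representation $(V;\rho,\mu)$ and a derivation, i.e. a linear map $D:\mathfrak g\to V$ with $D(x\cdot y)=\rho(x)D(y)+\mu(y)D(x)$. We write $\rho(x,v)=\rho(x)v$ and $\mu(v,x)=\mu(x)v$. Matsushima-Nijenhuis bracket: for a vector space $W$, $C^n(W;W)=\mathrm{Hom}(\wedge^{n-1}W\otimes W,W)$, $n\ge1$, whose elements have degree $n-1$. For $P\in C^{p+1}(W;W)$, $Q\in C^{q+1}(W;W)$, $[P,Q]^{MN}=P\circ Q-(-1)^{pq}Q\circ P$, where $$(P\circ Q)(x_1,\dots,x_{p+q+1})=\sum_{\sigma\in\mathbb S_{(q,1,p-1)}}\mathrm{sgn}(\sigma)P(Q(x_{\sigma(1)},\dots,x_{\sigma(q+1)}),x_{\sigma(q+2)},\dots,x_{\sigma(p+q)},x_{p+q+1})$$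 $$+(-1)^{pq}\sum_{\sigma\in\mathbb S_{(p,q)}}\mathrm{sgn}(\sigma)P(x_{\sigma(1)},\dots,x_{\sigma(p)},Q(x_{\sigma(p+1)},\dots,x_{\sigma(p+q)},x_{p+q+1})),$$ with $\mathbb S_{(i_1,\dots,i_k)}$ the unshuffles (first sum absent if $p=0$). This makes $C^*(W;W)$ a graded Lie algebra. Take $W=\mathfrak g\oplus V$ and $L=C^*(W;W)$. Let $\mathcal G^{k,l}=\wedge^{k-1}\mathfrak g\otimes\wedge^lV\otimes\mathfrak g+\wedge^k\mathfrak g\otimes\wedge^{l-1}V\otimes V$, so $\wedge^{n-1}W\otimes W\cong\bigoplus_{k+l=n}\mathcal G^{k,l}$. $C^{k|l}(W;W)$ is the space of $f\in C^{k+l+1}(W;W)$ with $f(\mathcal G^{k+1,l})\subset\mathfrak g$, $f(\mathcal G^{k,l+1})\subset V$ and $f=0$ on the other $\mathcal G^{i,j}$; $L$ is the direct sum of the $C^{k|l}(W;W)$. $L'^{\,n}=C^{n|0}(W;W)\cong\mathrm{Hom}(\wedge^n\mathfrak g\otimes\mathfrak g,\mathfrak g)\oplus\mathrm{Hom}(\wedge^n\mathfrak g\otimes V,V)\oplus\mathrm{Hom}(\wedge^{n-1}\mathfrak g\otimes V\otimes\mathfrak g,V)$ (third summand absent for $n=0$), in degree $n$; $\mathrm{Hom}(\wedge^{n-1}\mathfrak g\otimes\mathfrak g,V)\cong C^{n|-1}(W;W)$, in degree $n-1$. The identifications are by horizontal lifts: for $f$ in $\mathrm{Hom}(\wedge^{m-1}\mathfrak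 g\otimes\mathfrak g,\mathfrak g)$ or $\mathrm{Hom}(\wedge^{m-1}\mathfrak g\otimes\mathfrak g,V)$, $\hat f(x_1+v_1,\dots,x_m+v_m)=f(x_1,\dots,x_m)$; for $f\in\mathrm{Hom}(\wedge^{m-1}\mathfrak g\otimes V,V)$, $\hat f(\dots)=f(x_1,\dots,x_{m-1},v_m)$; for $f\in\mathrm{Hom}(\wedge^{m-2}\mathfrak g\otimes V\otimes\mathfrak g,V)$, $\hat f(\dots)=\sum_{i=1}^{m-1}(-1)^{m-1-i}f(x_1,\dots,\hat{x_i},\dots,x_{m-1},v_i,x_m)$. $P:L\to L$ is the projection onto $\mathfrak h$ vanishing on all $C^{k|l}(W;W)$ with $l\ne-1$. $|f|$ is the degree of $f$ in $L$. $(s^{-1}L')^i=L'^{\,i+1}$. An $L_\infty$-algebra is a $\mathbb Z$-graded vector space with degree $1$ graded symmetric multilinear maps $l_k$, $k\ge1$, satisfying $\sum_{i=1}^n\sum_{\sigma\in\mathbb S_{(i,n-i)}}\varepsilon(\sigma)l_{n-i+1}(l_i(x_{\sigma(1)},\dots,x_{\sigma(i)}),x_{\sigma(i+1)},\dots,x_{\sigma(n)})=0$ for all $n\ge1$, with $\varepsilon(\sigma)$ the Koszul sign. A Maurer-Cartan element is a degree $0$ element $\alpha$ with $\sum_{k\ge1}\frac1{k!}l_k(\alpha,\dots,\alpha)=0$. *)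

theory Defs
  imports
    "HOL-Analysis.Product_Vector"
    "HOL-Combinatorics.Permutations"
    "HOL-Library.Function_Algebras"
    "HOL-Computational_Algebra.Polynomial"
begin

section \<open>Pre-LieDer pairs\<close>

definition bilinear_map ::
  "('k::field \<Rightarrow> 'a::ab_group_add \<Rightarrow> 'a) \<Rightarrow> ('k \<Rightarrow> 'b::ab_group_add \<Rightarrow> 'b) \<Rightarrow>
   ('k \<Rightarrow> 'c::ab_group_add \<Rightarrow> 'c) \<Rightarrow> ('a \<Rightarrow> 'b \<Rightarrow> 'c) \<Rightarrow> bool" where
  "bilinear_map sA sB sC f \<longleftrightarrow>
     (\<forall>x. Vector_Spaces.linear sB sC (f x)) \<and> (\<forall>y. Vector_Spaces.linear sA sC (\<lambda>x. f x y))"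

locale pre_Lie_algebra = vector_space scale
  for scale :: "'k::field \<Rightarrow> 'g::ab_group_add \<Rightarrow> 'g" +
  fixes prd :: "'g \<Rightarrow> 'g \<Rightarrow> 'g" (infixl \<open>\<cdot>\<close> 70)
  assumes bilinear_prd: "bilinear_map scale scale scale prd"
    and pre_Lie: "(x \<cdot> y) \<cdot> z - x \<cdot> (y \<cdot> z) = (y \<cdot> x) \<cdot> z - y \<cdot> (x \<cdot> z)"

definition sub_adjacent :: "('g::ab_group_add \<Rightarrow> 'g \<Rightarrow> 'g) \<Rightarrow> 'g \<Rightarrow> 'g \<Rightarrow> 'g" where
  "sub_adjacent prd x y = prd x y - prd y x"

definition Lie_representation ::
  "('k::field \<Rightarrow> 'g::ab_group_add \<Rightarrow> 'g) \<Rightarrow> ('k \<Rightarrow> 'v::ab_group_add \<Rightarrow> 'v) \<Rightarrow>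
   ('g \<Rightarrow> 'g \<Rightarrow> 'g) \<Rightarrow> ('g \<Rightarrow> 'v \<Rightarrow> 'v) \<Rightarrow> bool" where
  "Lie_representation sg sv br \<rho> \<longleftrightarrow> bilinear_map sg sv sv \<rho> \<and>
     (\<forall>x y v. \<rho> (br x y) v = \<rho> x (\<rho> y v) - \<rho> y (\<rho> x v))"

locale pre_Lie_representation =
  pre_Lie_algebra sg prd + V: vector_space sv
  for sg :: "'k::field \<Rightarrow> 'g::ab_group_add \<Rightarrow> 'g"
    and prd :: "'g \<Rightarrow> 'g \<Rightarrow> 'g" (infixl \<open>\<cdot>\<close> 70)
    and sv :: "'k \<Rightarrow> 'v::ab_group_add \<Rightarrow> 'v" +
  fixes \<rho> \<mu> :: "'g \<Rightarrow> 'v \<Rightarrow> 'v"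
  assumes rho: "Lie_representation sg sv (sub_adjacent prd) \<rho>"
    and bilinear_mu: "bilinear_map sg sv sv \<mu>"
    and mu: "\<mu> y (\<mu> x v) - \<mu> (x \<cdot> y) v = \<mu> y (\<rho> x v) - \<rho> x (\<mu> y v)"

locale pre_LieDer_pair = pre_Lie_representation sg prd sv \<rho> \<mu>
  for sg :: "'k::field \<Rightarrow> 'g::ab_group_add \<Rightarrow> 'g"
    and prd :: "'g \<Rightarrow> 'g \<Rightarrow> 'g" (infixl \<open>\<cdot>\<close> 70)
    and sv :: "'k \<Rightarrow> 'v::ab_group_add \<Rightarrow> 'v"
    and D :: "'g \<Rightarrow> 'v"
    and \<rho> \<mu> :: "'g \<Rightarrow> 'v \<Rightarrow> 'v" +
  assumes linear_D: "Vector_Spaces.linear sg sv D"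
    and derivation: "D (x \<cdot> y) = \<rho> x (D y) + \<mu> y (D x)"


section \<open>The Matsushima-Nijenhuis bracket\<close>

text \<open>
  Maps of \<open>n\<close> arguments are functions on lists, set to \<open>0\<close> on lists of any other length.
  So maps of different arities live in one function space, in which the spaces
  \<^term>\<open>wedge_hom sA sB n\<close> below for \<open>n \<ge> 1\<close> are independent subspaces.
\<close>

definition fun_scale :: "('k \<Rightarrow> 'b \<Rightarrow> 'b) \<Rightarrow> 'k \<Rightarrow> ('a \<Rightarrow> 'b) \<Rightarrow> 'a \<Rightarrow> 'b" where
  "fun_scale s c f = (\<lambda>x. s c (f x))"

text \<open>
  \<open>Hom(\<Lambda>\<^sup>n\<^sup>-\<^sup>1 A \<otimes> A, B)\<close> for \<open>n \<ge> 1\<close>: multilinear maps of \<open>n\<close> arguments, alternating in the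
  first \<open>n - 1\<close> of them.
\<close>

definition wedge_hom ::
  "('k::field \<Rightarrow> 'a::ab_group_add \<Rightarrow> 'a) \<Rightarrow> ('k \<Rightarrow> 'b::ab_group_add \<Rightarrow> 'b) \<Rightarrow> nat \<Rightarrow>
   ('a list \<Rightarrow> 'b) set" where
  "wedge_hom sA sB n = {f.
     (\<forall>xs. length xs \<noteq> n \<longrightarrow> f xs = 0) \<and>
     (\<forall>xs i. length xs = n \<longrightarrow> i < n \<longrightarrow> Vector_Spaces.linear sA sB (\<lambda>x. f (xs[i := x]))) \<and>
     (\<forall>xs i j. length xs = n \<longrightarrow> i < j \<longrightarrow> j < n - 1 \<longrightarrow> xs ! i = xs ! j \<longrightarrow> f xs = 0)}"

text \<open>
  The unshuffles with block lengths \<open>bs\<close>, acting on the positions \<open>0, 1, \<dots>\<close>. The argument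
  list \<open>(x\<^sub>\<sigma>\<^sub>(\<^sub>1\<^sub>), x\<^sub>\<sigma>\<^sub>(\<^sub>2\<^sub>), \<dots>)\<close> is \<^term>\<open>permute_list \<sigma> xs\<close>.
\<close>

definition unshuffles :: "nat list \<Rightarrow> (nat \<Rightarrow> nat) set" where
  "unshuffles bs = {\<sigma>. \<sigma> permutes {..<sum_list bs} \<and>
     (\<forall>b<length bs. strict_mono_on {sum_list (take b bs)..<sum_list (take (Suc b) bs)} \<sigma>)}"

text \<open>
  \<open>F \<circ> G\<close> for \<open>F\<close> of degree \<open>p\<close> and \<open>G\<close> of degree \<open>q\<close>. The permutations only move the first
  \<open>p + q\<close> of the \<open>p + q + 1\<close> arguments, so the last entry of
  \<^term>\<open>permute_list \<sigma> xs\<close> is \<open>x\<^sub>p\<^sub>+\<^sub>q\<^sub>+\<^sub>1\<close>.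
\<close>

definition MN_circ ::
  "('k::field \<Rightarrow> 'w::ab_group_add \<Rightarrow> 'w) \<Rightarrow> nat \<Rightarrow> nat \<Rightarrow>
   ('w list \<Rightarrow> 'w) \<Rightarrow> ('w list \<Rightarrow> 'w) \<Rightarrow> 'w list \<Rightarrow> 'w" where
  "MN_circ s p q F G xs =
    (if length xs = p + q + 1 then
       (if p = 0 then 0 else
          \<Sum>\<sigma>\<in>unshuffles [q, 1, p - 1].
            let ys = permute_list \<sigma> xs
            in s (of_int (sign \<sigma>)) (F (G (take (q + 1) ys) # drop (q + 1) ys)))
       + s ((- 1) ^ (p * q))
          (\<Sum>\<sigma>\<in>unshuffles [p, q].
            let ys = permute_list \<sigma> xs
            in s (of_int (sign \<sigma>)) (F (take p ys @ [G (drop p ys)])))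
     else 0)"

definition MN_bracket ::
  "('k::field \<Rightarrow> 'w::ab_group_add \<Rightarrow> 'w) \<Rightarrow> nat \<Rightarrow> nat \<Rightarrow>
   ('w list \<Rightarrow> 'w) \<Rightarrow> ('w list \<Rightarrow> 'w) \<Rightarrow> 'w list \<Rightarrow> 'w" where
  "MN_bracket s p q F G = MN_circ s p q F G - fun_scale s ((- 1) ^ (p * q)) (MN_circ s q p G F)"


section \<open>The bigrading of cochains on \<open>W = g \<oplus> V\<close>\<close>

abbreviation prod_scale ::
  "('k::field \<Rightarrow> 'a::ab_group_add \<Rightarrow> 'a) \<Rightarrow> ('k \<Rightarrow> 'b::ab_group_add \<Rightarrow> 'b) \<Rightarrow>
   'k \<Rightarrow> 'a \<times> 'b \<Rightarrow> 'a \<times> 'b" where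
  "prod_scale \<equiv> module_prod.scale"

abbreviation scaleL ::
  "('k::field \<Rightarrow> 'g::ab_group_add \<Rightarrow> 'g) \<Rightarrow> ('k \<Rightarrow> 'v::ab_group_add \<Rightarrow> 'v) \<Rightarrow>
   'k \<Rightarrow> (('g \<times> 'v) list \<Rightarrow> 'g \<times> 'v) \<Rightarrow> ('g \<times> 'v) list \<Rightarrow> 'g \<times> 'v" where
  "scaleL sg sv \<equiv> fun_scale (prod_scale sg sv)"

abbreviation cochains ::
  "('k::field \<Rightarrow> 'g::ab_group_add \<Rightarrow> 'g) \<Rightarrow> ('k \<Rightarrow> 'v::ab_group_add \<Rightarrow> 'v) \<Rightarrow> nat \<Rightarrow>
   (('g \<times> 'v) list \<Rightarrow> 'g \<times> 'v) set" where
  "cochains sg sv n \<equiv> wedge_hom (prod_scale sg sv) (prod_scale sg sv) n"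

definition total_cochains ::
  "('k::field \<Rightarrow> 'g::ab_group_add \<Rightarrow> 'g) \<Rightarrow> ('k \<Rightarrow> 'v::ab_group_add \<Rightarrow> 'v) \<Rightarrow>
   (('g \<times> 'v) list \<Rightarrow> 'g \<times> 'v) set" where
  "total_cochains sg sv = module.span (scaleL sg sv) (\<Union>n\<in>{1..}. cochains sg sv n)"

text \<open>
  Argument lists spanning \<open>G\<^sup>k\<^sup>,\<^sup>l\<close>: the \<open>k\<close> entries at the positions in \<open>I\<close> lie in \<open>g\<close>,
  the other \<open>l\<close> entries lie in \<open>V\<close>. There are none if \<open>k < 0\<close> or \<open>l < 0\<close>.
\<close>

definition bihom_args :: "int \<Rightarrow> int \<Rightarrow> ('g::zero \<times> 'v::zero) list set" where
  "bihom_args k l = {xs. \<exists>I\<subseteq>{..<length xs}. int (card I) = k \<and> int (length xs) = k + l \<and>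
     (\<forall>m<length xs. if m \<in> I then snd (xs ! m) = 0 else fst (xs ! m) = 0)}"

text \<open>\<open>C\<^sup>k\<^sup>|\<^sup>l(W;W)\<close>, for \<open>k + l \<ge> 0\<close>.\<close>

definition bicochains ::
  "('k::field \<Rightarrow> 'g::ab_group_add \<Rightarrow> 'g) \<Rightarrow> ('k \<Rightarrow> 'v::ab_group_add \<Rightarrow> 'v) \<Rightarrow> int \<Rightarrow> int \<Rightarrow>
   (('g \<times> 'v) list \<Rightarrow> 'g \<times> 'v) set" where
  "bicochains sg sv k l = {f \<in> cochains sg sv (nat (k + l + 1)).
     (\<forall>xs\<in>bihom_args (k + 1) l. snd (f xs) = 0) \<and>
     (\<forall>xs\<in>bihom_args k (l + 1). fst (f xs) = 0) \<and>
     (\<forall>i j. (i, j) \<noteq> (k + 1, l) \<longrightarrow> (i, j) \<noteq> (k, l + 1) \<longrightarrow> (\<forall>xs\<in>bihom_args i j. f xs = 0))}"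

text \<open>The degree \<open>n\<close> parts of \<open>L'\<close> and of \<open>h\<close>.\<close>

definition L'_part ::
  "('k::field \<Rightarrow> 'g::ab_group_add \<Rightarrow> 'g) \<Rightarrow> ('k \<Rightarrow> 'v::ab_group_add \<Rightarrow> 'v) \<Rightarrow> int \<Rightarrow>
   (('g \<times> 'v) list \<Rightarrow> 'g \<times> 'v) set" where
  "L'_part sg sv n = (if n \<ge> 0 then bicochains sg sv n 0 else {0})"

definition h_part ::
  "('k::field \<Rightarrow> 'g::ab_group_add \<Rightarrow> 'g) \<Rightarrow> ('k \<Rightarrow> 'v::ab_group_add \<Rightarrow> 'v) \<Rightarrow> int \<Rightarrow>
   (('g \<times> 'v) list \<Rightarrow> 'g \<times> 'v) set" where
  "h_part sg sv n = (if n \<ge> 0 then bicochains sg sv (n + 1) (- 1) else {0})"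

definition is_projection_h ::
  "('k::field \<Rightarrow> 'g::ab_group_add \<Rightarrow> 'g) \<Rightarrow> ('k \<Rightarrow> 'v::ab_group_add \<Rightarrow> 'v) \<Rightarrow>
   ((('g \<times> 'v) list \<Rightarrow> 'g \<times> 'v) \<Rightarrow> (('g \<times> 'v) list \<Rightarrow> 'g \<times> 'v)) \<Rightarrow> bool" where
  "is_projection_h sg sv P \<longleftrightarrow>
     (\<forall>F\<in>total_cochains sg sv. \<forall>G\<in>total_cochains sg sv. P (F + G) = P F + P G) \<and>
     (\<forall>c. \<forall>F\<in>total_cochains sg sv. P (scaleL sg sv c F) = scaleL sg sv c (P F)) \<and>
     (\<forall>n. \<forall>\<theta>\<in>h_part sg sv n. P \<theta> = \<theta>) \<and>
     (\<forall>k l. k + l \<ge> 0 \<longrightarrow> l \<noteq> - 1 \<longrightarrow> (\<forall>F\<in>bicochains sg sv k l. P F = 0))"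


section \<open>Horizontal lifts\<close>

definition hlift :: "('g list \<Rightarrow> 'v) \<Rightarrow> ('g \<times> 'v) list \<Rightarrow> 'g::zero \<times> 'v" where
  "hlift f xs = (0, f (map fst xs))"

text \<open>
  The lifts of \<open>\<pi> \<in> Hom(g \<otimes> g, g)\<close>, \<open>\<rho> \<in> Hom(g \<otimes> V, V)\<close>, \<open>\<mu> \<in> Hom(V \<otimes> g, V)\<close> and
  \<open>D \<in> Hom(g, V)\<close>. For \<open>\<mu>\<close> the defining alternating sum has a single term, with sign \<open>+\<close>.
\<close>

fun lift_pi :: "('g \<Rightarrow> 'g \<Rightarrow> 'g) \<Rightarrow> ('g::zero \<times> 'v::zero) list \<Rightarrow> 'g \<times> 'v" where
  "lift_pi \<pi> [(x, v), (y, w)] = (\<pi> x y, 0)"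
| "lift_pi \<pi> _ = 0"

fun lift_rho :: "('g \<Rightarrow> 'v \<Rightarrow> 'v) \<Rightarrow> ('g::zero \<times> 'v::zero) list \<Rightarrow> 'g \<times> 'v" where
  "lift_rho \<rho> [(x, v), (y, w)] = (0, \<rho> x w)"
| "lift_rho \<rho> _ = 0"

fun lift_mu :: "('v \<Rightarrow> 'g \<Rightarrow> 'v) \<Rightarrow> ('g::zero \<times> 'v::zero) list \<Rightarrow> 'g \<times> 'v" where
  "lift_mu \<mu> [(x, v), (y, w)] = (0, \<mu> v y)"
| "lift_mu \<mu> _ = 0"

fun lift_D :: "('g \<Rightarrow> 'v) \<Rightarrow> ('g::zero \<times> 'v::zero) list \<Rightarrow> 'g \<times> 'v" where
  "lift_D D [(x, v)] = (0, D x)"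
| "lift_D D _ = 0"


context vector_space_pair
begin

lemma prod_scale_eq: "module_prod.scale s1 s2 = (\<lambda>c w. (s1 c (fst w), s2 c (snd w)))"
  using module_prod.scale_def[of s1 s2] by (simp add: fun_eq_iff module_prod_def module_pair_axioms)

lemma vector_space_prod_scale: "vector_space (prod_scale s1 s2)"
  unfolding prod_scale_eq
  by unfold_locales (auto simp: vs1.scale_right_distrib vs2.scale_right_distrib
     vs1.scale_left_distrib vs2.scale_left_distrib)
lemma linear_map_add: "Vector_Spaces.linear a b f \<Longrightarrow> f (x+y) = f x + f y"
  by (rule module_hom.add, rule Vector_Spaces.linear.axioms(3))
lemma linear_map_0: "Vector_Spaces.linear a b f \<Longrightarrow> f 0 = 0"
  by (rule module_hom.zero, rule Vector_Spaces.linear.axioms(3))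

lemma bicochains_other:
  assumes "f \<in> bicochains s1 s2 k l" "(i, j) \<noteq> (k + 1, l)" "(i, j) \<noteq> (k, l + 1)" "xs \<in> bihom_args i j"
  shows "f xs = 0"
proof -
  have "\<forall>i j. (i, j) \<noteq> (k + 1, l) \<longrightarrow> (i, j) \<noteq> (k, l + 1) \<longrightarrow> (\<forall>xs\<in>bihom_args i j. f xs = 0)"
    using assms(1) unfolding bicochains_def mem_Collect_eq by (elim conjE)
  from this[rule_format, OF assms(2-4)] show ?thesis .
qed

lemma bicochain_vanish:
  assumes f: "f \<in> bicochains s1 s2 k (- 1)" and len: "int (length xs) = k" and i: "i < length xs" "fst (xs ! i) = 0"
  shows "f xs = 0"
proof -
  define N where "N xs = card {m. m < length xs \<and> fst (xs ! m) \<noteq> 0 \<and> snd (xs ! m) \<noteq> 0}" for xs :: "('b \<times> 'c) list"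
  show ?thesis using len i
  proof (induction "N xs" arbitrary: xs rule: less_induct)
    case less
    show ?case
    proof (cases "N xs = 0")
      case True
      then have h: "fst (xs ! m) = 0 \<or> snd (xs ! m) = 0" if "m < length xs" for m
        using that by (auto simp: N_def)
      define I where "I = {m. m < length xs \<and> m \<noteq> i \<and> snd (xs ! m) = 0}"
      have "I \<subseteq> {..<length xs} - {i}" by (auto simp: I_def)
      then have c: "card I \<le> length xs - 1"
        using card_mono[of "{..<length xs} - {i}" I] less.prems by simp
      have "xs \<in> bihom_args (int (card I)) (k - int (card I))"
      proof -
        have 1: "I \<subseteq> {..<length xs}" by (auto simp: I_def)
        have 2: "if m \<in> I then snd (xs ! m) = 0 else fst (xs ! m) = 0" if "m < length xs" for m
          using h[OF that] that less.prems by (cases "m = i") (simp_all add: I_def, argo)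
        show ?thesis unfolding bihom_args_def using 1 2 less.prems(1) by auto
      qed
      moreover have "int (card I) < k" using c less.prems by linarith
      ultimately show ?thesis by (intro bicochains_other[OF f]) auto
    next
      case False
      then obtain m where m: "m < length xs" "fst (xs ! m) \<noteq> 0" "snd (xs ! m) \<noteq> 0"
        by (auto simp: N_def)
      obtain a b where ab: "xs ! m = (a, b)" by fastforce
      have lin: "Vector_Spaces.linear (prod_scale s1 s2) (prod_scale s1 s2) (\<lambda>x. f (xs[m := x]))"
        using f less.prems m by (auto simp: bicochains_def wedge_hom_def nat_eq_iff)
      have "xs = xs[m := (a, 0) + (0, b)]" using ab m by (metis add.right_neutral add_Pair add_0 list_update_id)
      then have eq: "f xs = f (xs[m := (a, 0)]) + f (xs[m := (0, b)])"
        using linear_map_add[OF lin] by metis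
      have z: "f (xs[m := c]) = 0" if "fst c = 0 \<or> snd c = 0" for c
      proof (rule less.hyps)
        have "{j. j < length (xs[m:=c]) \<and> fst (xs[m:=c] ! j) \<noteq> 0 \<and> snd (xs[m:=c] ! j) \<noteq> 0} \<subset>
           {m. m < length xs \<and> fst (xs ! m) \<noteq> 0 \<and> snd (xs ! m) \<noteq> 0}"
          using m that by (auto simp: nth_list_update split: if_splits)
        then show "N (xs[m:=c]) < N xs" unfolding N_def by (intro psubset_card_mono) auto
      qed (use less.prems m in \<open>auto simp: nth_list_update\<close>)
      show ?thesis unfolding eq by (simp add: z)
    qed
  qed
qed

lemma bicochain_proj:
  assumes f: "f \<in> bicochains s1 s2 k (- 1)" and len: "int (length xs) = k"
  shows "f xs = f (map (\<lambda>x. (fst x, 0)) xs)"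
proof -
  have "f xs = f (map (\<lambda>x. (fst x, 0)) (take m xs) @ drop m xs)" if "m \<le> length xs" for m
    using that
  proof (induction m)
    case (Suc m)
    let ?ys = "map (\<lambda>x. (fst x, 0)) (take m xs) @ drop m xs"
    have m: "m < length xs" using Suc by simp
    obtain a b where ab: "xs ! m = (a, b)" by fastforce
    have lin: "Vector_Spaces.linear (prod_scale s1 s2) (prod_scale s1 s2) (\<lambda>x. f (?ys[m := x]))"
      using f len m by (auto simp: bicochains_def wedge_hom_def nat_eq_iff)
    have "?ys ! m = (a, b)" using m ab by (simp add: nth_append)
    then have "?ys = ?ys[m := (a, 0) + (0, b)]" using m
      by (metis add.right_neutral add_Pair add_0 list_update_id)
    then have eq: "f ?ys = f (?ys[m := (a, 0)]) + f (?ys[m := (0, b)])"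
      using linear_map_add[OF lin] by metis
    have "f (?ys[m := (0, b)]) = 0"
      by (rule bicochain_vanish[OF f, of _ m]) (use m len in auto)
    moreover have "?ys[m := (a, 0)] = map (\<lambda>x. (fst x, 0)) (take (Suc m) xs) @ drop (Suc m) xs"
      using m ab by (simp add: take_Suc_conv_app_nth list_update_append Cons_nth_drop_Suc[symmetric])
    ultimately show ?case using Suc eq by simp
  qed simp
  from this[of "length xs"] show ?thesis by simp
qed

text \<open>The projection \<open>P\<close> exists; it is determined on \<open>L\<close> since \<open>L\<close> is spanned by the bicochains.\<close>

lemma projection_h_exists: "is_projection_h s1 s2 (\<lambda>F xs. (0, snd (F (map (\<lambda>x. (fst x, 0)) xs))))"
proof -
  let ?P = "\<lambda>(F::('b \<times> 'c) list \<Rightarrow> 'b \<times> 'c) (xs::('b \<times> 'c) list). (0::'b, snd (F (map (\<lambda>x. (fst x, 0)) xs)))"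
  have id: "?P \<theta> = \<theta>" if "\<theta> \<in> h_part s1 s2 n" for \<theta> n
  proof (cases "n \<ge> 0")
    case False then show ?thesis using that by (auto simp: h_part_def fun_eq_iff zero_prod_def)
  next
    case True
    then have b: "\<theta> \<in> bicochains s1 s2 (n + 1) (-1)" using that by (simp add: h_part_def)
    show ?thesis
    proof
      fix xs
      show "?P \<theta> xs = \<theta> xs"
      proof (cases "int (length xs) = n + 1")
        case l: True
        let ?ys = "map (\<lambda>x. (fst x, 0)) xs"
        have "?ys \<in> bihom_args (n + 1) 0" 
          unfolding bihom_args_def using l by (auto intro!: exI[of _ "{..<length xs}"])
        then have "fst (\<theta> ?ys) = 0" using b by (auto simp: bicochains_def)
        then show ?thesis using bicochain_proj[OF b l] by (metis prod.collapse)
      next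
        case False
        then have "length xs \<noteq> nat (n + 1)" using True by linarith
        then have "\<theta> ys = 0" if "length ys = length xs" for ys
          using b that by (simp add: bicochains_def wedge_hom_def)
        then show ?thesis by (simp add: zero_prod_def)
      qed
    qed
  qed
  have "?P F = 0" if "k + l \<ge> 0" "l \<noteq> - 1" "F \<in> bicochains s1 s2 k l" for k l F
  proof
    fix xs :: "('b \<times> 'c) list"
    let ?ys = "map (\<lambda>x. (fst x, 0)) xs :: ('b \<times> 'c) list"
    have "snd (F ?ys) = 0"
    proof (cases "int (length xs) = k + l + 1")
      case True
      have "?ys \<in> bihom_args (k + l + 1) 0" 
        unfolding bihom_args_def using True by (auto intro!: exI[of _ "{..<length xs}"])
      then show ?thesis
        using that(2,3) bicochains_other[OF that(3), of "k + l + 1" 0 ?ys]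
        by (cases "l = 0") (auto simp: bicochains_def)
    next
      case False
      then have "F ?ys = 0"
        using that by (auto simp: bicochains_def wedge_hom_def nat_eq_iff)
      then show ?thesis by simp
    qed
    then show "?P F xs = 0 xs" by (simp add: zero_prod_def)
  qed
  moreover have "?P (F + G) = ?P F + ?P G" "?P (scaleL s1 s2 c F) = scaleL s1 s2 c (?P F)" for F G c
    by (auto simp: fun_eq_iff fun_scale_def prod_scale_eq zero_prod_def)
  ultimately show ?thesis unfolding is_projection_h_def using id by simp
qed

lemma wedge_hom_alt:
  assumes "f \<in> wedge_hom sA sB n" "length xs = n" "i < j" "j < n - 1" "xs ! i = xs ! j"
  shows "f xs = 0"
proof -
  have "\<forall>xs i j. length xs = n \<longrightarrow> i < j \<longrightarrow> j < n - 1 \<longrightarrow> xs ! i = xs ! j \<longrightarrow> f xs = 0"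
    using assms(1) unfolding wedge_hom_def mem_Collect_eq by (elim conjE)
  from this[rule_format, OF assms(2-5)] show ?thesis .
qed

text \<open>The identification \<open>Hom(\<Lambda>\<^sup>n g \<otimes> g, V) \<cong> C\<^sup>n\<^sup>+\<^sup>1\<^sup>|\<^sup>-\<^sup>1(W;W)\<close> by horizontal lifts.\<close>

lemma h_part_eq_hlift:
  assumes n: "n \<ge> 0"
  shows "h_part s1 s2 n = hlift ` wedge_hom s1 s2 (nat (n + 1))" (is "?A = ?B")
proof (intro equalityI subsetI)
  fix \<theta> assume "\<theta> \<in> ?A"
  then have b: "\<theta> \<in> bicochains s1 s2 (n + 1) (-1)" using n by (simp add: h_part_def)
  define f where "f = (\<lambda>xs. snd (\<theta> (map (\<lambda>x. (x, 0)) xs)))"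
  have "\<theta> = (\<lambda>xs. (0, snd (\<theta> (map (\<lambda>x. (fst x, 0)) xs))))"
    using conjunct1[OF conjunct2[OF conjunct2[OF projection_h_exists[unfolded is_projection_h_def]]], rule_format, OF \<open>\<theta> \<in> ?A\<close>] by (rule sym)
  also have "\<dots> = hlift f" by (simp add: hlift_def f_def fun_eq_iff comp_def)
  finally have "\<theta> = hlift f" .
  moreover have "f \<in> wedge_hom s1 s2 (nat (n + 1))"
  proof -
    have lin: "Vector_Spaces.linear s1 s2 (\<lambda>x. f (xs[i := x]))"
      if "length xs = nat (n + 1)" "i < nat (n + 1)" for xs i
    proof -
      have l: "Vector_Spaces.linear (prod_scale s1 s2) (prod_scale s1 s2) (\<lambda>x. \<theta> ((map (\<lambda>x. (x, 0)) xs)[i := x]))"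
        using b that by (auto simp: bicochains_def wedge_hom_def)
      then interpret l: Vector_Spaces.linear "prod_scale s1 s2" "prod_scale s1 s2" "\<lambda>x. \<theta> ((map (\<lambda>x. (x, 0)) xs)[i := x])" .
      show ?thesis
      proof (unfold_locales, goal_cases)
        case (1 x y)
        show ?case using l.add[of "(x,0)" "(y,0)"] by (simp add: f_def map_update)
      next
        case (2 r x)
        show ?case using l.scale[of r "(x,0)"] by (simp add: f_def map_update prod_scale_eq)
      qed
    qed
    show ?thesis unfolding wedge_hom_def
    proof (intro CollectI conjI allI impI)
      fix xs :: "'b list" assume "length xs \<noteq> nat (n + 1)"
      then show "f xs = 0" using b by (simp add: f_def bicochains_def wedge_hom_def)
    next
      fix xs :: "'b list" and i j
      assume a: "length xs = nat (n + 1)" "i < j" "j < nat (n + 1) - 1" "xs ! i = xs ! j"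
      let ?ys = "map (\<lambda>x. (x, 0::'c)) xs"
      have y: "?ys ! i = ?ys ! j" "length ?ys = nat (n+1)" using a by auto
      have "\<theta> \<in> cochains s1 s2 (nat (n + 1))" using b by (simp add: bicochains_def)
      from wedge_hom_alt[OF this y(2) a(2,3) y(1)] have "\<theta> ?ys = 0" .
      then show "f xs = 0" by (simp add: f_def)
    qed (fact lin)
  qed
  ultimately show "\<theta> \<in> ?B" by blast
next
  fix \<theta> assume "\<theta> \<in> ?B"
  then obtain f where f: "f \<in> wedge_hom s1 s2 (nat (n + 1))" and t: "\<theta> = hlift f" by blast
  have "\<theta> \<in> bicochains s1 s2 (n + 1) (-1)"
    unfolding bicochains_def
  proof (intro CollectI conjI ballI allI impI)
    interpret PS: vector_space "prod_scale s1 s2" by (rule vector_space_prod_scale)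
    show "\<theta> \<in> cochains s1 s2 (nat (n + 1 + -1 + 1))"
      unfolding wedge_hom_def
    proof (intro CollectI conjI allI impI)
      fix xs :: "('b \<times> 'c) list" and i
      assume a: "length xs = nat (n + 1 + -1 + 1)" "i < nat (n + 1 + -1 + 1)"
      have l: "Vector_Spaces.linear s1 s2 (\<lambda>x. f ((map fst xs)[i := x]))"
        using f a by (auto simp: wedge_hom_def)
      then interpret l: Vector_Spaces.linear s1 s2 "\<lambda>x. f ((map fst xs)[i := x])" .
      show "Vector_Spaces.linear (prod_scale s1 s2) (prod_scale s1 s2) (\<lambda>x. \<theta> (xs[i := x]))"
        by (unfold_locales) (auto simp: t hlift_def map_update l.add l.scale prod_scale_eq)
    next
      fix xs :: "('b \<times> 'c) list" 
      assume "length xs \<noteq> nat (n + 1 + -1 + 1)"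
      then show "\<theta> xs = 0" using f by (simp add: t hlift_def zero_prod_def wedge_hom_def)
    next
      fix xs :: "('b \<times> 'c) list" and i j
      assume a: "length xs = nat (n + 1 + -1 + 1)" "i < j" "j < nat (n + 1 + -1 + 1) - 1" "xs ! i = xs ! j"
      then have "map fst xs ! i = map fst xs ! j" by simp
      moreover have "length (map fst xs) = nat (n+1)" using a by simp
      moreover have "j < nat (n+1) - 1" using a by simp
      ultimately have "f (map fst xs) = 0"
        by (intro wedge_hom_alt[OF f _ a(2)])
      then show "\<theta> xs = 0" by (simp add: t hlift_def zero_prod_def)
    qed
  next
    fix xs :: "('b \<times> 'c) list" assume "xs \<in> bihom_args (n + 1 + 1) (- 1)"
    then obtain I where "I \<subseteq> {..<length xs}" "int (card I) = n + 2" "int (length xs) = n + 1"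
      by (auto simp: bihom_args_def)
    then show "snd (\<theta> xs) = 0" using card_mono[of "{..<length xs}" I] by simp
  next
    fix xs :: "('b \<times> 'c) list"
    show "fst (\<theta> xs) = 0" by (simp add: t hlift_def)
  next
    fix i j and xs :: "('b \<times> 'c) list"
    assume a: "(i, j) \<noteq> (n + 1 + 1, - 1)" "(i, j) \<noteq> (n + 1, - 1 + 1)" "xs \<in> bihom_args i j"
    then obtain I where I: "I \<subseteq> {..<length xs}" "int (card I) = i" "int (length xs) = i + j"
        and z: "\<And>m. m < length xs \<Longrightarrow> m \<notin> I \<Longrightarrow> fst (xs ! m) = 0" by (auto simp: bihom_args_def)
    show "\<theta> xs = 0"
    proof (cases "length xs = nat (n + 1)")
      case False
      then show ?thesis using f by (simp add: t hlift_def zero_prod_def wedge_hom_def)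
    next
      case True
      have "I \<noteq> {..<length xs}"
      proof
        assume "I = {..<length xs}"
        then have "card I = length xs" by simp
        then have "i = n + 1" "j = 0" using I(2,3) True n by linarith+
        then show False using a by simp
      qed
      then obtain m where m: "m < length xs" "m \<notin> I" using I by auto
      have l: "Vector_Spaces.linear s1 s2 (\<lambda>x. f ((map fst xs)[m := x]))"
        using f m True by (auto simp: wedge_hom_def)
      have "(map fst xs)[m := 0] = map fst xs" using z[OF m] m by (metis list_update_id nth_map)
      then have "f (map fst xs) = 0" using linear_map_0[OF l] by simp
      then show ?thesis by (simp add: t hlift_def zero_prod_def)
    qed
  qed
  then show "\<theta> \<in> ?A" using n by (simp add: h_part_def)
qed

end


section \<open>\<open>L\<^sub>\<infinity>\<close>-algebras\<close>

text \<open>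
  A graded vector space is a family \<open>E\<close> of subspaces, \<open>E d\<close> being the part of degree \<open>d\<close>.
  Homogeneous elements are given as pairs of a degree and an element of that degree, so that the
  signs are determined also for \<open>0\<close>. The structure map \<open>l\<^sub>k\<close> is \<open>l\<close> on lists of length \<open>k\<close>.
\<close>

definition homogeneous :: "(int \<Rightarrow> 'a set) \<Rightarrow> (int \<times> 'a) list \<Rightarrow> bool" where
  "homogeneous E xs \<longleftrightarrow> (\<forall>(d, x)\<in>set xs. x \<in> E d)"

abbreviation total_degree :: "(int \<times> 'a) list \<Rightarrow> int" where
  "total_degree xs \<equiv> sum_list (map fst xs)"

text \<open>The Koszul sign of \<open>x\<^sub>1 \<dots> x\<^sub>n \<mapsto> x\<^sub>\<sigma>\<^sub>(\<^sub>1\<^sub>) \<dots> x\<^sub>\<sigma>\<^sub>(\<^sub>n\<^sub>)\<close>, one factor for each inversion of \<open>\<sigma>\<close>.\<close>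

definition koszul_sign :: "(nat \<Rightarrow> nat) \<Rightarrow> int list \<Rightarrow> 'k::field" where
  "koszul_sign \<sigma> ds =
     (\<Prod>(i, j)\<in>{(i, j). i < j \<and> j < length ds \<and> \<sigma> j < \<sigma> i}. (- 1) powi (ds ! \<sigma> i * ds ! \<sigma> j))"

locale L_infinity_algebra = vector_space scale
  for scale :: "'k::field_char_0 \<Rightarrow> 'a::ab_group_add \<Rightarrow> 'a" +
  fixes E :: "int \<Rightarrow> 'a set"
    and l :: "(int \<times> 'a) list \<Rightarrow> 'a"
  assumes subspaces: "subspace (E d)"
    and degree_1: "xs \<noteq> [] \<Longrightarrow> homogeneous E xs \<Longrightarrow> l xs \<in> E (total_degree xs + 1)"
    and multi_add: "homogeneous E xs \<Longrightarrow> i < length xs \<Longrightarrow> x \<in> E (fst (xs ! i)) \<Longrightarrow> y \<in> E (fst (xs ! i)) \<Longrightarrow>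
      l (xs[i := (fst (xs ! i), x + y)]) =
      l (xs[i := (fst (xs ! i), x)]) + l (xs[i := (fst (xs ! i), y)])"
    and multi_scale: "homogeneous E xs \<Longrightarrow> i < length xs \<Longrightarrow> x \<in> E (fst (xs ! i)) \<Longrightarrow>
      l (xs[i := (fst (xs ! i), scale c x)]) = scale c (l (xs[i := (fst (xs ! i), x)]))"
    and graded_symmetric: "homogeneous E xs \<Longrightarrow> \<sigma> permutes {..<length xs} \<Longrightarrow>
      l xs = scale (koszul_sign \<sigma> (map fst xs)) (l (permute_list \<sigma> xs))"
    and generalized_Jacobi: "homogeneous E xs \<Longrightarrow> xs \<noteq> [] \<Longrightarrow>
      (\<Sum>i\<in>{1..length xs}. \<Sum>\<sigma>\<in>unshuffles [i, length xs - i].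
         let ys = permute_list \<sigma> xs; us = take i ys
         in scale (koszul_sign \<sigma> (map fst xs)) (l ((total_degree us + 1, l us) # drop i ys))) = 0"

text \<open>
  The Maurer-Cartan sum is required to have only finitely many nonzero terms.
\<close>

definition maurer_cartan ::
  "('k::field_char_0 \<Rightarrow> 'a::ab_group_add \<Rightarrow> 'a) \<Rightarrow> (int \<Rightarrow> 'a set) \<Rightarrow>
   ((int \<times> 'a) list \<Rightarrow> 'a) \<Rightarrow> 'a \<Rightarrow> bool" where
  "maurer_cartan s E l \<alpha> \<longleftrightarrow> \<alpha> \<in> E 0 \<and>
     (let t = (\<lambda>k. s (1 / fact k) (l (replicate k (0, \<alpha>)))); K = {k. k \<ge> 1 \<and> t k \<noteq> 0}
      in finite K \<and> (\<Sum>k\<in>K. t k) = 0)"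


section \<open>The \<open>L\<^sub>\<infinity>\<close>-algebra of pre-LieDer pairs\<close>

text \<open>
  The pair \<open>(f, \<theta>)\<close> stands for \<open>(s\<^sup>-\<^sup>1 f, \<theta>)\<close>; if it has degree \<open>i\<close>, then \<open>|f| = i + 1\<close> and
  \<open>|\<theta>| = i\<close>.
\<close>

abbreviation LD_scale ::
  "('k::field \<Rightarrow> 'g::ab_group_add \<Rightarrow> 'g) \<Rightarrow> ('k \<Rightarrow> 'v::ab_group_add \<Rightarrow> 'v) \<Rightarrow> 'k \<Rightarrow>
   (('g \<times> 'v) list \<Rightarrow> 'g \<times> 'v) \<times> (('g \<times> 'v) list \<Rightarrow> 'g \<times> 'v) \<Rightarrow>
   (('g \<times> 'v) list \<Rightarrow> 'g \<times> 'v) \<times> (('g \<times> 'v) list \<Rightarrow> 'g \<times> 'v)" where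
  "LD_scale sg sv \<equiv> prod_scale (scaleL sg sv) (scaleL sg sv)"

definition LD_space ::
  "('k::field \<Rightarrow> 'g::ab_group_add \<Rightarrow> 'g) \<Rightarrow> ('k \<Rightarrow> 'v::ab_group_add \<Rightarrow> 'v) \<Rightarrow> int \<Rightarrow>
   ((('g \<times> 'v) list \<Rightarrow> 'g \<times> 'v) \<times> (('g \<times> 'v) list \<Rightarrow> 'g \<times> 'v)) set" where
  "LD_space sg sv i = L'_part sg sv (i + 1) \<times> h_part sg sv i"

text \<open>
  The second component of \<open>l\<^sub>2\<close> collects \<open>l\<^sub>2(s\<^sup>-\<^sup>1 f, \<eta>) = P[f, \<eta>]\<close> and
  \<open>l\<^sub>2(\<theta>, s\<^sup>-\<^sup>1 g) = (-1)\<^sup>i\<^sup>j l\<^sub>2(s\<^sup>-\<^sup>1 g, \<theta>) = (-1)\<^sup>i\<^sup>j P[g, \<theta>]\<close>. The truncation by \<^term>\<open>nat\<close> is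
  harmless, as the component in question is \<open>0\<close> in negative degrees.
\<close>

fun LD_brackets ::
  "('k::field \<Rightarrow> 'g::ab_group_add \<Rightarrow> 'g) \<Rightarrow> ('k \<Rightarrow> 'v::ab_group_add \<Rightarrow> 'v) \<Rightarrow>
   ((('g \<times> 'v) list \<Rightarrow> 'g \<times> 'v) \<Rightarrow> (('g \<times> 'v) list \<Rightarrow> 'g \<times> 'v)) \<Rightarrow>
   (int \<times> (('g \<times> 'v) list \<Rightarrow> 'g \<times> 'v) \<times> (('g \<times> 'v) list \<Rightarrow> 'g \<times> 'v)) list \<Rightarrow>
   (('g \<times> 'v) list \<Rightarrow> 'g \<times> 'v) \<times> (('g \<times> 'v) list \<Rightarrow> 'g \<times> 'v)" where
  "LD_brackets sg sv P [(i, f, \<theta>), (j, g, \<eta>)] =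
     (scaleL sg sv ((- 1) powi (i + 1)) (MN_bracket (prod_scale sg sv) (nat (i + 1)) (nat (j + 1)) f g),
      P (MN_bracket (prod_scale sg sv) (nat (i + 1)) (nat j) f \<eta>) +
      scaleL sg sv ((- 1) powi (i * j)) (P (MN_bracket (prod_scale sg sv) (nat (j + 1)) (nat i) g \<theta>)))"
| "LD_brackets sg sv P _ = 0"

end

(*
  The Matsushima-Nijenhuis product F o G inserts G into F in all possible ways, antisymmetrised over
  unshuffles. Unshuffle sums satisfy a coassociativity and a graded cocommutativity law, so the
  associator of o reduces to the terms in which two cochains are inserted into two different slots of
  the third. These are graded symmetric, i.e. o is a graded right pre-Lie product, and the graded
  Jacobi identity follows.

  A cochain lies in C^{k|l} iff it lowers the V-weight by l. Hence [L', L'] lies in L' and [L', h] in h,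
  the projection P acts as the identity on all brackets that occur, and the only nontrivial generalised
  Jacobi identity is the one for three arguments, a signed form of the graded Jacobi identity.

  For F = pi + rho + mu, the Maurer-Cartan equation says [F, F] = 0, i.e. F is a pre-Lie product on
  g + V (the semidirect product), and [F, D] = 0, i.e. D is a derivation.
*)

theory Submission
  imports Defs
begin

section \<open>Signed sums over unshuffles\<close>

text \<open>Nested sums over permutations with permutation signs are hard to rearrange directly.
  They are replaced by the recursions \<open>usum\<close> and \<open>asum\<close> along the argument
  list, for which coassociativity and cocommutativity are list inductions. All sums run over the
  arguments but the last, which is never shuffled. A (q,1,p-1)-unshuffle amounts to selecting the
  q+1 arguments of the inner map (\<open>usum\<close>) and then the one among them that goes to its
  last place (\<open>asum\<close>).

  Signs are an operation \<open>psgn\<close> on abelian groups that depends on a parity only, so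
  sign identities end in case distinctions over parities. Cochains are 0 on lists of the wrong
  length; hence the sums may run over splittings of all sizes, and a sign such as (-1)^(length A)
  becomes one in the degrees because all other terms vanish.

  The sign (-1)^|f| in the binary bracket is that of the degree shift: it turns graded antisymmetry
  on \<open>L'\<close> into graded symmetry on the desuspension. The desuspension starts in degree
  -1, so the second half of the proof works with integer degrees.\<close>

definition psgn :: "nat \<Rightarrow> 'b::ab_group_add \<Rightarrow> 'b" where
  "psgn n x = (if even n then x else - x)"

lemma psgn_simps [simp]:
  "psgn 0 x = x" "psgn n 0 = 0" "psgn n (psgn m x) = psgn (n + m) x" "psgn (Suc n) x = - psgn n x"
  "psgn n (- x) = - psgn n x"
  by (auto simp: psgn_def)

lemma psgn_add: "psgn n (x + y) = psgn n x + psgn n y"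
  by (simp add: psgn_def)

lemma psgn_diff: "psgn n (x - y) = psgn n x - psgn n y"
  by (simp add: psgn_def)

lemma psgn_cong: "even n = even m \<Longrightarrow> x = y \<Longrightarrow> psgn n x = psgn m y"
  by (simp add: psgn_def)

text \<open>
  \<open>usum xs \<phi>\<close> sums \<open>\<plusminus> \<phi> A B\<close> over all ways to split \<open>xs\<close> into two complementary sublists,
  \<open>asum xs f\<close> sums \<open>\<plusminus> f\<close> over all ways to move one entry of \<open>xs\<close> to the end.
\<close>

primrec usum :: "'a list \<Rightarrow> ('a list \<Rightarrow> 'a list \<Rightarrow> 'b::ab_group_add) \<Rightarrow> 'b" where
  "usum [] \<phi> = \<phi> [] []"
| "usum (x # xs) \<phi> = usum xs (\<lambda>A B. \<phi> (x # A) B) + usum xs (\<lambda>A B. psgn (length A) (\<phi> A (x # B)))"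

primrec asum :: "'a list \<Rightarrow> ('a list \<Rightarrow> 'b::ab_group_add) \<Rightarrow> 'b" where
  "asum [] f = 0"
| "asum (x # xs) f = asum xs (\<lambda>A. f (x # A)) + psgn (length xs) (f (xs @ [x]))"

section \<open>Calculus of \<open>usum\<close> and \<open>asum\<close>\<close>

lemma usum_cong:
  assumes "\<And>A B. length A + length B = length xs \<Longrightarrow> \<phi> A B = \<psi> A B"
  shows "usum xs \<phi> = usum xs \<psi>"
  using assms
proof (induction xs arbitrary: \<phi> \<psi>)
  case (Cons x xs)
  have "usum xs (\<lambda>A B. \<phi> (x # A) B) = usum xs (\<lambda>A B. \<psi> (x # A) B)"
    "usum xs (\<lambda>A B. psgn (length A) (\<phi> A (x # B))) = usum xs (\<lambda>A B. psgn (length A) (\<psi> A (x # B)))"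
    by (intro Cons.IH; simp add: Cons.prems)+
  then show ?case by simp
qed simp

lemma usum_add: "usum xs (\<lambda>A B. \<phi> A B + \<psi> A B) = usum xs \<phi> + usum xs \<psi>"
  by (induction xs arbitrary: \<phi> \<psi>) (simp_all add: psgn_add)

lemma usum_minus: "usum xs (\<lambda>A B. - \<phi> A B) = - usum xs \<phi>"
  by (induction xs arbitrary: \<phi>) simp_all

lemma usum_zero [simp]: "usum xs (\<lambda>A B. 0) = 0"
  by (induction xs) simp_all

lemma usum_psgn: "usum xs (\<lambda>A B. psgn n (\<phi> A B)) = psgn n (usum xs \<phi>)"
  by (simp add: psgn_def usum_minus)

lemma usum_eq_0:
  assumes "\<And>A B. length A + length B = length xs \<Longrightarrow> \<phi> A B = 0"
  shows "usum xs \<phi> = 0"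
  using usum_cong[of xs \<phi> "\<lambda>_ _. 0"] assms by simp

text \<open>The coefficients are only signs, so additivity of \<open>h\<close> suffices; no
  linearity over the field is involved.\<close>

lemma usum_hom:
  assumes "\<And>x y. h (x + y) = h x + h y"
  shows "h (usum xs \<phi>) = usum xs (\<lambda>A B. h (\<phi> A B))"
proof -
  have h0: "h 0 = 0" using assms[of 0 0] by simp
  have "h (- x) = - h x" for x
    using assms[of x "- x"] h0 by (simp add: add_eq_0_iff2 minus_unique)
  then have "h (psgn n x) = psgn n (h x)" for n x by (simp add: psgn_def)
  then show ?thesis by (induction xs arbitrary: \<phi>) (simp_all add: assms)
qed

text \<open>The moved entry is a one-element second block. It jumps over the entries behind it,
  which is the sign that \<open>usum\<close> assigns. Thus \<open>asum\<close> inherits the laws of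
  \<open>usum\<close>.\<close>

lemma asum_eq_usum:
  fixes f :: "'a list \<Rightarrow> 'b::ab_group_add"
  shows "asum xs f = usum xs (\<lambda>A B. if length B = 1 then f (A @ B) else 0)"
proof (induction xs arbitrary: f)
  case (Cons x xs)
  \<comment> \<open>If the head is the singleton block, everything else has to go to the first
    block, so a single splitting survives.\<close>
  have "usum xs (\<lambda>A B. if B = [] then g A else 0) = g xs" for g :: "'a list \<Rightarrow> 'b"
  proof (induction xs arbitrary: g)
    case (Cons a xs)
    show ?case using Cons[of "\<lambda>A. g (a # A)"] by simp
  qed simp
  from this[of "\<lambda>A. psgn (length A) (f (A @ [x]))"]
  have "usum xs (\<lambda>A B. psgn (length A) (if length (x # B) = 1 then f (A @ x # B) else 0)) =
      psgn (length xs) (f (xs @ [x]))"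
    by (simp add: if_distrib[of "psgn _"] cong: if_cong)
  then show ?case using Cons[of "\<lambda>A. f (x # A)"] by (simp cong: if_cong)
qed simp

lemma asum_cong:
  assumes "\<And>A. length A = length xs \<Longrightarrow> f A = g A"
  shows "asum xs f = asum xs g"
  unfolding asum_eq_usum using assms by (intro usum_cong) simp

lemma asum_add: "asum xs (\<lambda>A. f A + g A) = asum xs f + asum xs g"
  by (induction xs arbitrary: f g) (simp_all add: psgn_add)

lemma asum_minus: "asum xs (\<lambda>A. - f A) = - asum xs f"
  by (induction xs arbitrary: f) simp_all

lemma asum_psgn: "asum xs (\<lambda>A. psgn n (f A)) = psgn n (asum xs f)"
  by (simp add: psgn_def asum_minus)

lemma asum_zero [simp]: "asum xs (\<lambda>A. 0) = 0"
  by (induction xs) simp_all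

lemma asum_hom:
  assumes "\<And>x y. h (x + y) = h x + h y"
  shows "h (asum xs f) = asum xs (\<lambda>A. h (f A))"
proof -
  have "h 0 = 0" using assms[of 0 0] by simp
  then show ?thesis unfolding asum_eq_usum usum_hom[of h, OF assms] by (intro usum_cong) simp
qed

text \<open>Both sides sum over splittings into three blocks. The head joins A, B or C, and on
  either side it passes nothing, A, or A and B.\<close>

lemma usum_coassoc:
  "usum xs (\<lambda>S C. usum S (\<lambda>A B. \<phi> A B C)) = usum xs (\<lambda>A T. usum T (\<lambda>B C. \<phi> A B C))"
proof (induction xs arbitrary: \<phi>)
  case (Cons x xs)
  have "usum xs (\<lambda>S C. psgn (length S) (usum S (\<lambda>A B. \<phi> A B (x # C)))) =
      usum xs (\<lambda>S C. usum S (\<lambda>A B. psgn (length A + length B) (\<phi> A B (x # C))))"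
    unfolding usum_psgn[symmetric] by (intro usum_cong) simp
  then show ?case
    \<comment> \<open>The three instances are the cases of the head joining A, B and C.\<close>
    using Cons[of "\<lambda>A. \<phi> (x # A)"] Cons[of "\<lambda>A B. psgn (length A) \<circ> \<phi> A (x # B)"]
      Cons[of "\<lambda>A B C. psgn (length A + length B) (\<phi> A B (x # C))"]
    by (simp add: usum_add psgn_add usum_psgn[symmetric] algebra_simps)
qed simp

text \<open>Moving a block of length a past one of length b takes a b adjacent
  transpositions.\<close>

lemma usum_cocomm: "usum xs \<phi> = usum xs (\<lambda>A B. psgn (length A * length B) (\<phi> B A))"
proof (induction xs arbitrary: \<phi>)
  case (Cons x xs)
  have "usum xs (\<lambda>A B. psgn (length A * length B) (\<phi> (x # B) A)) =
      usum xs (\<lambda>A B. psgn (length A + length A * length (x # B)) (\<phi> (x # B) A))"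
    by (intro usum_cong psgn_cong) auto
  moreover have "usum xs (\<lambda>A B. psgn (length A * length B) (psgn (length B) (\<phi> B (x # A)))) =
      usum xs (\<lambda>A B. psgn (length (x # A) * length B) (\<phi> B (x # A)))"
    by (intro usum_cong) (simp add: add.commute)
  ultimately show ?case
    using Cons[of "\<lambda>A. \<phi> (x # A)"] Cons[of "\<lambda>A B. psgn (length A) (\<phi> A (x # B))"] by simp
qed simp

text \<open>Cocommutativity is applied to the first two blocks after regrouping by coassociativity;
  C stays in place.\<close>

lemma usum_swap:
  "usum xs (\<lambda>A T. usum T (\<lambda>B C. \<phi> A B C)) =
   usum xs (\<lambda>B T. usum T (\<lambda>A C. psgn (length A * length B) (\<phi> A B C)))"
proof -
  have "usum xs (\<lambda>S C. usum S (\<lambda>A B. \<phi> A B C)) =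
      usum xs (\<lambda>S C. usum S (\<lambda>B A. psgn (length A * length B) (\<phi> A B C)))"
    by (subst usum_cocomm) (simp add: mult.commute)
  then show ?thesis unfolding usum_coassoc .
qed

text \<open>Coassociativity with a third block of length one: the entry moved to the end is kept out
  of the splitting and ends up behind D.\<close>

lemma asum_coassoc:
  "asum xs (\<lambda>Z. usum (butlast Z) (\<lambda>C D. \<psi> C (D @ [last Z]))) = usum xs (\<lambda>C E. asum E (\<psi> C))"
proof -
  have "asum xs (\<lambda>Z. usum (butlast Z) (\<lambda>C D. \<psi> C (D @ [last Z]))) =
      usum xs (\<lambda>S U. usum S (\<lambda>C D. if length U = 1 then \<psi> C (D @ U) else 0))"
    unfolding asum_eq_usum by (intro usum_cong) (auto simp: length_Suc_conv butlast_append)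
  then show ?thesis unfolding usum_coassoc asum_eq_usum .
qed

text \<open>
  The unshuffles with given block lengths are the permutations that are increasing on the
  positions carrying equal labels, for a list of labels constant on the blocks. Removing the
  argument \<open>x\<^sub>1\<close>, which sits at the first occurrence of some label, gives a recursion.
\<close>

definition label_perms :: "'c list \<Rightarrow> (nat \<Rightarrow> nat) set" where
  "label_perms ls = {\<sigma>. \<sigma> permutes {..<length ls} \<and>
     (\<forall>i j. i < j \<longrightarrow> j < length ls \<longrightarrow> ls ! i = ls ! j \<longrightarrow> \<sigma> i < \<sigma> j)}"

definition first_pos :: "'c list \<Rightarrow> nat set" where
  "first_pos ls = {k. k < length ls \<and> (\<forall>i<k. ls ! i \<noteq> ls ! k)}"

text \<open>\<open>permute_list\<close> reads position \<open>k\<close> from index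
  \<open>\<sigma> k\<close>, so the value 0 at \<open>k\<close> puts the first argument into
  position \<open>k\<close>; the shifted \<tau> arranges the others.\<close>

definition ins_perm :: "nat \<Rightarrow> (nat \<Rightarrow> nat) \<Rightarrow> nat \<Rightarrow> nat" where
  "ins_perm k \<tau> i = (if i < k then Suc (\<tau> i) else if i = k then 0 else Suc (\<tau> (i - 1)))"

definition delete_at :: "nat \<Rightarrow> 'c list \<Rightarrow> 'c list" where
  "delete_at k xs = take k xs @ drop (Suc k) xs"

lemma length_delete_at: "k < length ls \<Longrightarrow> length (delete_at k ls) = length ls - 1"
  by (simp add: delete_at_def)

lemma nth_delete_at:
  "k < length ls \<Longrightarrow> i < length ls - 1 \<Longrightarrow> delete_at k ls ! i = ls ! (if i < k then i else Suc i)"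
  by (auto simp: delete_at_def nth_append min_def)

text \<open>Moving the first argument one place further is an adjacent transposition, which is where
  the factor (-1)^k in \<open>ins_perm_sign\<close> comes from.\<close>

lemma ins_perm_Suc: "ins_perm (Suc k) \<tau> = ins_perm k \<tau> \<circ> transpose k (Suc k)"
  by (auto simp: fun_eq_iff ins_perm_def transpose_def)

text \<open>Shifting by one turns a transposition on the left into a transposition, so a
  factorisation of \<tau> yields one of the same length for
  \<open>ins_perm 0 \<tau>\<close>.\<close>

lemma ins_perm_0_sign:
  assumes "\<tau> permutes {..<n}"
  shows "ins_perm 0 \<tau> permutes {..<Suc n} \<and> sign (ins_perm 0 \<tau>) = sign \<tau>"
  using assms finite_lessThan
proof (induction rule: permutes_induct)
  case id
  have "ins_perm 0 id = id" by (auto simp: fun_eq_iff ins_perm_def)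
  then show ?case by (metis permutes_id)
next
  case (swap a b p)
  have "ins_perm 0 (transpose a b \<circ> p) = transpose (Suc a) (Suc b) \<circ> ins_perm 0 p"
    by (auto simp: fun_eq_iff ins_perm_def transpose_def)
  moreover have "permutation p" "permutation (ins_perm 0 p)"
    using swap by (auto intro: permutes_imp_permutation[OF finite_lessThan])
  ultimately show ?case using swap
    by (auto simp: sign_compose permutation_swap_id sign_swap_id simp del: comp_apply
        intro!: permutes_compose permutes_swap_id)
qed

lemma ins_perm_sign:
  assumes "\<tau> permutes {..<n}" "k \<le> n"
  shows "ins_perm k \<tau> permutes {..<Suc n} \<and> sign (ins_perm k \<tau>) = (- 1) ^ k * sign \<tau>"
  using assms(2)
proof (induction k)
  case 0
  then show ?case using ins_perm_0_sign[OF assms(1)] by simp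
next
  case (Suc k)
  then have IH: "ins_perm k \<tau> permutes {..<Suc n}" "sign (ins_perm k \<tau>) = (- 1) ^ k * sign \<tau>" by auto
  have "sign (ins_perm (Suc k) \<tau>) = sign (ins_perm k \<tau>) * sign (transpose k (Suc k))"
    unfolding ins_perm_Suc 
    by (intro sign_compose permutation_swap_id permutes_imp_permutation[OF finite_lessThan IH(1)])
  moreover have "ins_perm (Suc k) \<tau> permutes {..<Suc n}"
    unfolding ins_perm_Suc using Suc.prems by (intro permutes_compose permutes_swap_id IH(1)) auto
  ultimately show ?case using IH(2) by (simp add: sign_swap_id)
qed

lemma permute_list_ins_perm:
  assumes "\<tau> permutes {..<length xs}" "k \<le> length xs"
  shows "permute_list (ins_perm k \<tau>) (x # xs) = take k (permute_list \<tau> xs) @ x # drop k (permute_list \<tau> xs)"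
proof (rule nth_equalityI)
  fix i assume "i < length (permute_list (ins_perm k \<tau>) (x # xs))"
  then have i: "i < Suc (length xs)" by simp
  consider "i < k" | "i = k" | "k < i" by linarith
  then show "permute_list (ins_perm k \<tau>) (x # xs) ! i =
      (take k (permute_list \<tau> xs) @ x # drop k (permute_list \<tau> xs)) ! i"
    using i assms by cases (auto simp: permute_list_def ins_perm_def nth_append nth_Cons' less_Suc_eq)
qed (use assms in simp)

lemma finite_label_perms: "finite (label_perms ls)"
  by (rule finite_subset[OF _ finite_permutations[of "{..<length ls}"]]) (auto simp: label_perms_def)

text \<open>The position that \<sigma> sends to 0 is the first one with its label, because \<sigma>
  increases on equal labels. Deleting this position and lowering all values by one inverts
  \<open>ins_perm\<close>.\<close>

lemma label_perms_decompose:
  "bij_betw (\<lambda>(k, \<tau>). ins_perm k \<tau>) (SIGMA k:first_pos ls. label_perms (delete_at k ls)) (label_perms ls)"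
  if ls: "ls \<noteq> []"
proof -
  define n where "n = length ls - 1"
  have n: "length ls = Suc n" using ls by (simp add: n_def)
  show ?thesis unfolding bij_betw_def
  proof (intro conjI inj_onI equalityI subsetI)
    fix a b :: "nat \<times> (nat \<Rightarrow> nat)"
    assume "(\<lambda>(k, \<tau>). ins_perm k \<tau>) a = (\<lambda>(k, \<tau>). ins_perm k \<tau>) b"
    moreover obtain k \<tau> l \<upsilon> where ab: "a = (k, \<tau>)" "b = (l, \<upsilon>)" by (cases a, cases b)
    ultimately have eq: "ins_perm k \<tau> i = ins_perm l \<upsilon> i" for i by (simp add: fun_eq_iff)
    have kl: "k = l" using eq[of k] by (simp add: ins_perm_def split: if_splits)
    have "\<tau> i = \<upsilon> i" for i
      using eq[of "if i < k then i else Suc i"] by (simp add: kl ins_perm_def split: if_splits)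
    then show "a = b" by (simp add: ab kl fun_eq_iff)
  next
    fix \<sigma> assume "\<sigma> \<in> (\<lambda>(k, \<tau>). ins_perm k \<tau>) ` (SIGMA k:first_pos ls. label_perms (delete_at k ls))"
    then obtain k \<tau> where k: "k \<in> first_pos ls" and t: "\<tau> \<in> label_perms (delete_at k ls)"
      and \<sigma>: "\<sigma> = ins_perm k \<tau>" by auto
    have kn: "k < Suc n" using k n by (simp add: first_pos_def)
    have len: "length (delete_at k ls) = n" using n kn by (simp add: length_delete_at)
    have "\<tau> permutes {..<n}" using t len by (simp add: label_perms_def)
    then have "\<sigma> permutes {..<Suc n}" using ins_perm_sign[of \<tau> n k] kn \<sigma> by simp
    moreover have "\<sigma> i < \<sigma> j" if ij: "i < j" "j < Suc n" "ls ! i = ls ! j" for i j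
    proof -
      have mono: "\<tau> a < \<tau> b" if "a < b" "b < n" "ls ! (if a < k then a else Suc a) = ls ! (if b < k then b else Suc b)" for a b
        using t that len kn n by (auto simp: label_perms_def nth_delete_at)
      have "j \<noteq> k" using k ij by (auto simp: first_pos_def)
      then consider "i < k" "j < k" | "i < k" "k < j" | "i = k" "k < j" | "k < i" "k < j"
        using ij by linarith
      then show ?thesis
      proof cases
        case 1
        then show ?thesis using ij kn mono[of i j] by (simp add: \<sigma> ins_perm_def)
      next
        case 2
        then have "\<tau> i < \<tau> (j - 1)" using ij by (intro mono) auto
        then show ?thesis using 2 by (simp add: \<sigma> ins_perm_def)
      next
        case 3
        then show ?thesis by (simp add: \<sigma> ins_perm_def)
      next
        case 4
        then have "\<tau> (i - 1) < \<tau> (j - 1)" using ij by (intro mono) auto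
        then show ?thesis using 4 by (simp add: \<sigma> ins_perm_def)
      qed
    qed
    ultimately show "\<sigma> \<in> label_perms ls" by (simp add: label_perms_def n)
  next
    fix \<sigma> assume s: "\<sigma> \<in> label_perms ls"
    then have p: "\<sigma> permutes {..<Suc n}"
      and mono: "\<And>i j. i < j \<Longrightarrow> j < Suc n \<Longrightarrow> ls ! i = ls ! j \<Longrightarrow> \<sigma> i < \<sigma> j"
      by (auto simp: label_perms_def n)
    have inj: "\<sigma> i = \<sigma> j \<Longrightarrow> i = j" for i j using permutes_inj[OF p] by (auto dest: injD)
    have "0 \<in> \<sigma> ` {..<Suc n}" using permutes_image[OF p] by simp
    then obtain k where k: "k < Suc n" "\<sigma> k = 0" by force
    have fk: "k \<in> first_pos ls" unfolding first_pos_def using k mono[of _ k] by (force simp: n)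
    have pos: "\<sigma> i > 0" if "i \<noteq> k" for i using inj[of i k] k that by (cases "\<sigma> i") auto
    \<comment> \<open>\<open>e\<close> enumerates the positions other than \<open>k\<close> in
      increasing order.\<close>
    define e where "e i = (if i < k then i else Suc i)" for i
    have e: "e i \<noteq> k" "e i = e j \<Longrightarrow> i = j" for i j by (auto simp: e_def split: if_splits)
    define \<tau> where "\<tau> i = (if i < n then \<sigma> (e i) - 1 else i)" for i
    have Suc_\<tau>: "Suc (\<tau> i) = \<sigma> (e i)" for i
    proof (cases "i < n")
      case True
      then show ?thesis using pos[OF e(1), of i] by (simp add: \<tau>_def)
    next
      case False
      then have "\<not> i < k" "Suc i \<notin> {..<Suc n}" using k by auto
      then show ?thesis using False permutes_not_in[OF p, of "Suc i"] by (simp add: \<tau>_def e_def)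
    qed
    have "inj_on \<tau> {..<n}"
    proof (rule inj_onI)
      fix i j assume "\<tau> i = \<tau> j"
      then have "\<sigma> (e i) = \<sigma> (e j)" by (metis Suc_\<tau>)
      then show "i = j" using inj e(2) by blast
    qed
    moreover have "\<tau> ` {..<n} \<subseteq> {..<n}"
    proof safe
      fix i assume "i < n"
      then have "e i \<in> {..<Suc n}" by (simp add: e_def)
      then have "\<sigma> (e i) \<in> {..<Suc n}" using permutes_in_image[OF p] by blast
      then show "\<tau> i < n" using Suc_\<tau>[of i] by simp
    qed
    ultimately have "bij_betw \<tau> {..<n} {..<n}"
      using endo_inj_surj[of "{..<n}" \<tau>] by (simp add: bij_betw_def)
    then have "\<tau> permutes {..<n}" by (rule bij_imp_permutes) (simp add: \<tau>_def)
    moreover have "\<tau> i < \<tau> j" if "i < j" "j < n" "delete_at k ls ! i = delete_at k ls ! j" for i j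
    proof -
      have "\<sigma> (e i) < \<sigma> (e j)"
        using that k n by (intro mono) (auto simp: nth_delete_at e_def)
      then show ?thesis using Suc_\<tau>[of i] Suc_\<tau>[of j] by simp
    qed
    ultimately have "\<tau> \<in> label_perms (delete_at k ls)"
      using k n by (simp add: label_perms_def length_delete_at)
    moreover have "\<sigma> = ins_perm k \<tau>"
      using k Suc_\<tau> by (auto simp: fun_eq_iff ins_perm_def e_def)
    ultimately show "\<sigma> \<in> (\<lambda>(k, \<tau>). ins_perm k \<tau>) ` (SIGMA k:first_pos ls. label_perms (delete_at k ls))"
      using fk by force
  qed
qed

section \<open>Sums over unshuffles as \<open>usum\<close> and \<open>asum\<close>\<close>

definition label_sum :: "'c list \<Rightarrow> ('a list \<Rightarrow> 'b::ab_group_add) \<Rightarrow> 'a list \<Rightarrow> 'b" where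
  "label_sum ls \<Phi> xs = (\<Sum>\<sigma>\<in>label_perms ls. if sign \<sigma> = 1 then \<Phi> (permute_list \<sigma> xs) else - \<Phi> (permute_list \<sigma> xs))"

lemma label_sum_Nil: "label_sum [] \<Phi> [] = \<Phi> []"
  by (simp add: label_sum_def label_perms_def)

text \<open>Expansion along the place of the first argument, in analogy to the Laplace expansion of
  a determinant; the sign (-1)^k is that of \<open>ins_perm_sign\<close>.\<close>

lemma label_sum_Cons:
  assumes "length ls = Suc (length xs)"
  shows "label_sum ls \<Phi> (x # xs) =
    (\<Sum>k\<in>first_pos ls. label_sum (delete_at k ls) (\<lambda>ys. psgn k (\<Phi> (take k ys @ x # drop k ys))) xs)"
proof -
  let ?f = "\<lambda>\<sigma>. if sign \<sigma> = 1 then \<Phi> (permute_list \<sigma> (x # xs)) else - \<Phi> (permute_list \<sigma> (x # xs))"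
  let ?g = "\<lambda>k \<tau>. let ys = permute_list \<tau> xs; z = psgn k (\<Phi> (take k ys @ x # drop k ys))
     in if sign \<tau> = 1 then z else - z"
  have "ls \<noteq> []" using assms by auto
  then have "label_sum ls \<Phi> (x # xs) = (\<Sum>(k, \<tau>)\<in>(SIGMA k:first_pos ls. label_perms (delete_at k ls)). ?f (ins_perm k \<tau>))"
    unfolding label_sum_def
    by (subst sum.reindex_bij_betw[OF label_perms_decompose, symmetric]) (auto intro!: sum.cong)
  also have "\<dots> = (\<Sum>(k, \<tau>)\<in>(SIGMA k:first_pos ls. label_perms (delete_at k ls)). ?g k \<tau>)"
  proof (intro sum.cong refl, clarify)
    fix k \<tau> assume k: "k \<in> first_pos ls" and t: "\<tau> \<in> label_perms (delete_at k ls)"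
    have kn: "k \<le> length xs" using k assms by (simp add: first_pos_def)
    then have "length (delete_at k ls) = length xs" using assms by (simp add: length_delete_at)
    then have p: "\<tau> permutes {..<length xs}" using t by (simp add: label_perms_def)
    show "?f (ins_perm k \<tau>) = ?g k \<tau>"
      using ins_perm_sign[OF p kn] permute_list_ins_perm[OF p kn, of x]
      by (cases \<tau> rule: sign_cases) (auto simp: psgn_def Let_def uminus_power_if)
  qed
  also have "\<dots> = (\<Sum>k\<in>first_pos ls. \<Sum>\<tau>\<in>label_perms (delete_at k ls). ?g k \<tau>)"
    by (subst sum.Sigma) (auto simp: first_pos_def finite_label_perms)
  finally show ?thesis by (simp add: label_sum_def Let_def)
qed

text \<open>The first argument heads one of the two blocks, so it lands at 0 or at \<open>p\<close>.
  These are the two summands in the recursion of \<open>usum\<close>; the sign for \<open>p\<close>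
  agrees because A has length \<open>p\<close>.\<close>

lemma label_sum_2:
  assumes "a \<noteq> b" "length xs = p + q"
  shows "label_sum (replicate p a @ replicate q b) \<Phi> xs =
    usum xs (\<lambda>A B. if length A = p then \<Phi> (A @ B) else 0)"
  using assms(2)
proof (induction xs arbitrary: p q \<Phi>)
  case (Cons x xs)
  let ?ls = "replicate p a @ replicate q b"
  have fp: "first_pos ?ls = (if p > 0 then {0} else {}) \<union> (if q > 0 then {p} else {})"
  proof (intro equalityI subsetI)
    fix k assume k: "k \<in> first_pos ?ls"
    then have "?ls ! 0 \<noteq> ?ls ! k \<or> k = 0" "p < k \<Longrightarrow> ?ls ! p \<noteq> ?ls ! k" "k < p + q"
      unfolding first_pos_def by auto
    then show "k \<in> (if p > 0 then {0} else {}) \<union> (if q > 0 then {p} else {})"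
      by (cases "k < p"; cases "k = p") (auto simp: nth_append)
  qed (use assms(1) in \<open>auto simp: first_pos_def nth_append split: if_splits\<close>)
  have 1: "label_sum (delete_at 0 ?ls) (\<lambda>ys. psgn 0 (\<Phi> (take 0 ys @ x # drop 0 ys))) xs =
      usum xs (\<lambda>A B. if length (x # A) = p then \<Phi> ((x # A) @ B) else 0)" if p: "p > 0"
  proof -
    have "delete_at 0 ?ls = replicate (p - 1) a @ replicate q b"
      using p by (cases p) (simp_all add: delete_at_def)
    then have "label_sum (delete_at 0 ?ls) (\<lambda>ys. psgn 0 (\<Phi> (take 0 ys @ x # drop 0 ys))) xs =
      usum xs (\<lambda>A B. if length A = p - 1 then \<Phi> ((x # A) @ B) else 0)"
      using Cons.IH[of "p - 1" q "\<lambda>ys. \<Phi> (x # ys)"] p Cons.prems by (simp cong: if_cong)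
    also have "\<dots> = usum xs (\<lambda>A B. if length (x # A) = p then \<Phi> ((x # A) @ B) else 0)"
      using p by (intro usum_cong) auto
    finally show ?thesis .
  qed
  have 2: "label_sum (delete_at p ?ls) (\<lambda>ys. psgn p (\<Phi> (take p ys @ x # drop p ys))) xs =
      usum xs (\<lambda>A B. psgn (length A) (if length A = p then \<Phi> (A @ x # B) else 0))" if q: "q > 0"
  proof -
    have "delete_at p ?ls = replicate p a @ replicate (q - 1) b"
      using q by (cases q) (simp_all add: delete_at_def)
    then have "label_sum (delete_at p ?ls) (\<lambda>ys. psgn p (\<Phi> (take p ys @ x # drop p ys))) xs =
      usum xs (\<lambda>A B. if length A = p then psgn p (\<Phi> (take p (A @ B) @ x # drop p (A @ B))) else 0)"
      using Cons.IH[of p "q - 1" "\<lambda>ys. psgn p (\<Phi> (take p ys @ x # drop p ys))"] q Cons.prems by simp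
    also have "\<dots> = usum xs (\<lambda>A B. psgn (length A) (if length A = p then \<Phi> (A @ x # B) else 0))"
      by (intro usum_cong) auto
    finally show ?thesis .
  qed
  \<comment> \<open>An empty block has no first position. The matching summand of
    \<open>usum\<close> vanishes too, as no A has the required length.\<close>
  have 3: "usum xs (\<lambda>A B. if length (x # A) = p then \<Phi> ((x # A) @ B) else 0) = 0" if "p = 0"
    using that by simp
  have 4: "usum xs (\<lambda>A B. psgn (length A) (if length A = p then \<Phi> (A @ x # B) else 0)) = 0" if "q = 0"
    using that Cons.prems by (intro usum_eq_0) auto
  have len: "length ?ls = Suc (length xs)" using Cons.prems by simp
  show ?case unfolding label_sum_Cons[OF len] fp usum.simps
    using 1 2 3 4 Cons.prems by (cases "p > 0"; cases "q > 0") auto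
qed (simp add: label_sum_Nil)

text \<open>A collects the first two blocks, and \<open>asum\<close> chooses which of its entries is
  the singleton block. The possible places 0, \<open>q\<close> and \<open>Suc q\<close> of the first
  argument match the summands of the two recursions.\<close>

lemma label_sum_3:
  assumes "a \<noteq> b" "b \<noteq> c" "a \<noteq> c" "length xs = q + 1 + r"
  shows "label_sum (replicate q a @ b # replicate r c) \<Phi> xs =
    usum xs (\<lambda>A D. if length A = Suc q then asum A (\<lambda>Z. \<Phi> (Z @ D)) else 0)"
  using assms(4)
proof (induction xs arbitrary: q r \<Phi>)
  case (Cons x xs)
  let ?ls = "replicate q a @ b # replicate r c"
  have fp: "first_pos ?ls = insert q ((if q > 0 then {0} else {}) \<union> (if r > 0 then {Suc q} else {}))"
  proof (intro equalityI subsetI)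
    fix k assume k: "k \<in> first_pos ?ls"
    then have "?ls ! 0 \<noteq> ?ls ! k \<or> k = 0" "Suc q < k \<Longrightarrow> ?ls ! Suc q \<noteq> ?ls ! k" "k < Suc (q + r)"
      unfolding first_pos_def by auto
    moreover have "?ls ! Suc q = c \<and> ?ls ! k = c" if "Suc q < k" "k < Suc (q + r)"
      using that by (simp add: nth_append nth_Cons')
    ultimately have "\<not> Suc q < k" "?ls ! 0 \<noteq> ?ls ! k \<or> k = 0" by auto
    then have "k = 0 \<or> k = q \<or> k = Suc q \<or> ?ls ! 0 \<noteq> ?ls ! k \<and> k < q" by linarith
    then show "k \<in> insert q ((if q > 0 then {0} else {}) \<union> (if r > 0 then {Suc q} else {}))"
      using \<open>k < Suc (q + r)\<close> by (auto simp: nth_append)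
  next
    fix k assume "k \<in> insert q ((if q > 0 then {0} else {}) \<union> (if r > 0 then {Suc q} else {}))"
    then consider "k = q" | "k = 0" "q > 0" | "k = Suc q" "r > 0" by (auto split: if_splits)
    then show "k \<in> first_pos ?ls"
      using assms(1-3) by cases (auto simp: first_pos_def nth_append nth_Cons')
  qed
  have 1: "label_sum (delete_at 0 ?ls) (\<lambda>ys. psgn 0 (\<Phi> (take 0 ys @ x # drop 0 ys))) xs =
      usum xs (\<lambda>A D. if length (x # A) = Suc q then asum A (\<lambda>Z. \<Phi> ((x # Z) @ D)) else 0)" if p: "q > 0"
  proof -
    have "delete_at 0 ?ls = replicate (q - 1) a @ b # replicate r c"
      using p by (cases q) (simp_all add: delete_at_def)
    then show ?thesis
      using Cons.IH[of "q - 1" r "\<lambda>ys. \<Phi> (x # ys)"] p Cons.prems by (simp cong: if_cong)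
  qed
  \<comment> \<open>Once the first argument fills the middle block, two blocks remain and
    \<open>label_sum_2\<close> applies.\<close>
  have 2: "label_sum (delete_at q ?ls) (\<lambda>ys. psgn q (\<Phi> (take q ys @ x # drop q ys))) xs =
      usum xs (\<lambda>A D. if length (x # A) = Suc q then psgn (length A) (\<Phi> ((A @ [x]) @ D)) else 0)"
  proof -
    have "delete_at q ?ls = replicate q a @ replicate r c" by (simp add: delete_at_def)
    then have "label_sum (delete_at q ?ls) (\<lambda>ys. psgn q (\<Phi> (take q ys @ x # drop q ys))) xs =
      usum xs (\<lambda>A B. if length A = q then psgn q (\<Phi> (take q (A @ B) @ x # drop q (A @ B))) else 0)"
      using label_sum_2[OF assms(3), of xs q r "\<lambda>ys. psgn q (\<Phi> (take q ys @ x # drop q ys))"] Cons.prems by simp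
    also have "\<dots> = usum xs (\<lambda>A D. if length (x # A) = Suc q then psgn (length A) (\<Phi> ((A @ [x]) @ D)) else 0)"
      by (intro usum_cong) auto
    finally show ?thesis .
  qed
  have 3: "label_sum (delete_at (Suc q) ?ls) (\<lambda>ys. psgn (Suc q) (\<Phi> (take (Suc q) ys @ x # drop (Suc q) ys))) xs =
      usum xs (\<lambda>A D. psgn (length A) (if length A = Suc q then asum A (\<lambda>Z. \<Phi> (Z @ x # D)) else 0))" if r: "r > 0"
  proof -
    let ?\<Phi> = "\<lambda>ys. psgn (Suc q) (\<Phi> (take (Suc q) ys @ x # drop (Suc q) ys))"
    have "delete_at (Suc q) ?ls = replicate q a @ b # replicate (r - 1) c"
      using r by (cases r) (simp_all add: delete_at_def)
    then have "label_sum (delete_at (Suc q) ?ls) ?\<Phi> xs =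
      usum xs (\<lambda>A D. if length A = Suc q then asum A (\<lambda>Z. ?\<Phi> (Z @ D)) else 0)"
      using Cons.IH[of q "r - 1" ?\<Phi>] r Cons.prems by simp
    also have "\<dots> = usum xs (\<lambda>A D. psgn (length A) (if length A = Suc q then asum A (\<lambda>Z. \<Phi> (Z @ x # D)) else 0))"
      by (intro usum_cong) (auto simp: asum_psgn[symmetric] asum_minus[symmetric] intro!: asum_cong)
    finally show ?thesis .
  qed
  have 4: "usum xs (\<lambda>A D. if length (x # A) = Suc q then asum A (\<lambda>Z. \<Phi> ((x # Z) @ D)) else 0) = 0" if "q = 0"
    using that by (intro usum_eq_0) auto
  have 5: "usum xs (\<lambda>A D. psgn (length A) (if length A = Suc q then asum A (\<lambda>Z. \<Phi> (Z @ x # D)) else 0)) = 0" if "r = 0"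
    using that Cons.prems by (intro usum_eq_0) auto
  have 6: "usum (x # xs) (\<lambda>A D. if length A = Suc q then asum A (\<lambda>Z. \<Phi> (Z @ D)) else 0) =
      usum xs (\<lambda>A D. if length (x # A) = Suc q then asum A (\<lambda>Z. \<Phi> ((x # Z) @ D)) else 0) +
      usum xs (\<lambda>A D. if length (x # A) = Suc q then psgn (length A) (\<Phi> ((A @ [x]) @ D)) else 0) +
      usum xs (\<lambda>A D. psgn (length A) (if length A = Suc q then asum A (\<lambda>Z. \<Phi> (Z @ x # D)) else 0))"
    unfolding usum.simps usum_add[symmetric] by (intro usum_cong arg_cong2[where f="(+)"]) auto
  have len: "length ?ls = Suc (length xs)" using Cons.prems by simp
  show ?case unfolding label_sum_Cons[OF len] fp 6
    using 1 2 3 4 5 Cons.prems by (cases "q > 0"; cases "r > 0") (auto simp: algebra_simps)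
qed simp

lemma unshuffles_2: "unshuffles [p, q] = label_perms (replicate p False @ replicate q True)"
proof -
  have "(\<forall>b<length [p, q]. strict_mono_on {sum_list (take b [p, q])..<sum_list (take (Suc b) [p, q])} \<sigma>) \<longleftrightarrow>
      strict_mono_on {0..<p} \<sigma> \<and> strict_mono_on {p..<p + q} \<sigma>" for \<sigma> :: "nat \<Rightarrow> nat"
    by (auto simp: less_Suc_eq)
  moreover have "strict_mono_on {0..<p} \<sigma> \<and> strict_mono_on {p..<p + q} \<sigma> \<longleftrightarrow>
      (\<forall>i j. i < j \<longrightarrow> j < p + q \<longrightarrow> (replicate p False @ replicate q True) ! i = (replicate p False @ replicate q True) ! j \<longrightarrow> \<sigma> i < \<sigma> j)" for \<sigma> :: "nat \<Rightarrow> nat"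
    by (auto simp: strict_mono_on_def nth_append)
  ultimately show ?thesis by (simp add: unshuffles_def label_perms_def)
qed

lemma unshuffles_3:
  "unshuffles [q, 1, r] = label_perms (replicate q (0::nat) @ 1 # replicate r 2)"
proof -
  have "(\<forall>b<length [q, 1, r]. strict_mono_on {sum_list (take b [q, 1, r])..<sum_list (take (Suc b) [q, 1, r])} \<sigma>) \<longleftrightarrow>
      strict_mono_on {0..<q} \<sigma> \<and> strict_mono_on {q..<Suc q} \<sigma> \<and> strict_mono_on {Suc q..<Suc q + r} \<sigma>" for \<sigma> :: "nat \<Rightarrow> nat"
    by (auto simp: less_Suc_eq)
  moreover have "strict_mono_on {0..<q} \<sigma> \<and> strict_mono_on {q..<Suc q} \<sigma> \<and> strict_mono_on {Suc q..<Suc q + r} \<sigma> \<longleftrightarrow>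
      (\<forall>i j. i < j \<longrightarrow> j < Suc (q + r) \<longrightarrow> (replicate q (0::nat) @ 1 # replicate r 2) ! i = (replicate q 0 @ 1 # replicate r 2) ! j \<longrightarrow> \<sigma> i < \<sigma> j)" for \<sigma> :: "nat \<Rightarrow> nat"
    by (auto simp: strict_mono_on_def nth_append nth_Cons')
  ultimately show ?thesis by (simp add: unshuffles_def label_perms_def)
qed

section \<open>The graded Lie algebra of cochains\<close>

locale vector_space_char_0 = vector_space scale
  for scale :: "'k::field_char_0 \<Rightarrow> 'w::ab_group_add \<Rightarrow> 'w"
begin

text \<open>The index is the degree: \<open>n + 1\<close> arguments, alternating in the first
  \<open>n\<close>.\<close>

abbreviation cochain :: "nat \<Rightarrow> ('w list \<Rightarrow> 'w) \<Rightarrow> bool" where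
  "cochain n f \<equiv> f \<in> wedge_hom scale scale (Suc n)"

abbreviation lin :: "('w \<Rightarrow> 'w) \<Rightarrow> bool" where
  "lin \<equiv> Vector_Spaces.linear scale scale"

section \<open>Multilinearity and antisymmetry of cochains\<close>

lemma lin_iff: "lin h \<longleftrightarrow> (\<forall>x y. h (x + y) = h x + h y) \<and> (\<forall>c x. h (scale c x) = scale c (h x))"
  by (simp add: Vector_Spaces.linear_def module_hom_def module_hom_axioms_def
      vector_space_axioms module_axioms)

lemma lin_add: "lin f \<Longrightarrow> lin g \<Longrightarrow> lin (\<lambda>x. f x + g x)"
  by (simp add: lin_iff scale_right_distrib)

lemma lin_psgn: "lin f \<Longrightarrow> lin (\<lambda>x. psgn n (f x))"
  by (simp add: lin_iff psgn_def)

lemma lin_comp: "lin f \<Longrightarrow> lin g \<Longrightarrow> lin (\<lambda>x. f (g x))"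
  by (simp add: lin_iff)

lemma lin_plusD: "lin f \<Longrightarrow> f (x + y) = f x + f y"
  by (simp add: lin_iff)

lemma lin_0D: "lin f \<Longrightarrow> f 0 = 0"
  using lin_plusD[of f 0 0] by simp

lemma lin_minusD: "lin f \<Longrightarrow> f (- x) = - f x"
  using lin_plusD[of f x "- x"] lin_0D[of f] by (simp add: add_eq_0_iff2 minus_unique)

lemma lin_usum: "(\<And>A B. lin (\<lambda>x. \<phi> x A B)) \<Longrightarrow> lin (\<lambda>x. usum xs (\<phi> x))"
  by (induction xs arbitrary: \<phi>) (simp_all add: lin_add lin_psgn)

lemma lin_asum: "(\<And>A. lin (\<lambda>x. f x A)) \<Longrightarrow> lin (\<lambda>x. asum xs (f x))"
proof (induction xs arbitrary: f)
  case Nil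
  show ?case by (simp add: lin_iff)
qed (simp add: lin_add lin_psgn)

lemma lin_usum_arg:
  assumes "\<And>us vs B. lin (\<lambda>x. \<phi> (us @ x # vs) B)" "\<And>A us vs. lin (\<lambda>x. \<phi> A (us @ x # vs))"
  shows "lin (\<lambda>x. usum (us @ x # vs) \<phi>)"
  using assms
proof (induction us arbitrary: \<phi>)
  case Nil
  show ?case unfolding append_Nil usum.simps
    using Nil.prems(1)[of "[]"] Nil.prems(2)[of _ "[]"] by (intro lin_add lin_usum lin_psgn) simp_all
next
  case (Cons a us)
  show ?case unfolding append_Cons usum.simps
  proof (intro lin_add Cons.IH lin_psgn)
    show "lin (\<lambda>x. \<phi> (a # us @ x # vs) B)" for us vs B using Cons.prems(1)[of "a # us"] by simp
    show "lin (\<lambda>x. \<phi> A (us @ x # vs))" for A us vs by (fact Cons.prems(2))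
    show "lin (\<lambda>x. \<phi> A (a # us @ x # vs))" for A us vs using Cons.prems(2)[of A "a # us"] by simp
    show "lin (\<lambda>x. psgn (length (us @ x # vs)) (\<phi> (us @ x # vs) (a # B)))" for us vs B
      using lin_psgn[OF Cons.prems(1), of "Suc (length us + length vs)"] by simp
  qed
qed

lemma lin_asum_arg:
  assumes "\<And>us vs. lin (\<lambda>x. f (us @ x # vs))"
  shows "lin (\<lambda>x. asum (us @ x # vs) f)"
  using assms
proof (induction us arbitrary: f)
  case Nil
  show ?case unfolding append_Nil asum.simps
    using Nil.prems[of "[]"] Nil.prems[of _ "[]"] by (intro lin_add lin_asum lin_psgn) simp_all
next
  case (Cons a us)
  have "lin (\<lambda>x. asum (us @ x # vs) (\<lambda>A. f (a # A)))"
    using Cons.prems[of "a # _"] by (intro Cons.IH) simp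
  moreover have "lin (\<lambda>x. psgn (length (us @ x # vs)) (f ((us @ x # vs) @ [a])))"
    using lin_psgn[OF Cons.prems[of us "vs @ [a]"], of "Suc (length us + length vs)"] by simp
  ultimately show ?case unfolding append_Cons asum.simps by (rule lin_add)
qed

lemma cochain_vanish: "cochain n f \<Longrightarrow> length xs \<noteq> Suc n \<Longrightarrow> f xs = 0"
  by (simp add: wedge_hom_def)

lemma cochain_lin:
  assumes "cochain n f"
  shows "lin (\<lambda>x. f (us @ x # vs))"
proof (cases "length (us @ undefined # vs) = Suc n")
  case True
  have "lin (\<lambda>x. f ((us @ undefined # vs)[length us := x]))"
    using assms True unfolding wedge_hom_def by (auto simp del: list_update_length)
  then show ?thesis by simp
next
  case False
  then have "(\<lambda>x. f (us @ x # vs)) = (\<lambda>x. 0)" using cochain_vanish[OF assms] by auto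
  then show ?thesis by (simp add: lin_iff)
qed

lemmas cochain_lin_Cons = cochain_lin[where us="[]", simplified]
lemmas cochain_lin_snoc = cochain_lin[where vs="[]"]

text \<open>Polarisation: expand \<open>g (x + y) (x + y) = 0\<close>. The trailing \<open>z\<close>
  keeps the exchanged entries away from the last slot, in which nothing is alternating.\<close>

lemma cochain_swap:
  assumes f: "cochain n f"
  shows "f (us @ x # y # vs @ [z]) = - f (us @ y # x # vs @ [z])"
proof -
  define g where "g a b = f (us @ a # b # vs @ [z])" for a b
  have g: "g a a = 0" for a
  proof (cases "length (us @ a # a # vs @ [z]) = Suc n")
    case True
    have "\<forall>xs i j. length xs = Suc n \<longrightarrow> i < j \<longrightarrow> j < Suc n - 1 \<longrightarrow> xs ! i = xs ! j \<longrightarrow> f xs = 0"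
      using f by (simp add: wedge_hom_def)
    from this[rule_format, OF True, of "length us" "Suc (length us)"]
    show ?thesis using True by (simp add: g_def nth_append)
  qed (simp add: g_def cochain_vanish[OF f])
  have "g (a + a') b = g a b + g a' b" "g a (b + b') = g a b + g a b'" for a a' b b'
    using lin_plusD[OF cochain_lin[OF f, of us "b # vs @ [z]"]]
      lin_plusD[OF cochain_lin[OF f, of "us @ [a]" "vs @ [z]"]] by (simp_all add: g_def)
  then have "g (x + y) (x + y) = g x x + g x y + (g y x + g y y)" by (simp only: ac_simps)
  then have "g x y + g y x = 0" by (simp add: g)
  then show ?thesis by (simp add: eq_neg_iff_add_eq_0 g_def)
qed

lemma eq_minus_self: "(x::'w) = - x \<Longrightarrow> x = 0"
proof -
  assume "x = - x"
  then have "scale 2 x = 0" using scale_left_distrib[of 1 1 x] by (simp add: eq_neg_iff_add_eq_0)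
  then show "x = 0" by simp
qed

text \<open>Adjacent antisymmetry is easier to carry through the unshuffle sums than vanishing on
  repeated arguments. It implies the latter because 2 is invertible.\<close>

lemma cochainI:
  assumes "\<And>xs. length xs \<noteq> Suc n \<Longrightarrow> f xs = 0"
    and "\<And>us vs. lin (\<lambda>x. f (us @ x # vs))"
    and swap: "\<And>us x y vs z. f (us @ x # y # vs @ [z]) = - f (us @ y # x # vs @ [z])"
  shows "cochain n f"
  unfolding wedge_hom_def
proof (intro CollectI conjI allI impI)
  fix xs :: "'w list" and i assume "length xs = Suc n" "i < Suc n"
  then have "xs[i := x] = take i xs @ x # drop (Suc i) xs" for x by (simp add: upd_conv_take_nth_drop)
  then show "lin (\<lambda>x. f (xs[i := x]))" using assms(2) by simp
next
  fix xs :: "'w list" and i j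
  assume a: "length xs = Suc n" "i < j" "j < Suc n - 1" "xs ! i = xs ! j"
  \<comment> \<open>Adjacent swaps bring the two equal entries together.\<close>
  have zero: "f (us @ a # ms @ a # vs @ [z]) = 0" for us a ms vs z
  proof (induction ms arbitrary: us)
    case Nil
    show ?case using eq_minus_self[OF swap[of us a a]] by simp
  next
    case (Cons m ms)
    show ?case using swap[of us a m "ms @ a # vs"] Cons[of "us @ [m]"] by simp
  qed
  have "xs = take j xs @ xs ! j # drop (Suc j) xs" using a by (simp add: id_take_nth_drop)
  also have "take j xs = take i (take j xs) @ take j xs ! i # drop (Suc i) (take j xs)"
    using a by (intro id_take_nth_drop) simp
  also have "take j xs ! i = xs ! j" using a by simp
  also have "drop (Suc j) xs = butlast (drop (Suc j) xs) @ [last (drop (Suc j) xs)]"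
    using a by (intro append_butlast_last_id[symmetric]) simp
  finally have "xs = take i (take j xs) @ xs ! j # drop (Suc i) (take j xs) @ xs ! j #
      butlast (drop (Suc j) xs) @ [last (drop (Suc j) xs)]" by simp
  then show "f xs = 0" using zero by metis
qed (use assms(1) in auto)

text \<open>If x and y fall into the same block, antisymmetry of \<open>\<phi>\<close> gives the
  sign. If they are separated, the two mixed terms trade places, and their signs differ by -1 since
  one of the two entries passes the other.\<close>

lemma usum_swap_arg:
  fixes \<phi> :: "'a list \<Rightarrow> 'a list \<Rightarrow> 'b::ab_group_add"
  assumes "\<And>us x y vs B. \<phi> (us @ x # y # vs) B = - \<phi> (us @ y # x # vs) B"
    and "\<And>A us x y vs. \<phi> A (us @ x # y # vs) = - \<phi> A (us @ y # x # vs)"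
  shows "usum (us @ x # y # vs) \<phi> = - usum (us @ y # x # vs) \<phi>"
  using assms
proof (induction us arbitrary: \<phi>)
  case Nil
  have "usum vs (\<lambda>A B. \<phi> (x # y # A) B) = - usum vs (\<lambda>A B. \<phi> (y # x # A) B)"
    "usum vs (\<lambda>A B. psgn (length A) (psgn (length A) (\<phi> A (x # y # B)))) =
     - usum vs (\<lambda>A B. psgn (length A) (psgn (length A) (\<phi> A (y # x # B))))"
    unfolding usum_minus[symmetric] using Nil.prems(1)[of "[]" x y] Nil.prems(2)[of _ "[]" x y]
    by (intro usum_cong; simp)+
  then show ?case by (simp add: usum_minus)
next
  case (Cons a us)
  have "usum (us @ x # y # vs) (\<lambda>A. \<phi> (a # A)) = - usum (us @ y # x # vs) (\<lambda>A. \<phi> (a # A))"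
  proof (intro Cons.IH)
    show "\<phi> (a # us @ x # y # vs) B = - \<phi> (a # us @ y # x # vs) B" for us x y vs B
      using Cons.prems(1)[of "a # us" x y vs B] by simp
  qed (fact Cons.prems(2))
  moreover have "usum (us @ x # y # vs) (\<lambda>A B. psgn (length A) (\<phi> A (a # B))) =
      - usum (us @ y # x # vs) (\<lambda>A B. psgn (length A) (\<phi> A (a # B)))"
  proof (intro Cons.IH)
    show "psgn (length (us @ x # y # vs)) (\<phi> (us @ x # y # vs) (a # B)) =
      - psgn (length (us @ y # x # vs)) (\<phi> (us @ y # x # vs) (a # B))" for us x y vs B
      by (subst Cons.prems(1)) simp
    show "psgn (length A) (\<phi> A (a # us @ x # y # vs)) = - psgn (length A) (\<phi> A (a # us @ y # x # vs))" for A us x y vs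
      using Cons.prems(2)[of A "a # us" x y vs] by simp
  qed
  ultimately show ?case by simp
qed

text \<open>\<open>f\<close> need not be antisymmetric in its last slot: the terms that move x or y
  there trade places with opposite signs.\<close>

lemma asum_swap_arg:
  fixes f :: "'a list \<Rightarrow> 'b::ab_group_add"
  assumes "\<And>us x y vs z. f (us @ x # y # vs @ [z]) = - f (us @ y # x # vs @ [z])"
  shows "asum (us @ x # y # vs) f = - asum (us @ y # x # vs) f"
  using assms
proof (induction us arbitrary: f)
  case Nil
  have "asum vs (\<lambda>A. f (x # y # A)) = - asum vs (\<lambda>A. f (y # x # A))"
  proof (cases "vs = []")
    case False
    show ?thesis unfolding asum_minus[symmetric]
    proof (intro asum_cong)
      fix A :: "'a list" assume "length A = length vs"
      then have "A = butlast A @ [last A]" using False by (metis append_butlast_last_id length_0_conv)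
      then show "f (x # y # A) = - f (y # x # A)" using Nil.prems[of "[]" x y "butlast A" "last A"] by simp
    qed
  qed simp
  then show ?case by simp
next
  case (Cons a us)
  have "asum (us @ x # y # vs) (\<lambda>A. f (a # A)) = - asum (us @ y # x # vs) (\<lambda>A. f (a # A))"
  proof (intro Cons.IH)
    show "f (a # us @ x # y # vs @ [z]) = - f (a # us @ y # x # vs @ [z])" for us x y vs z
      using Cons.prems[of "a # us" x y vs z] by simp
  qed
  then show ?case using Cons.prems[of us x y vs a] by simp
qed

section \<open>The product of cochains\<close>

text \<open>The Matsushima-Nijenhuis product without length conditions: on cochains, splittings of
  the wrong size contribute 0. The parameter \<open>k\<close> stands for the exponent p q of the
  sign and is left free, so that the algebraic laws hold without reference to degrees.\<close>

definition circ :: "nat \<Rightarrow> ('w list \<Rightarrow> 'w) \<Rightarrow> ('w list \<Rightarrow> 'w) \<Rightarrow> 'w list \<Rightarrow> 'w" where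
  "circ k F G zs = (if zs = [] then 0 else
     usum (butlast zs) (\<lambda>A D. F (asum A G # D @ [last zs])) +
     psgn k (usum (butlast zs) (\<lambda>A B. F (A @ [G (B @ [last zs])]))))"

lemma circ_Nil [simp]: "circ k F G [] = 0"
  by (simp add: circ_def)

lemma circ_snoc:
  "circ k F G (xs @ [y]) = usum xs (\<lambda>A D. F (asum A G # D @ [y])) +
     psgn k (usum xs (\<lambda>A B. F (A @ [G (B @ [y])])))"
  by (simp add: circ_def)

text \<open>In the associator, \<open>r\<close> is a value inserted earlier. The next insertion
  either takes it as an argument or leaves it beside itself, in the first slots or with an insertion
  into the last slot.\<close>

lemma circ_Cons_snoc:
  "circ k F G (r # xs @ [y]) =
     usum xs (\<lambda>A D. F (asum (r # A) G # D @ [y])) +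
     usum xs (\<lambda>A D. psgn (length A) (F (asum A G # r # D @ [y]))) +
     psgn k (usum xs (\<lambda>A B. F (r # A @ [G (B @ [y])])) +
       usum xs (\<lambda>A B. psgn (length A) (F (A @ [G (r # B @ [y])]))))"
  using circ_snoc[of k F G "r # xs" y] by simp

lemma asum_vanish:
  assumes "cochain q G" "length A \<noteq> Suc q"
  shows "asum A G = 0"
proof -
  have "asum A G = asum A (\<lambda>_. 0)" by (rule asum_cong) (simp add: assms cochain_vanish[OF assms(1)])
  then show ?thesis by simp
qed

lemma circ_vanish:
  assumes F: "cochain p F" and G: "cochain q G" and "length zs \<noteq> Suc (p + q)"
  shows "circ k F G zs = 0"
proof (cases "zs = []")
  case False
  then obtain xs y where zs: "zs = xs @ [y]" by (metis append_butlast_last_id)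
  have 1: "F (asum A G # D @ [y]) = 0" if "length A + length D = length xs" for A D
    using that assms zs cochain_vanish[OF F, of "asum A G # D @ [y]"] asum_vanish[OF G, of A]
      lin_0D[OF cochain_lin_Cons[OF F, of "D @ [y]"]] by (cases "length A = Suc q") auto
  have 2: "F (A @ [G (B @ [y])]) = 0" if "length A + length B = length xs" for A B
    using that assms zs cochain_vanish[OF F, of "A @ [G (B @ [y])]"] cochain_vanish[OF G, of "B @ [y]"]
      lin_0D[OF cochain_lin_snoc[OF F, of A]] by (cases "length B = q") auto
  show ?thesis unfolding zs circ_snoc by (simp add: usum_eq_0[OF 1] usum_eq_0[OF 2])
qed simp

text \<open>\<open>G\<close> has no symmetry in its last argument. In the last slot of
  \<open>F\<close> this matches the unshuffled last argument; in a first slot \<open>asum\<close>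
  antisymmetrises \<open>G\<close> fully.\<close>

lemma cochain_circ:
  assumes F: "cochain p F" and G: "cochain q G"
  shows "cochain (p + q) (circ k F G)"
proof (rule cochainI)
  show "circ k F G zs = 0" if "length zs \<noteq> Suc (p + q)" for zs
    by (rule circ_vanish[OF F G that])
next
  fix us vs
  show "lin (\<lambda>x. circ k F G (us @ x # vs))"
  proof (cases vs rule: rev_cases)
    case Nil
    have "lin (\<lambda>x. F (asum A G # D @ [x]))" for A D
      using cochain_lin_snoc[OF F, of "asum A G # D"] by simp
    moreover have "lin (\<lambda>x. F (A @ [G (B @ [x])]))" for A B
      using lin_comp[OF cochain_lin_snoc[OF F] cochain_lin_snoc[OF G]] .
    ultimately show ?thesis unfolding Nil circ_snoc by (intro lin_add lin_psgn lin_usum)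
  next
    case (snoc ws z)
    have 1: "lin (\<lambda>x. F (asum (us @ x # vs) G # D @ [z]))" for us vs D
      using lin_comp[OF cochain_lin_Cons[OF F] lin_asum_arg[OF cochain_lin[OF G]]] .
    have 2: "lin (\<lambda>x. F (asum A G # (us @ x # vs) @ [z]))" for A us vs
      using cochain_lin[OF F, of "asum A G # us" "vs @ [z]"] by simp
    have 3: "lin (\<lambda>x. F ((us @ x # vs) @ [G (B @ [z])]))" for us vs B
      using cochain_lin[OF F, of us "vs @ [G (B @ [z])]"] by simp
    have 4: "lin (\<lambda>x. F (A @ [G ((us @ x # vs) @ [z])]))" for A us vs
      using lin_comp[OF cochain_lin_snoc[OF F] cochain_lin[OF G, of us "vs @ [z]"]] by simp
    have "lin (\<lambda>x. circ k F G ((us @ x # ws) @ [z]))"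
      unfolding circ_snoc by (intro lin_add lin_psgn lin_usum_arg 1 2 3 4)
    then show ?thesis by (simp add: snoc)
  qed
next
  fix us x y vs z
  have 1: "F (asum (us @ x # y # vs) G # D @ [z]) = - F (asum (us @ y # x # vs) G # D @ [z])" for us x y vs D
    using asum_swap_arg[where f=G, OF cochain_swap[OF G], of us x y vs] lin_minusD[OF cochain_lin_Cons[OF F]] by simp
  have 2: "F (asum A G # (us @ x # y # vs) @ [z]) = - F (asum A G # (us @ y # x # vs) @ [z])" for A us x y vs
    using cochain_swap[OF F, of "asum A G # us" x y vs z] by simp
  have 3: "F ((us @ x # y # vs) @ [G (B @ [z])]) = - F ((us @ y # x # vs) @ [G (B @ [z])])" for us x y vs B
    using cochain_swap[OF F, of us x y vs "G (B @ [z])"] by simp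
  have 4: "F (A @ [G ((us @ x # y # vs) @ [z])]) = - F (A @ [G ((us @ y # x # vs) @ [z])])" for A us x y vs
    using cochain_swap[OF G, of us x y vs z] lin_minusD[OF cochain_lin_snoc[OF F]] by simp
  have "circ k F G ((us @ x # y # vs) @ [z]) = - circ k F G ((us @ y # x # vs) @ [z])"
    unfolding circ_snoc usum_swap_arg[where \<phi>="\<lambda>A D. F (asum A G # D @ [z])", OF 1 2, of us x y vs]
      usum_swap_arg[where \<phi>="\<lambda>A B. F (A @ [G (B @ [z])])", OF 3 4, of us x y vs] by simp
  then show "circ k F G (us @ x # y # vs @ [z]) = - circ k F G (us @ y # x # vs @ [z])" by simp
qed

lemma circ_add_left: "circ k (F + F') G = circ k F G + circ k F' G"
proof
  fix zs show "circ k (F + F') G zs = (circ k F G + circ k F' G) zs"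
    by (cases zs rule: rev_cases) (simp_all add: circ_snoc usum_add psgn_add algebra_simps)
qed

lemma circ_minus_left: "circ k (- F) G = - circ k F G"
proof
  fix zs show "circ k (- F) G zs = (- circ k F G) zs"
    by (cases zs rule: rev_cases) (simp_all add: circ_snoc usum_minus)
qed

lemma circ_add_right:
  assumes F: "cochain p F"
  shows "circ k F (G + G') = circ k F G + circ k F G'"
proof
  fix zs
  show "circ k F (G + G') zs = (circ k F G + circ k F G') zs"
  proof (cases zs rule: rev_cases)
    case (snoc xs y)
    show ?thesis unfolding snoc circ_snoc plus_fun_def
      by (simp add: asum_add lin_plusD[OF cochain_lin_Cons[OF F]]
          lin_plusD[OF cochain_lin_snoc[OF F]] usum_add psgn_add algebra_simps)
  qed simp
qed

lemma circ_minus_right: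
  assumes F: "cochain p F"
  shows "circ k F (- G) = - circ k F G"
proof
  fix zs
  show "circ k F (- G) zs = (- circ k F G) zs"
  proof (cases zs rule: rev_cases)
    case (snoc xs y)
    show ?thesis unfolding snoc circ_snoc fun_Compl_def
      by (simp add: asum_minus lin_minusD[OF cochain_lin_Cons[OF F]]
          lin_minusD[OF cochain_lin_snoc[OF F]] usum_minus)
  qed simp
qed

section \<open>The associator\<close>

text \<open>After full antisymmetrisation the last slot of \<open>Q\<close> is no longer special:
  insertions of \<open>R\<close> into the first and into the last slot of \<open>Q\<close> combine
  into \<open>asum\<close> over a list headed by the value of \<open>R\<close>.\<close>

lemma asum_circ:
  assumes Q: "cochain q Q" and R: "cochain r R"
  shows "asum A (circ (q * r) Q R) = usum A (\<lambda>C E. asum (asum C R # E) Q)"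
proof -
  have "asum A (circ (q * r) Q R) = asum A (\<lambda>Z.
      usum (butlast Z) (\<lambda>C D. Q (asum C R # (D @ [last Z]))) +
      psgn (q * r) (usum (butlast Z) (\<lambda>C D. Q (C @ [R (D @ [last Z])]))))"
  proof (cases "A = []")
    case False
    show ?thesis
    proof (rule asum_cong)
      fix Z :: "'w list" assume "length Z = length A"
      then have "Z \<noteq> []" using False by auto
      then show "circ (q * r) Q R Z = usum (butlast Z) (\<lambda>C D. Q (asum C R # (D @ [last Z]))) +
        psgn (q * r) (usum (butlast Z) (\<lambda>C D. Q (C @ [R (D @ [last Z])])))" by (simp add: circ_def)
    qed
  qed simp
  also have "\<dots> = usum A (\<lambda>C E. asum E (\<lambda>Z. Q (asum C R # Z))) +
      psgn (q * r) (usum A (\<lambda>C E. asum E (\<lambda>Z. Q (C @ [R Z]))))"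
    unfolding asum_add asum_psgn
    using asum_coassoc[of A "\<lambda>C Z. Q (asum C R # Z)"] asum_coassoc[of A "\<lambda>C Z. Q (C @ [R Z])"] by simp
  also have "usum A (\<lambda>C E. asum E (\<lambda>Z. Q (C @ [R Z]))) = usum A (\<lambda>C E. Q (C @ [asum E R]))"
    by (subst asum_hom[of "\<lambda>x. Q (_ @ [x])", OF lin_plusD[OF cochain_lin_snoc[OF Q]]]) (rule refl)
  also have "\<dots> = usum A (\<lambda>E C. psgn (length E * length C) (Q (C @ [asum E R])))"
    by (rule usum_cocomm)
  also have "psgn (q * r) \<dots> = usum A (\<lambda>C E. psgn (length E) (Q (E @ [asum C R])))"
    unfolding usum_psgn[symmetric]
  proof (intro usum_cong)
    fix C E
    show "psgn (q * r) (psgn (length C * length E) (Q (E @ [asum C R]))) = psgn (length E) (Q (E @ [asum C R]))"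
    \<comment> \<open>For these lengths the exponent q r + (r + 1) q has the parity of q, the length
      of E; all other splittings give 0.\<close>
    proof (cases "length C = Suc r \<and> length E = q")
      case True
      then show ?thesis by (auto simp: psgn_def)
    next
      case False
      then have "Q (E @ [asum C R]) = 0"
        using asum_vanish[OF R, of C] cochain_vanish[OF Q, of "E @ [asum C R]"]
          lin_0D[OF cochain_lin_snoc[OF Q, of E]] by auto
      then show ?thesis by simp
    qed
  qed
  finally show ?thesis by (simp add: usum_add)
qed

text \<open>\<open>Q\<close> and \<open>R\<close> are inserted side by side into alternating slots
  of \<open>P\<close>; the sign moves the value of \<open>R\<close> past the arguments C of
  \<open>Q\<close>.\<close>

definition parallel :: "('w list \<Rightarrow> 'w) \<Rightarrow> ('w list \<Rightarrow> 'w) \<Rightarrow> ('w list \<Rightarrow> 'w) \<Rightarrow> 'w list \<Rightarrow> 'w \<Rightarrow> 'w" where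
  "parallel P Q R xs y = usum xs (\<lambda>A B. usum B (\<lambda>C D. psgn (length C) (P (asum C Q # asum A R # D @ [y]))))"

text \<open>\<open>R\<close> is inserted into an alternating slot of \<open>P\<close>, and
  \<open>Q\<close> into its last slot.\<close>

definition mixed :: "('w list \<Rightarrow> 'w) \<Rightarrow> ('w list \<Rightarrow> 'w) \<Rightarrow> ('w list \<Rightarrow> 'w) \<Rightarrow> 'w list \<Rightarrow> 'w \<Rightarrow> 'w" where
  "mixed P Q R xs y = usum xs (\<lambda>A B. usum B (\<lambda>C D. P (asum A R # C @ [Q (D @ [y])])))"

text \<open>Exchanging the argument blocks costs (q + 1)(r + 1), exchanging the values in
  \<open>P\<close> costs 1, and the built-in signs q + 1 and r + 1 change roles; the total has the
  parity of q r.\<close>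

lemma parallel_commute:
  assumes P: "cochain p P" and Q: "cochain q Q" and R: "cochain r R"
  shows "parallel P R Q xs y = psgn (q * r) (parallel P Q R xs y)"
proof -
  have "parallel P Q R xs y = usum xs (\<lambda>C B. usum B (\<lambda>A D.
      psgn (length A * length C) (psgn (length C) (P (asum C Q # asum A R # D @ [y])))))"
    unfolding parallel_def by (rule usum_swap)
  also have "psgn (q * r) \<dots> = parallel P R Q xs y"
    unfolding parallel_def usum_psgn[symmetric]
  proof (intro usum_cong)
    fix C B A D
    show "psgn (q * r) (psgn (length A * length C) (psgn (length C) (P (asum C Q # asum A R # D @ [y])))) =
      psgn (length A) (P (asum A R # asum C Q # D @ [y]))"
    proof (cases "length C = Suc q \<and> length A = Suc r")
      case True
      have "P (asum C Q # asum A R # D @ [y]) = - P (asum A R # asum C Q # D @ [y])"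
        using cochain_swap[OF P, of "[]" "asum C Q" "asum A R" D y] by simp
      then show ?thesis using True by (auto simp: psgn_def)
    next
      case False
      then have "asum C Q = 0 \<or> asum A R = 0" using asum_vanish[OF Q] asum_vanish[OF R] by blast
      moreover have "P (u # v # D @ [y]) = 0" if "u = 0 \<or> v = 0" for u v
        using that lin_0D[OF cochain_lin[OF P, of "[]"], of "v # D @ [y]"]
          lin_0D[OF cochain_lin[OF P, of "[u]"], of "D @ [y]"] by auto
      ultimately show ?thesis by (metis psgn_simps(2))
    qed
  qed
  finally show ?thesis ..
qed

text \<open>The left side has six kinds of terms. Those with \<open>R\<close> inside
  \<open>Q\<close> inside \<open>P\<close> (\<open>L1\<close>, \<open>L4\<close>, \<open>L6\<close>)
  are exactly the right-hand product; the side-by-side insertions survive.\<close>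

lemma associator:
  assumes P: "cochain p P" and Q: "cochain q Q" and R: "cochain r R"
  shows "circ ((p + q) * r) (circ (p * q) P Q) R (xs @ [y]) =
    circ (p * (q + r)) P (circ (q * r) Q R) (xs @ [y]) +
    (parallel P Q R xs y + psgn (p * q) (mixed P Q R xs y) + psgn ((p + q) * r) (mixed P R Q xs y))"
proof -
  define L1 where "L1 = usum xs (\<lambda>A B. usum B (\<lambda>C D. P (asum (asum A R # C) Q # D @ [y])))"
  define L4 where "L4 = usum xs (\<lambda>A B. usum B (\<lambda>C D. psgn (length C) (P (C @ [Q (asum A R # D @ [y])]))))"
  define L5 where "L5 = usum xs (\<lambda>A B. usum A (\<lambda>C D. P (asum C Q # D @ [R (B @ [y])])))"
  define L6 where "L6 = usum xs (\<lambda>A B. usum A (\<lambda>C D. P (C @ [Q (D @ [R (B @ [y])])])))"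
  define R1 where "R1 = usum xs (\<lambda>A B. usum B (\<lambda>C D. P (A @ [Q (asum C R # D @ [y])])))"
  have left: "circ ((p + q) * r) (circ (p * q) P Q) R (xs @ [y]) =
      L1 + parallel P Q R xs y + psgn (p * q) (mixed P Q R xs y + L4) + psgn ((p + q) * r) (L5 + psgn (p * q) L6)"
    unfolding circ_snoc circ_Cons_snoc usum_add usum_psgn L1_def parallel_def mixed_def L4_def L5_def L6_def ..
  \<comment> \<open>Matching \<open>L1\<close> needs \<open>asum_circ\<close>, since the whole
    product of \<open>Q\<close> and \<open>R\<close> sits in an alternating slot of
    \<open>P\<close>.\<close>
  have "usum xs (\<lambda>A B. P (asum A (circ (q * r) Q R) # B @ [y])) =
      usum xs (\<lambda>A B. usum A (\<lambda>C E. P (asum (asum C R # E) Q # B @ [y])))"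
    unfolding asum_circ[OF Q R]
      usum_hom[of "\<lambda>x. P (x # _)", OF lin_plusD[OF cochain_lin_Cons[OF P]]] ..
  also have "\<dots> = L1" unfolding L1_def by (rule usum_coassoc)
  finally have 1: "usum xs (\<lambda>A B. P (asum A (circ (q * r) Q R) # B @ [y])) = L1" .
  have P_snoc: "P (A @ [u + v]) = P (A @ [u]) + P (A @ [v])" "P (A @ [psgn n u]) = psgn n (P (A @ [u]))" for A u v n
    using lin_plusD[OF cochain_lin_snoc[OF P]] lin_minusD[OF cochain_lin_snoc[OF P]] by (auto simp: psgn_def)
  have 2: "usum xs (\<lambda>A B. P (A @ [circ (q * r) Q R (B @ [y])])) = R1 +
      psgn (q * r) (usum xs (\<lambda>A B. usum B (\<lambda>C D. P (A @ [Q (C @ [R (D @ [y])])]))))"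
    unfolding circ_snoc P_snoc usum_hom[of "\<lambda>x. P (_ @ [x])", OF lin_plusD[OF cochain_lin_snoc[OF P]]]
      usum_add usum_psgn R1_def ..
  also have "usum xs (\<lambda>A B. usum B (\<lambda>C D. P (A @ [Q (C @ [R (D @ [y])])]))) = L6"
    unfolding L6_def by (rule usum_coassoc[symmetric])
  finally have 2: "usum xs (\<lambda>A B. P (A @ [circ (q * r) Q R (B @ [y])])) = R1 + psgn (q * r) L6" .
  have right: "circ (p * (q + r)) P (circ (q * r) Q R) (xs @ [y]) =
      L1 + psgn (p * (q + r)) (R1 + psgn (q * r) L6)"
    unfolding circ_snoc[of _ P "circ (q * r) Q R"] 1 2 ..
  have L5: "L5 = mixed P R Q xs y"
    unfolding L5_def mixed_def by (rule usum_coassoc)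
  have "L4 = usum xs (\<lambda>C B. usum B (\<lambda>A D. psgn (length A * length C) (psgn (length C) (P (C @ [Q (asum A R # D @ [y])])))))"
    unfolding L4_def by (rule usum_swap)
  also have "\<dots> = psgn (p * r) R1"
    unfolding R1_def usum_psgn[symmetric]
  proof (intro usum_cong)
    fix C B A D
    show "psgn (length A * length C) (psgn (length C) (P (C @ [Q (asum A R # D @ [y])]))) =
        psgn (p * r) (P (C @ [Q (asum A R # D @ [y])]))"
    \<comment> \<open>Only these lengths contribute, and (r + 1) p + p has the parity of p
      r.\<close>
    proof (cases "length A = Suc r \<and> length C = p")
      case True
      then show ?thesis by (auto simp: psgn_def)
    next
      case False
      then have "P (C @ [Q (asum A R # D @ [y])]) = 0"
        using asum_vanish[OF R, of A] lin_0D[OF cochain_lin_Cons[OF Q, of "D @ [y]"]]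
          cochain_vanish[OF P, of "C @ [Q (asum A R # D @ [y])]"] lin_0D[OF cochain_lin_snoc[OF P, of C]] by auto
      then show ?thesis by simp
    qed
  qed
  finally have L4: "L4 = psgn (p * r) R1" .
  show ?thesis unfolding left right L5 L4
    by (cases "even p"; cases "even q"; cases "even r") (simp_all add: psgn_def algebra_simps)
qed

text \<open>Under exchange of \<open>Q\<close> and \<open>R\<close> the parallel term is symmetric
  up to (-1)^(q r), and the two mixed terms trade places with the same relative sign. Naming the
  associator \<open>a\<close> makes the Jacobi identity a purely linear consequence.\<close>

lemma associator_commute:
  assumes P: "cochain p P" and Q: "cochain q Q" and R: "cochain r R"
  obtains a where "circ ((p + q) * r) (circ (p * q) P Q) R = circ (p * (q + r)) P (circ (q * r) Q R) + a"
    and "circ ((p + r) * q) (circ (p * r) P R) Q = circ (p * (r + q)) P (circ (r * q) R Q) + psgn (q * r) a"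
proof
  let ?a = "circ ((p + q) * r) (circ (p * q) P Q) R - circ (p * (q + r)) P (circ (q * r) Q R)"
  show "circ ((p + q) * r) (circ (p * q) P Q) R = circ (p * (q + r)) P (circ (q * r) Q R) + ?a" by simp
  show "circ ((p + r) * q) (circ (p * r) P R) Q = circ (p * (r + q)) P (circ (r * q) R Q) + psgn (q * r) ?a"
  proof
    fix zs
    define X where "X = circ (p * (r + q)) P (circ (r * q) R Q) zs"
    define Y where "Y = circ (p * (q + r)) P (circ (q * r) Q R) zs"
    have psgn_apply: "psgn n f zs = psgn n (f zs)" for n and f :: "'w list \<Rightarrow> 'w" by (simp add: psgn_def)
    have "circ ((p + r) * q) (circ (p * r) P R) Q zs =
        X + psgn (q * r) (circ ((p + q) * r) (circ (p * q) P Q) R zs - Y)"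
    proof (cases zs rule: rev_cases)
      case Nil
      then show ?thesis by (simp add: X_def Y_def)
    next
      case (snoc xs y)
      show ?thesis
        unfolding X_def Y_def snoc associator[OF P R Q] associator[OF P Q R] parallel_commute[OF P Q R]
          add_diff_cancel_left'
        by (cases "even p"; cases "even q"; cases "even r") (simp_all add: psgn_def)
    qed
    then show "circ ((p + r) * q) (circ (p * r) P R) Q zs =
        (circ (p * (r + q)) P (circ (r * q) R Q) + psgn (q * r) ?a) zs"
      by (simp only: X_def Y_def plus_fun_apply psgn_apply fun_diff_def)
  qed
qed

lemma circ_diff_left: "circ k (F - F') G = circ k F G - circ k F' G"
  using circ_add_left[where F'="- F'"] by (simp add: circ_minus_left)

lemma circ_diff_right: "cochain p F \<Longrightarrow> circ k F (G - G') = circ k F G - circ k F G'"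
  using circ_add_right[where G'="- G'"] by (simp add: circ_minus_right)

lemma circ_psgn_left: "circ k (psgn n F) G = psgn n (circ k F G)"
  by (simp add: psgn_def circ_minus_left)

lemma circ_psgn_right: "cochain p F \<Longrightarrow> circ k F (psgn n G) = psgn n (circ k F G)"
  by (simp add: psgn_def circ_minus_right)

section \<open>The graded Lie bracket\<close>

definition bracket :: "nat \<Rightarrow> nat \<Rightarrow> ('w list \<Rightarrow> 'w) \<Rightarrow> ('w list \<Rightarrow> 'w) \<Rightarrow> 'w list \<Rightarrow> 'w" where
  "bracket p q F G = circ (p * q) F G - psgn (p * q) (circ (q * p) G F)"

lemma cochain_add: "cochain n f \<Longrightarrow> cochain n g \<Longrightarrow> cochain n (f + g)"
proof (rule cochainI)
  assume f: "cochain n f" and g: "cochain n g"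
  show "(f + g) (us @ x # y # vs @ [z]) = - (f + g) (us @ y # x # vs @ [z])" for us x y vs z
    using cochain_swap[OF f, of us x y vs z] cochain_swap[OF g, of us x y vs z] by simp
qed (simp_all add: cochain_vanish lin_add cochain_lin)

lemma cochain_psgn: "cochain n f \<Longrightarrow> cochain n (psgn m f)"
proof (rule cochainI)
  assume f: "cochain n f"
  have psgn_apply: "psgn m f xs = psgn m (f xs)" for xs by (simp add: psgn_def)
  show "psgn m f (us @ x # y # vs @ [z]) = - psgn m f (us @ y # x # vs @ [z])" for us x y vs z
    using cochain_swap[OF f, of us x y vs z] by (simp add: psgn_apply)
  show "lin (\<lambda>x. psgn m f (us @ x # vs))" for us vs
    using cochain_lin[OF f] by (simp add: psgn_apply lin_psgn)
  show "psgn m f xs = 0" if "length xs \<noteq> Suc n" for xs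
    using cochain_vanish[OF f that] by (simp add: psgn_apply)
qed

lemma cochain_bracket:
  assumes "cochain p F" "cochain q G"
  shows "cochain (p + q) (bracket p q F G)"
proof -
  have "bracket p q F G = circ (p * q) F G + psgn (Suc (p * q)) (circ (q * p) G F)"
    by (simp add: bracket_def)
  then show ?thesis
    using cochain_circ[OF assms] cochain_circ[OF assms(2,1)]
    by (metis add.commute cochain_add cochain_psgn)
qed

lemma bracket_antisym: "bracket q p G F = - psgn (p * q) (bracket p q F G)"
  by (cases "even (p * q)") (simp_all add: bracket_def psgn_def mult.commute)

lemma bracket_add_right: "cochain p F \<Longrightarrow> bracket p q F (G + G') = bracket p q F G + bracket p q F G'"
  by (simp add: bracket_def circ_add_left circ_add_right psgn_add)

lemma bracket_psgn_right: "cochain p F \<Longrightarrow> bracket p q F (psgn n G) = psgn n (bracket p q F G)"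
  by (simp add: bracket_def circ_psgn_left circ_psgn_right psgn_diff add.commute)

text \<open>The commutator of a graded right pre-Lie product is a Lie bracket: replacing each
  left-nested product by the right-nested one plus an associator makes the right-nested products and
  the associators cancel separately.\<close>

theorem bracket_Jacobi:
  assumes P: "cochain p P" and Q: "cochain q Q" and R: "cochain r R"
  shows "bracket p (q + r) P (bracket q r Q R) =
    bracket (p + q) r (bracket p q P Q) R + psgn (p * q) (bracket q (p + r) Q (bracket p r P R))"
proof -
  \<comment> \<open>\<open>a\<close>, \<open>b\<close>, \<open>c\<close> are associators with
    \<open>P\<close>, \<open>Q\<close>, \<open>R\<close> outermost; each one accounts for both
    orders of the other two maps.\<close>
  obtain a where a: "circ ((p + q) * r) (circ (p * q) P Q) R = circ (p * (q + r)) P (circ (q * r) Q R) + a"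
    "circ ((p + r) * q) (circ (p * r) P R) Q = circ (p * (r + q)) P (circ (r * q) R Q) + psgn (q * r) a"
    by (rule associator_commute[OF P Q R])
  obtain b where b: "circ ((q + p) * r) (circ (q * p) Q P) R = circ (q * (p + r)) Q (circ (p * r) P R) + b"
    "circ ((q + r) * p) (circ (q * r) Q R) P = circ (q * (r + p)) Q (circ (r * p) R P) + psgn (p * r) b"
    by (rule associator_commute[OF Q P R])
  obtain c where c: "circ ((r + p) * q) (circ (r * p) R P) Q = circ (r * (p + q)) R (circ (p * q) P Q) + c"
    "circ ((r + q) * p) (circ (r * q) R Q) P = circ (r * (q + p)) R (circ (q * p) Q P) + psgn (p * q) c"
    by (rule associator_commute[OF R P Q])
  note comm = mult.commute[of q p] mult.commute[of r p] mult.commute[of r q]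
    add.commute[of q p] add.commute[of r p] add.commute[of r q]
    mult.commute[of "p + q" r] mult.commute[of "p + r" q] mult.commute[of "q + r" p]
  show ?thesis
    unfolding bracket_def circ_diff_left circ_diff_right[OF P] circ_diff_right[OF Q] circ_diff_right[OF R]
      circ_psgn_left circ_psgn_right[OF P] circ_psgn_right[OF Q] circ_psgn_right[OF R]
    using a b c unfolding comm
    by (cases "even p"; cases "even q"; cases "even r") (simp_all add: psgn_def)
qed

subsection \<open>The Matsushima-Nijenhuis bracket\<close>

lemma scale_minus_one_power: "scale ((- 1) ^ n) x = psgn n x"
  by (simp add: psgn_def)

text \<open>The permutations fix the position behind \<open>xs\<close>, so the last argument stays
  outside the list recursion.\<close>

lemma sum_label_perms:
  assumes "length ls = length xs"
  shows "(\<Sum>\<sigma>\<in>label_perms ls. scale (of_int (sign \<sigma>)) (\<Phi> (permute_list \<sigma> (xs @ [z])))) =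
    label_sum ls (\<lambda>ys. \<Phi> (ys @ [z])) xs"
  unfolding label_sum_def
proof (intro sum.cong refl)
  fix \<sigma> assume "\<sigma> \<in> label_perms ls"
  then have p: "\<sigma> permutes {..<length xs}" by (simp add: label_perms_def assms)
  have "permute_list \<sigma> (xs @ [z]) = permute_list \<sigma> xs @ [z]"
    using permutes_not_in[OF p, of "length xs"] permutes_in_image[OF p]
    by (simp add: permute_list_def nth_append)
  then show "scale (of_int (sign \<sigma>)) (\<Phi> (permute_list \<sigma> (xs @ [z]))) =
      (if sign \<sigma> = 1 then \<Phi> (permute_list \<sigma> xs @ [z]) else - \<Phi> (permute_list \<sigma> xs @ [z]))"
    by (cases \<sigma> rule: sign_cases) simp_all
qed

lemma MN_circ_eq_circ:
  assumes F: "cochain p F" and G: "cochain q G"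
  shows "MN_circ scale p q F G = circ (p * q) F G"
proof
  fix zs
  show "MN_circ scale p q F G zs = circ (p * q) F G zs"
  proof (cases "length zs = p + q + 1")
    case False
    then show ?thesis using circ_vanish[OF F G] by (simp add: MN_circ_def)
  next
    case True
    then obtain xs z where zs: "zs = xs @ [z]" and len: "length xs = p + q"
      by (cases zs rule: rev_cases) auto
    let ?S1 = "\<Sum>\<sigma>\<in>unshuffles [q, 1, p - 1]. let ys = permute_list \<sigma> zs in
      scale (of_int (sign \<sigma>)) (F (G (take (q + 1) ys) # drop (q + 1) ys))"
    let ?S2 = "\<Sum>\<sigma>\<in>unshuffles [p, q]. let ys = permute_list \<sigma> zs in
      scale (of_int (sign \<sigma>)) (F (take p ys @ [G (drop p ys)]))"
    have "?S2 = usum xs (\<lambda>A B. if length A = p then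
        F (take p ((A @ B) @ [z]) @ [G (drop p ((A @ B) @ [z]))]) else 0)"
      unfolding Let_def unshuffles_2 zs
      by (subst sum_label_perms) (use len in \<open>simp_all add: label_sum_2 cong: if_cong\<close>)
    also have "\<dots> = usum xs (\<lambda>A B. F (A @ [G (B @ [z])]))"
      by (intro usum_cong) (auto simp: cochain_vanish[OF F])
    finally have 2: "?S2 = usum xs (\<lambda>A B. F (A @ [G (B @ [z])]))" .
    have 1: "(if p = 0 then 0 else ?S1) = usum xs (\<lambda>A D. F (asum A G # D @ [z]))"
    proof (cases "p = 0")
      case True
      \<comment> \<open>A cochain of degree 0 takes one argument, while this list has at least two
        entries; so the sum absent by convention is 0 in \<open>circ\<close> as well.\<close>
      then have "F (asum A G # D @ [z]) = 0" for A D by (simp add: cochain_vanish[OF F])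
      then show ?thesis using True by simp
    next
      case False
      have "?S1 = usum xs (\<lambda>A D. if length A = Suc q then asum A (\<lambda>Z.
          F (G (take (q + 1) ((Z @ D) @ [z])) # drop (q + 1) ((Z @ D) @ [z]))) else 0)"
        unfolding Let_def unshuffles_3 zs
        by (subst sum_label_perms) (use len False in \<open>simp_all add: label_sum_3 cong: if_cong\<close>)
      also have "\<dots> = usum xs (\<lambda>A D. F (asum A G # D @ [z]))"
      proof (intro usum_cong)
        fix A D :: "'w list"
        have "asum A (\<lambda>Z. F (G (take (q + 1) ((Z @ D) @ [z])) # drop (q + 1) ((Z @ D) @ [z]))) =
            asum A (\<lambda>Z. F (G Z # D @ [z]))" if "length A = Suc q"
          using that by (intro asum_cong) simp
        also have "\<dots> = F (asum A G # D @ [z])"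
          by (rule asum_hom[symmetric]) (rule lin_plusD[OF cochain_lin_Cons[OF F]])
        finally show "(if length A = Suc q then asum A (\<lambda>Z.
          F (G (take (q + 1) ((Z @ D) @ [z])) # drop (q + 1) ((Z @ D) @ [z]))) else 0) = F (asum A G # D @ [z])"
          using asum_vanish[OF G, of A] lin_0D[OF cochain_lin_Cons[OF F, of "D @ [z]"]] by simp
      qed
      finally show ?thesis using False by simp
    qed
    have "MN_circ scale p q F G zs = (if p = 0 then 0 else ?S1) + psgn (p * q) ?S2"
      unfolding MN_circ_def scale_minus_one_power if_P[OF True] ..
    also have "\<dots> = circ (p * q) F G (xs @ [z])" unfolding 1 2 circ_snoc ..
    finally show ?thesis unfolding zs .
  qed
qed

lemma MN_bracket_eq_bracket:
  assumes "cochain p F" "cochain q G"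
  shows "MN_bracket scale p q F G = bracket p q F G"
proof -
  have "fun_scale scale ((- 1) ^ n) f = psgn n f" for n and f :: "'w list \<Rightarrow> 'w"
    by (simp add: fun_scale_def fun_eq_iff psgn_def)
  then show ?thesis
    by (simp add: MN_bracket_def bracket_def MN_circ_eq_circ[OF assms] MN_circ_eq_circ[OF assms(2,1)])
qed

end

section \<open>The bigrading\<close>

text \<open>The integer counterpart of \<open>psgn\<close>, as degrees in the desuspension may be
  negative.\<close>

definition isgn :: "int \<Rightarrow> 'b::ab_group_add \<Rightarrow> 'b" where
  "isgn n x = (if even n then x else - x)"

lemma minus_one_powi: "(- 1 :: 'k::field) powi n = (if even n then 1 else - 1)"
  by (cases n rule: int_cases2) (auto simp: power_int_minus uminus_power_if)

section \<open>Koszul signs and unshuffles for two and three arguments\<close>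

lemma koszul_sign_id [simp]: "koszul_sign id ds = 1"
proof -
  have "{(a, b). a < b \<and> b < length ds \<and> id b < id a} = {}" by auto
  then show ?thesis by (simp only: koszul_sign_def prod.empty)
qed

lemma koszul_sign_2: "koszul_sign (transpose 0 1) [i, j] = (if even (i * j) then 1 else (- 1 :: 'k::field))"
proof -
  have "{(a, b). a < b \<and> b < length [i, j] \<and> transpose 0 1 b < transpose 0 1 (a::nat)} = {(0::nat, 1)}"
    by (auto simp: transpose_def)
  then show ?thesis by (simp add: koszul_sign_def minus_one_powi)
qed

lemma koszul_sign_3:
  "koszul_sign (transpose 1 2) [i, j, k] = (if even (j * k) then 1 else (- 1 :: 'k::field))"
  "koszul_sign (transpose 0 1 \<circ> transpose 1 2) [i, j, k] = (if even (i * (j + k)) then 1 else (- 1 :: 'k::field))"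
proof -
  have "{(a, b). a < b \<and> b < length [i, j, k] \<and> transpose 1 2 b < transpose 1 2 (a::nat)} = {(1::nat, 2)}"
    by (auto simp: transpose_def split: if_splits)
  then show "koszul_sign (transpose 1 2) [i, j, k] = (if even (j * k) then 1 else (- 1 :: 'k::field))"
    by (simp add: koszul_sign_def minus_one_powi)
  have "{(a, b). a < b \<and> b < length [i, j, k] \<and>
      (transpose 0 1 \<circ> transpose 1 2) b < (transpose 0 1 \<circ> transpose 1 2) (a::nat)} = {(0::nat, 2), (1, 2)}"
    by (auto simp: transpose_def split: if_splits)
  then show "koszul_sign (transpose 0 1 \<circ> transpose 1 2) [i, j, k] =
      (if even (i * (j + k)) then 1 else (- 1 :: 'k::field))"
    by (simp add: koszul_sign_def minus_one_powi)
qed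

lemma permutes_2: "\<sigma> permutes {..<2::nat} \<Longrightarrow> \<sigma> = id \<or> \<sigma> = transpose 0 1"
proof -
  have "{..<2} = {0, 1::nat}" by auto
  moreover assume "\<sigma> permutes {..<2::nat}"
  ultimately show ?thesis using permutes_doubleton_iff by metis
qed

lemma unshuffles_2_1: "unshuffles [2, 1] = {id, transpose 1 2, transpose 0 1 \<circ> transpose 1 2}" (is "?A = ?B")
proof (intro equalityI subsetI)
  fix \<sigma> assume "\<sigma> \<in> ?A"
  then have p: "\<sigma> permutes {..<3}"
    and "\<And>i j. i < j \<Longrightarrow> j < 3 \<Longrightarrow> [False, False, True] ! i = [False, False, True] ! j \<Longrightarrow> \<sigma> i < \<sigma> j"
    by (simp_all add: unshuffles_2 label_perms_def numeral_2_eq_2 numeral_3_eq_3)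
  from this(2)[of 0 1] have m: "\<sigma> 0 < \<sigma> 1" by simp
  have im: "\<sigma> 0 < 3" "\<sigma> 1 < 3" "\<sigma> 2 < 3" using permutes_in_image[OF p] by auto
  have inj: "\<sigma> 2 \<noteq> \<sigma> 0" "\<sigma> 2 \<noteq> \<sigma> 1" by (simp_all add: inj_eq[OF permutes_inj[OF p]])
  have out: "\<sigma> n = n" if "n \<noteq> 0" "n \<noteq> 1" "n \<noteq> 2" for n
    using that permutes_not_in[OF p, of n] by auto
  have "\<sigma> 0 = 0 \<and> \<sigma> 1 = 1 \<and> \<sigma> 2 = 2 \<or> \<sigma> 0 = 0 \<and> \<sigma> 1 = 2 \<and> \<sigma> 2 = 1 \<or> \<sigma> 0 = 1 \<and> \<sigma> 1 = 2 \<and> \<sigma> 2 = 0"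
  proof -
    have "a = 0 \<and> b = 1 \<and> c = 2 \<or> a = 0 \<and> b = 2 \<and> c = 1 \<or> a = 1 \<and> b = 2 \<and> c = 0"
      if "a < 3" "b < 3" "c < 3" "a < b" "c \<noteq> a" "c \<noteq> b" for a b c :: nat
      using that by (auto simp: numeral_2_eq_2 numeral_3_eq_3 less_Suc_eq)
    from this[OF im m inj] show ?thesis .
  qed
  then show "\<sigma> \<in> ?B"
  proof (elim disjE)
    assume h: "\<sigma> 0 = 0 \<and> \<sigma> 1 = 1 \<and> \<sigma> 2 = 2"
    have "\<sigma> = id"
    proof
      fix n show "\<sigma> n = id n" using h out[of n] by (cases "n = 0"; cases "n = 1"; cases "n = 2") auto
    qed
    then show ?thesis by simp
  next
    assume h: "\<sigma> 0 = 0 \<and> \<sigma> 1 = 2 \<and> \<sigma> 2 = 1"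
    have "\<sigma> = transpose 1 2"
    proof
      fix n show "\<sigma> n = transpose 1 2 n" using h out[of n]
        by (cases "n = 0"; cases "n = 1"; cases "n = 2") (auto simp: transpose_def)
    qed
    then show ?thesis by simp
  next
    assume h: "\<sigma> 0 = 1 \<and> \<sigma> 1 = 2 \<and> \<sigma> 2 = 0"
    have "\<sigma> = transpose 0 1 \<circ> transpose 1 2"
    proof
      fix n show "\<sigma> n = (transpose 0 1 \<circ> transpose 1 2) n" using h out[of n]
        by (cases "n = 0"; cases "n = 1"; cases "n = 2") (auto simp: transpose_def)
    qed
    then show ?thesis by simp
  qed
next
  fix \<sigma> :: "nat \<Rightarrow> nat" assume "\<sigma> \<in> ?B"
  moreover have "transpose 1 2 permutes {..<3::nat}" "transpose 0 1 permutes {..<3::nat}"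
    by (auto intro: permutes_swap_id)
  ultimately have p: "\<sigma> permutes {..<3}" by (auto intro: permutes_compose permutes_id)
  have "\<sigma> 0 < \<sigma> 1" using \<open>\<sigma> \<in> ?B\<close> by (auto simp: transpose_def)
  then show "\<sigma> \<in> ?A" using p
    by (auto simp: unshuffles_2 label_perms_def numeral_2_eq_2 numeral_3_eq_3 less_Suc_eq)
qed

lemma permute_list_3:
  "permute_list (transpose 1 2) [x, y, z] = [x, z, y]"
  "permute_list (transpose 0 1 \<circ> transpose 1 2) [x, y, z] = [y, z, x]"
  by (simp_all add: permute_list_def transpose_def upt_rec)

text \<open>
  A homogeneous element of \<open>W = g \<oplus> V\<close> has weight \<open>0\<close> in \<open>g\<close> and weight \<open>1\<close> in \<open>V\<close>. Then
  \<open>C\<^sup>k\<^sup>|\<^sup>l(W;W)\<close> consists of the cochains that lower the total weight by \<open>l\<close>.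
\<close>

definition wt :: "int \<Rightarrow> 'g::ab_group_add \<times> 'v::ab_group_add \<Rightarrow> bool" where
  "wt w x \<longleftrightarrow> (w \<noteq> 0 \<longrightarrow> fst x = 0) \<and> (w \<noteq> 1 \<longrightarrow> snd x = 0)"

text \<open>One condition covers all three clauses of \<open>bicochains\<close>: outside of 0 and 1
  only the zero vector has a weight, so an output weight other than 0 or 1 forces the value 0. Since
  weights add up, the condition is stable under insertion.\<close>

definition homog :: "int \<Rightarrow> (('g::ab_group_add \<times> 'v::ab_group_add) list \<Rightarrow> 'g \<times> 'v) \<Rightarrow> bool" where
  "homog l f \<longleftrightarrow> (\<forall>ws xs. list_all2 wt ws xs \<longrightarrow> wt (sum_list ws - l) (f xs))"

lemma wt_0 [simp]: "wt w 0"
  by (simp add: wt_def)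

lemma wt_add: "wt w x \<Longrightarrow> wt w y \<Longrightarrow> wt w (x + y)"
  by (simp add: wt_def)

lemma wt_psgn: "wt w x \<Longrightarrow> wt w (psgn n x)"
  by (simp add: wt_def psgn_def)

lemma homogD: "homog l f \<Longrightarrow> list_all2 wt ws xs \<Longrightarrow> w = sum_list ws - l \<Longrightarrow> wt w (f xs)"
  by (simp add: homog_def)

lemma wt_usum:
  fixes xs :: "('g::ab_group_add \<times> 'v::ab_group_add) list" and \<phi> :: "_ \<Rightarrow> _ \<Rightarrow> 'g \<times> 'v"
  assumes "\<And>us vs A B. list_all2 wt us A \<Longrightarrow> list_all2 wt vs B \<Longrightarrow> wt (sum_list us + sum_list vs - l) (\<phi> A B)"
    and "list_all2 wt ws xs"
  shows "wt (sum_list ws - l) (usum xs \<phi>)"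
  using assms
proof (induction xs arbitrary: ws l \<phi>)
  case Nil
  then show ?case using Nil(1)[of "[]" "[]" "[]" "[]"] by simp
next
  case (Cons x xs)
  then obtain w ws' where ws: "ws = w # ws'" "wt w x" "list_all2 wt ws' xs"
    by (auto simp: list_all2_Cons2)
  \<comment> \<open>The weight of the head is absorbed into the shift \<open>l\<close>, which is why
    the induction is over arbitrary \<open>l\<close>.\<close>
  have "wt (sum_list ws' - (l - w)) (usum xs (\<lambda>A B. \<phi> (x # A) B))"
  proof (rule Cons.IH[OF _ ws(3)])
    fix us vs and A B :: "('g \<times> 'v) list"
    assume "list_all2 wt us A" "list_all2 wt vs B"
    then show "wt (sum_list us + sum_list vs - (l - w)) (\<phi> (x # A) B)"
      using Cons.prems(1)[of "w # us" "x # A" vs B] ws(2) by (simp add: algebra_simps)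
  qed
  moreover have "wt (sum_list ws' - (l - w)) (usum xs (\<lambda>A B. psgn (length A) (\<phi> A (x # B))))"
  proof (rule Cons.IH[OF _ ws(3)])
    fix us vs and A B :: "('g \<times> 'v) list"
    assume "list_all2 wt us A" "list_all2 wt vs B"
    then show "wt (sum_list us + sum_list vs - (l - w)) (psgn (length A) (\<phi> A (x # B)))"
      using Cons.prems(1)[of us A "w # vs" "x # B"] ws(2) by (intro wt_psgn) (simp add: algebra_simps)
  qed
  ultimately show ?case unfolding usum.simps using ws(1) by (intro wt_add) (simp_all add: algebra_simps)
qed

lemma wt_asum:
  fixes xs :: "('g::ab_group_add \<times> 'v::ab_group_add) list"
  assumes "homog l f" "list_all2 wt ws xs"
  shows "wt (sum_list ws - l) (asum xs f)"
  unfolding asum_eq_usum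
proof (rule wt_usum[OF _ assms(2)])
  fix us vs and A B :: "('g \<times> 'v) list"
  assume "list_all2 wt us A" "list_all2 wt vs B"
  then show "wt (sum_list us + sum_list vs - l) (if length B = 1 then f (A @ B) else 0)"
    using homogD[OF assms(1), of "us @ vs" "A @ B"] by (simp add: list_all2_appendI)
qed

section \<open>Bilinearity of the bracket over the scalars\<close>

context vector_space_char_0
begin

lemma circ_scale_left: "circ k (fun_scale scale c F) G = fun_scale scale c (circ k F G)"
proof
  fix zs show "circ k (fun_scale scale c F) G zs = fun_scale scale c (circ k F G) zs"
    by (cases zs rule: rev_cases)
      (simp_all add: circ_snoc fun_scale_def scale_right_distrib psgn_def
        usum_hom[of "scale c", OF scale_right_distrib])
qed

lemma circ_scale_right:
  assumes F: "cochain p F"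
  shows "circ k F (fun_scale scale c G) = fun_scale scale c (circ k F G)"
proof
  fix zs
  have F_scale: "F (us @ scale c x # vs) = scale c (F (us @ x # vs))" for us x vs
    using cochain_lin[OF F] by (simp add: lin_iff)
  have "asum A (\<lambda>x. scale c (G x)) = scale c (asum A G)" for A
    by (rule asum_hom[symmetric]) (rule scale_right_distrib)
  then show "circ k F (fun_scale scale c G) zs = fun_scale scale c (circ k F G) zs"
    using F_scale[of "[]"] F_scale[of _ _ "[]"]
    by (cases zs rule: rev_cases)
      (simp_all add: circ_snoc fun_scale_def scale_right_distrib psgn_def
        usum_hom[of "scale c", OF scale_right_distrib])
qed

lemma bracket_scale_right:
  assumes "cochain p F"
  shows "bracket p q F (fun_scale scale c G) = fun_scale scale c (bracket p q F G)"
  unfolding bracket_def circ_scale_left circ_scale_right[OF assms]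
  by (simp add: fun_eq_iff fun_scale_def psgn_def scale_right_diff_distrib scale_right_distrib)

lemma bracket_scale_left:
  assumes "cochain q G"
  shows "bracket p q (fun_scale scale c F) G = fun_scale scale c (bracket p q F G)"
proof -
  have "bracket p q (fun_scale scale c F) G = - psgn (q * p) (fun_scale scale c (bracket q p G F))"
    by (subst bracket_antisym) (simp add: bracket_scale_right[OF assms])
  also have "\<dots> = fun_scale scale c (- psgn (q * p) (bracket q p G F))"
    by (simp add: fun_eq_iff fun_scale_def psgn_def)
  finally show ?thesis using bracket_antisym[of p q F G] by simp
qed

lemma bracket_add_left:
  assumes "cochain q G"
  shows "bracket p q (F + F') G = bracket p q F G + bracket p q F' G"
  using bracket_antisym[of p q "F + F'" G] bracket_antisym[of p q F G] bracket_antisym[of p q F' G]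
  by (simp add: bracket_add_right[OF assms] psgn_add)

lemma bracket_minus_right:
  "cochain p F \<Longrightarrow> bracket p q F (- G) = - bracket p q F G"
  using bracket_psgn_right[where n=1 and G=G and F=F and p=p and q=q] by (simp add: psgn_def)

lemma bracket_minus_left:
  assumes "cochain q G"
  shows "bracket p q (- F) G = - bracket p q F G"
  using bracket_antisym[of p q "- F" G] bracket_antisym[of p q F G]
  by (simp add: bracket_minus_right[OF assms])

lemma bracket_0_right: "cochain p F \<Longrightarrow> bracket p q F 0 = 0"
  using bracket_add_right[where G=0 and G'=0 and F=F and p=p and q=q] by simp

lemma bracket_0_left: "cochain q G \<Longrightarrow> bracket p q 0 G = 0"
  using bracket_add_left[where F=0 and F'=0 and G=G and p=p and q=q] by simp

lemma cochain_scale: "cochain n f \<Longrightarrow> cochain n (fun_scale scale c f)"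
proof (rule cochainI)
  assume f: "cochain n f"
  show "fun_scale scale c f (us @ x # y # vs @ [z]) = - fun_scale scale c f (us @ y # x # vs @ [z])" for us x y vs z
    using cochain_swap[OF f, of us x y vs z] by (simp add: fun_scale_def)
  show "lin (\<lambda>x. fun_scale scale c f (us @ x # vs))" for us vs
    using cochain_lin[OF f, of us vs]
    by (simp add: lin_iff fun_scale_def scale_right_distrib scale_left_commute)
qed (simp add: cochain_vanish fun_scale_def)

lemma cochain_0: "cochain n 0"
  by (rule cochainI) (simp_all add: lin_iff)

end

section \<open>Bicochains as cochains of fixed weight\<close>

locale graded_pair = vector_space_pair sg sv
  for sg :: "'k::field_char_0 \<Rightarrow> 'g::ab_group_add \<Rightarrow> 'g"
    and sv :: "'k \<Rightarrow> 'v::ab_group_add \<Rightarrow> 'v"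
begin

sublocale W: vector_space_char_0 "prod_scale sg sv"
  by (rule vector_space_char_0.intro) (rule vector_space_prod_scale)

lemma wt_scale: "wt w x \<Longrightarrow> wt w (prod_scale sg sv c x)"
  by (simp add: wt_def prod_scale_eq)

text \<open>The inner value has the weight of its arguments minus \<open>m\<close>, and the outer
  map lowers by a further \<open>l\<close>. The weight of the unshuffled last argument is moved into
  the shift.\<close>

lemma homog_circ:
  assumes "homog l F" "homog m G"
  shows "homog (l + m) (W.circ k F G)"
  unfolding homog_def
proof (intro allI impI)
  fix ws and zs :: "('g \<times> 'v) list" assume a: "list_all2 wt ws zs"
  show "wt (sum_list ws - (l + m)) (W.circ k F G zs)"
  proof (cases zs rule: rev_cases)
    case (snoc xs y)
    then obtain us w where ws: "ws = us @ [w]" "list_all2 wt us xs" "wt w y"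
      using a by (auto simp: list_all2_append2 list_all2_Cons2)
    have 1: "wt (sum_list us - (l + m - w)) (usum xs (\<lambda>A D. F (asum A G # D @ [y])))"
    proof (rule wt_usum[OF _ ws(2)])
      fix as ds and A D :: "('g \<times> 'v) list"
      assume A: "list_all2 wt as A" and D: "list_all2 wt ds D"
      have "list_all2 wt ((sum_list as - m) # ds @ [w]) (asum A G # D @ [y])"
        using wt_asum[OF assms(2) A] D ws(3) by (simp add: list_all2_appendI)
      then show "wt (sum_list as + sum_list ds - (l + m - w)) (F (asum A G # D @ [y]))"
        by (rule homogD[OF assms(1)]) simp
    qed
    have 2: "wt (sum_list us - (l + m - w)) (usum xs (\<lambda>A B. F (A @ [G (B @ [y])])))"
    proof (rule wt_usum[OF _ ws(2)])
      fix as bs and A B :: "('g \<times> 'v) list"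
      assume A: "list_all2 wt as A" and B: "list_all2 wt bs B"
      have "wt (sum_list bs + w - m) (G (B @ [y]))"
        by (rule homogD[OF assms(2), of "bs @ [w]"]) (use B ws(3) in \<open>simp_all add: list_all2_appendI\<close>)
      then have "list_all2 wt (as @ [sum_list bs + w - m]) (A @ [G (B @ [y])])"
        using A by (simp add: list_all2_appendI)
      then show "wt (sum_list as + sum_list bs - (l + m - w)) (F (A @ [G (B @ [y])]))"
        by (rule homogD[OF assms(1)]) simp
    qed
    show ?thesis unfolding snoc W.circ_snoc ws(1)
      using wt_add[OF 1 wt_psgn[OF 2]] by (simp add: algebra_simps)
  qed simp
qed

lemma homog_bracket:
  assumes "homog l F" "homog m G"
  shows "homog (l + m) (W.bracket p q F G)"
proof -
  have 1: "homog (l + m) (W.circ (p * q) F G)" "homog (l + m) (W.circ (q * p) G F)"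
    using homog_circ[OF assms] homog_circ[OF assms(2,1)] by (simp_all add: add.commute)
  have "W.bracket p q F G xs = W.circ (p * q) F G xs + psgn (Suc (p * q)) (W.circ (q * p) G F xs)" for xs
    by (simp add: W.bracket_def psgn_def)
  then show ?thesis using 1 unfolding homog_def by (metis wt_add wt_psgn)
qed

text \<open>On arguments of weights 0 and 1, the weight sum counts the entries from V, i.e. it is
  the second index of \<open>bihom_args\<close>. The sums \<open>l\<close> and \<open>l + 1\<close>
  prescribe output weight 0 and 1; any other sum forces 0.\<close>

lemma bicochains_iff:
  assumes kl: "k + l \<ge> 0"
  shows "f \<in> bicochains sg sv k l \<longleftrightarrow> W.cochain (nat (k + l)) f \<and> homog l f"
proof -
  have n: "nat (k + l + 1) = Suc (nat (k + l))" using kl by simp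
  show ?thesis
  proof
    assume f: "f \<in> bicochains sg sv k l"
    then have c: "W.cochain (nat (k + l)) f" by (simp add: bicochains_def n)
    have "wt (sum_list ws - l) (f xs)" if a: "list_all2 wt ws xs" for ws and xs :: "('g \<times> 'v) list"
    proof (cases "length xs = Suc (nat (k + l)) \<and> set ws \<subseteq> {0, 1}")
      case False
      then have "length xs \<noteq> Suc (nat (k + l)) \<or> \<not> set ws \<subseteq> {0, 1}" by blast
      then have "f xs = 0"
      proof
        \<comment> \<open>An entry of weight outside {0, 1} is the zero vector, and \<open>f\<close>
          is multilinear.\<close>
        assume "\<not> set ws \<subseteq> {0, 1}"
        then obtain i where i: "i < length ws" "ws ! i \<noteq> 0" "ws ! i \<noteq> 1" by (auto simp: in_set_conv_nth subset_iff)
        then have "xs ! i = 0" "i < length xs"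
          using a list_all2_nthD[OF a i(1)] list_all2_lengthD[OF a] by (simp_all add: wt_def prod_eq_iff)
        then show "f xs = 0"
          using W.lin_0D[OF W.cochain_lin[OF c, of "take i xs" "drop (Suc i) xs"]] id_take_nth_drop[of i xs] by simp
      qed (simp add: W.cochain_vanish[OF c])
      then show ?thesis by simp
    next
      case True
      define I where "I = {m. m < length xs \<and> ws ! m = 0}"
      have len: "length ws = length xs" using a by (rule list_all2_lengthD)
      have sub: "I \<subseteq> {..<length xs}" by (auto simp: I_def)
      have w01: "ws ! m = (if m \<in> I then 0 else 1)" if "m < length xs" for m
      proof -
        have "ws ! m \<in> set ws" using that len by simp
        then have "ws ! m \<in> {0, 1}" using True by blast
        then show ?thesis using that by (auto simp: I_def)
      qed
      have "sum_list ws = (\<Sum>m<length xs. if m \<in> I then 0 else 1)"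
        unfolding sum_list_sum_nth atLeast0LessThan len by (rule sum.cong) (simp_all add: w01)
      also have "\<dots> = int (card ({..<length xs} - I))"
        by (simp add: sum.If_cases Diff_eq)
      also have "\<dots> = int (length xs) - int (card I)"
        using sub card_mono[OF finite_lessThan sub] by (simp add: card_Diff_subset finite_subset[OF sub])
      finally have s: "int (card I) = int (length xs) - sum_list ws" by simp
      have "if m \<in> I then snd (xs ! m) = 0 else fst (xs ! m) = 0" if "m < length xs" for m
        using list_all2_nthD[OF a, of m] that len w01[OF that] by (simp add: wt_def split: if_splits)
      then have "xs \<in> bihom_args (int (length xs) - sum_list ws) (sum_list ws)"
        unfolding bihom_args_def using sub s by auto
      moreover have "int (length xs) = k + l + 1" using True kl by simp
      ultimately have b: "xs \<in> bihom_args (k + l + 1 - sum_list ws) (sum_list ws)" by simp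
      consider "sum_list ws = l" | "sum_list ws = l + 1" | "sum_list ws \<noteq> l" "sum_list ws \<noteq> l + 1" by blast
      then show ?thesis
      proof cases
        case 1
        then have "xs \<in> bihom_args (k + 1) l" using b by (simp add: algebra_simps)
        then show ?thesis using f 1 by (auto simp: bicochains_def wt_def)
      next
        case 2
        then have "xs \<in> bihom_args k (l + 1)" using b by (simp add: algebra_simps)
        then show ?thesis using f 2 by (auto simp: bicochains_def wt_def)
      next
        case 3
        then show ?thesis using bicochains_other[OF f _ _ b] by simp
      qed
    qed
    then show "W.cochain (nat (k + l)) f \<and> homog l f" using c by (simp add: homog_def)
  next
    assume f: "W.cochain (nat (k + l)) f \<and> homog l f"
    have w: "wt (j - l) (f xs)" if "xs \<in> bihom_args i j" for i j xs
    proof -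
      obtain I where I: "I \<subseteq> {..<length xs}" "int (card I) = i" "int (length xs) = i + j"
        and z: "\<And>m. m < length xs \<Longrightarrow> if m \<in> I then snd (xs ! m) = 0 else fst (xs ! m) = 0"
        using \<open>xs \<in> bihom_args i j\<close> unfolding bihom_args_def by blast
      define ws where "ws = map (\<lambda>m. if m \<in> I then 0 else 1 :: int) [0..<length xs]"
      have "list_all2 wt ws xs"
        unfolding list_all2_conv_all_nth ws_def using z by (auto simp: wt_def split: if_splits)
      moreover have "sum_list ws = (\<Sum>m<length xs. if m \<in> I then 0 else 1)"
        unfolding sum_list_sum_nth by (simp add: ws_def atLeast0LessThan cong: sum.cong_simp)
      then have "sum_list ws = int (card ({..<length xs} - I))"
        by (simp add: sum.If_cases Diff_eq)
      then have "sum_list ws = j"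
        using I card_mono[OF finite_lessThan I(1)] by (simp add: card_Diff_subset finite_subset[OF I(1)])
      ultimately show ?thesis using f homogD by blast
    qed
    have "f xs = 0" if "(i, j) \<noteq> (k + 1, l)" "(i, j) \<noteq> (k, l + 1)" "xs \<in> bihom_args i j" for i j xs
    proof (cases "length xs = Suc (nat (k + l))")
      case True
      have "int (length xs) = i + j" using that(3) by (auto simp: bihom_args_def)
      then have "i + j = k + l + 1" using True kl by simp
      then have "j \<noteq> l" "j \<noteq> l + 1" using that by auto
      then show ?thesis using w[OF that(3)] by (simp add: wt_def prod_eq_iff)
    qed (use f W.cochain_vanish in blast)
    then show "f \<in> bicochains sg sv k l"
      using f w unfolding bicochains_def n by (force simp: wt_def)
  qed
qed

section \<open>Integer degrees\<close>

text \<open>\<open>L'\<close> is the case \<open>l = 0\<close> and \<open>h\<close> the case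
  \<open>l = - 1\<close>, so both kinds of brackets are treated at once; \<open>n\<close> is the
  degree in the graded Lie algebra.\<close>

definition part :: "int \<Rightarrow> int \<Rightarrow> (('g \<times> 'v) list \<Rightarrow> 'g \<times> 'v) set" where
  "part l n = {f. if n \<ge> 0 then W.cochain (nat n) f \<and> homog l f else f = 0}"

lemma L'_part_eq: "L'_part sg sv n = part 0 n"
  using bicochains_iff[of n 0] by (auto simp: L'_part_def part_def)

lemma h_part_eq: "h_part sg sv n = part (- 1) n"
  using bicochains_iff[of "n + 1" "- 1"] by (auto simp: h_part_def part_def)

lemma part_cochain: "f \<in> part l n \<Longrightarrow> W.cochain (nat n) f"
  using W.cochain_0[of 0] by (auto simp: part_def split: if_splits)

lemma part_neg: "f \<in> part l n \<Longrightarrow> n < 0 \<Longrightarrow> f = 0"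
  by (simp add: part_def)

lemma part_0: "0 \<in> part l n"
  by (simp add: part_def W.cochain_0 homog_def)

lemma part_add: "f \<in> part l n \<Longrightarrow> g \<in> part l n \<Longrightarrow> f + g \<in> part l n"
  by (auto simp: part_def W.cochain_add homog_def wt_add split: if_splits)

lemma part_scale: "f \<in> part l n \<Longrightarrow> scaleL sg sv c f \<in> part l n"
  using W.cochain_scale[of f _ c]
  by (auto simp: part_def homog_def fun_scale_def fun_eq_iff wt_scale split: if_splits)

lemma part_isgn: "f \<in> part l n \<Longrightarrow> isgn m f \<in> part l n"
proof -
  assume "f \<in> part l n"
  moreover have "- f = scaleL sg sv (- 1) f" by (simp add: fun_eq_iff fun_scale_def)
  ultimately show ?thesis using part_scale[of f l n "- 1"] by (simp add: isgn_def)
qed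

text \<open>Truncation by \<open>nat\<close> is harmless on parts, since an argument of negative
  degree is 0.\<close>

definition br :: "int \<Rightarrow> int \<Rightarrow> (('g \<times> 'v) list \<Rightarrow> 'g \<times> 'v) \<Rightarrow> (('g \<times> 'v) list \<Rightarrow> 'g \<times> 'v) \<Rightarrow> ('g \<times> 'v) list \<Rightarrow> 'g \<times> 'v"
  where "br m n f g = W.bracket (nat m) (nat n) f g"

lemma MN_bracket_eq_br:
  "f \<in> part l m \<Longrightarrow> g \<in> part l' n \<Longrightarrow> MN_bracket (prod_scale sg sv) (nat m) (nat n) f g = br m n f g"
  unfolding br_def by (intro W.MN_bracket_eq_bracket part_cochain)

lemma br_0 [simp]: "f \<in> part l m \<Longrightarrow> br m n f 0 = 0" "g \<in> part l n \<Longrightarrow> br m n 0 g = 0"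
  by (simp_all add: br_def W.bracket_0_left W.bracket_0_right part_cochain)

text \<open>The degrees \<open>d\<close> and \<open>c\<close> enter by equations so that sums such
  as \<open>i + j + 1 + 1\<close> may keep the shape in which they arise from nesting.\<close>

lemma br_part:
  assumes f: "f \<in> part l m" and g: "g \<in> part l' n" and d: "d = m + n" "c = l + l'"
  shows "br m n f g \<in> part c d"
proof (cases "m < 0 \<or> n < 0")
  case True
  then have "br m n f g = 0" using f g part_neg by fastforce
  then show ?thesis by (simp add: part_0)
next
  case False
  then have "W.cochain (nat (m + n)) (br m n f g)"
    using W.cochain_bracket[OF part_cochain[OF f] part_cochain[OF g]] by (simp add: br_def nat_add_distrib)
  moreover have "homog (l + l') (br m n f g)"
    using False f g homog_bracket by (simp add: br_def part_def)
  ultimately show ?thesis using False d by (simp add: part_def)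
qed

lemma br_antisym:
  assumes f: "f \<in> part l m" and g: "g \<in> part l' n"
  shows "br n m g f = - isgn (m * n) (br m n f g)"
proof (cases "m < 0 \<or> n < 0")
  case True
  then have "f = 0 \<or> g = 0" using f g part_neg by blast
  then show ?thesis using f g by (auto simp: isgn_def)
next
  case False
  then show ?thesis using W.bracket_antisym[of "nat n" "nat m" g f]
    by (simp add: br_def isgn_def psgn_def even_nat_iff)
qed

lemma br_Jacobi:
  assumes f: "f \<in> part l a" and g: "g \<in> part l' b" and h: "h \<in> part l'' c"
    and d: "ab = a + b" "bc = b + c" "ac = a + c"
  shows "br a bc f (br b c g h) = br ab c (br a b f g) h + isgn (a * b) (br b ac g (br a c f h))"
proof (cases "a < 0 \<or> b < 0 \<or> c < 0")
  case True
  then have "f = 0 \<or> g = 0 \<or> h = 0" using f g h part_neg by blast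
  moreover have "br a b f g \<in> part (l + l') ab" "br b c g h \<in> part (l' + l'') bc" "br a c f h \<in> part (l + l'') ac"
    using br_part f g h d by blast+
  ultimately show ?thesis using f g h by (auto simp: isgn_def)
next
  case False
  then show ?thesis
    using W.bracket_Jacobi[OF part_cochain[OF f] part_cochain[OF g] part_cochain[OF h]]
    by (simp add: br_def isgn_def psgn_def even_nat_iff d nat_add_distrib)
qed

lemma br_add_right: "f \<in> part l m \<Longrightarrow> br m n f (g + g') = br m n f g + br m n f g'"
  by (simp add: br_def W.bracket_add_right part_cochain)

lemma br_add_left: "g \<in> part l n \<Longrightarrow> br m n (f + f') g = br m n f g + br m n f' g"
  by (simp add: br_def W.bracket_add_left part_cochain)

lemma br_isgn_right: "f \<in> part l m \<Longrightarrow> br m n f (isgn k g) = isgn k (br m n f g)"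
  by (simp add: br_def isgn_def W.bracket_minus_right part_cochain)

lemma br_isgn_left: "g \<in> part l n \<Longrightarrow> br m n (isgn k f) g = isgn k (br m n f g)"
  by (simp add: br_def isgn_def W.bracket_minus_left part_cochain)

lemma br_scale_right: "f \<in> part l m \<Longrightarrow> br m n f (scaleL sg sv c g) = scaleL sg sv c (br m n f g)"
  by (simp add: br_def W.bracket_scale_right part_cochain)

lemma br_scale_left: "g \<in> part l n \<Longrightarrow> br m n (scaleL sg sv c f) g = scaleL sg sv c (br m n f g)"
  by (simp add: br_def W.bracket_scale_left part_cochain)

lemma scaleL_powi: "scaleL sg sv ((- 1) powi n) f = isgn n f"
  by (simp add: fun_eq_iff fun_scale_def isgn_def minus_one_powi)

end

section \<open>The \<open>L\<^sub>\<infinity>\<close>-structure\<close>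

lemma (in vector_space) vector_space_fun_scale: "vector_space (fun_scale scale)"
  by unfold_locales
    (simp_all add: fun_scale_def fun_eq_iff scale_right_distrib scale_left_distrib)

locale graded_pair_projection = graded_pair sg sv
  for sg :: "'k::field_char_0 \<Rightarrow> 'g::ab_group_add \<Rightarrow> 'g"
    and sv :: "'k \<Rightarrow> 'v::ab_group_add \<Rightarrow> 'v" +
  fixes P :: "(('g \<times> 'v) list \<Rightarrow> 'g \<times> 'v) \<Rightarrow> (('g \<times> 'v) list \<Rightarrow> 'g \<times> 'v)"
  assumes projection: "is_projection_h sg sv P"
begin

abbreviation "E \<equiv> LD_space sg sv"
abbreviation "l \<equiv> LD_brackets sg sv P"

lemma P_id: "\<theta> \<in> part (- 1) n \<Longrightarrow> P \<theta> = \<theta>"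
  using projection unfolding is_projection_h_def h_part_eq by blast

lemma LD_scale_eq: "LD_scale sg sv c w = (scaleL sg sv c (fst w), scaleL sg sv c (snd w))"
proof -
  have "vector_space_pair (scaleL sg sv) (scaleL sg sv)"
    using W.vector_space_fun_scale by (simp add: vector_space_pair_def)
  from vector_space_pair.prod_scale_eq[OF this] show ?thesis by simp
qed

lemma vector_space_LD_scale: "vector_space (LD_scale sg sv)"
proof (rule vector_space_pair.vector_space_prod_scale)
  show "vector_space_pair (scaleL sg sv) (scaleL sg sv)"
    using W.vector_space_fun_scale by (simp add: vector_space_pair_def)
qed

lemma E_iff: "(f, \<theta>) \<in> E i \<longleftrightarrow> f \<in> part 0 (i + 1) \<and> \<theta> \<in> part (- 1) i"
  by (simp add: LD_space_def L'_part_eq h_part_eq)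

lemma E_add: "x \<in> E i \<Longrightarrow> y \<in> E i \<Longrightarrow> x + y \<in> E i"
  by (cases x; cases y) (simp add: E_iff part_add)

lemma E_scale: "x \<in> E i \<Longrightarrow> LD_scale sg sv c x \<in> E i"
  by (cases x) (simp add: E_iff LD_scale_eq part_scale)

lemma E_0: "0 \<in> E i"
  by (simp add: zero_prod_def E_iff part_0)

lemma l_pair:
  assumes "(f, \<theta>) \<in> E i" "(g, \<eta>) \<in> E j"
  shows "l [(i, f, \<theta>), (j, g, \<eta>)] =
    (isgn (i + 1) (br (i + 1) (j + 1) f g), br (i + 1) j f \<eta> + isgn (i * j) (br (j + 1) i g \<theta>))"
proof -
  have f: "f \<in> part 0 (i + 1)" and t: "\<theta> \<in> part (- 1) i" and g: "g \<in> part 0 (j + 1)" and e: "\<eta> \<in> part (- 1) j"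
    using assms by (simp_all add: E_iff)
  have "P (br (i + 1) j f \<eta>) = br (i + 1) j f \<eta>" by (rule P_id[OF br_part[OF f e refl]]) simp
  moreover have "P (br (j + 1) i g \<theta>) = br (j + 1) i g \<theta>" by (rule P_id[OF br_part[OF g t refl]]) simp
  ultimately show ?thesis
    by (simp add: MN_bracket_eq_br[OF f g] MN_bracket_eq_br[OF f e] MN_bracket_eq_br[OF g t] scaleL_powi)
qed

lemma l_not_pair: "length xs \<noteq> 2 \<Longrightarrow> l xs = 0"
  by (cases "(sg, sv, P, xs)" rule: LD_brackets.cases) auto

lemma l_degree:
  assumes x: "x \<in> E i" and y: "y \<in> E j"
  shows "l [(i, x), (j, y)] \<in> E (i + j + 1)"
proof -
  obtain f \<theta> g \<eta> where xy: "x = (f, \<theta>)" "y = (g, \<eta>)" by (cases x, cases y)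
  have f: "f \<in> part 0 (i + 1)" and t: "\<theta> \<in> part (- 1) i" and g: "g \<in> part 0 (j + 1)" and e: "\<eta> \<in> part (- 1) j"
    using assms by (simp_all add: E_iff xy)
  have "br (i + 1) (j + 1) f g \<in> part 0 (i + j + 1 + 1)" by (rule br_part[OF f g]) simp_all
  moreover have "br (i + 1) j f \<eta> \<in> part (- 1) (i + j + 1)" by (rule br_part[OF f e]) simp_all
  moreover have "br (j + 1) i g \<theta> \<in> part (- 1) (i + j + 1)" by (rule br_part[OF g t]) simp_all
  ultimately show ?thesis
    using l_pair[of f \<theta> i g \<eta> j] x y unfolding xy by (simp add: E_iff part_add part_isgn)
qed

text \<open>In the first component, the antisymmetry sign with exponent (i + 1)(j + 1) + 1 and the
  shift signs i + 1 and j + 1 combine to i j. The second component is symmetric by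
  construction.\<close>

lemma l_symmetric:
  assumes x: "x \<in> E i" and y: "y \<in> E j"
  shows "l [(j, y), (i, x)] = isgn (i * j) (l [(i, x), (j, y)])"
proof -
  obtain f \<theta> g \<eta> where xy: "x = (f, \<theta>)" "y = (g, \<eta>)" by (cases x, cases y)
  have "br (j + 1) (i + 1) g f = - isgn ((i + 1) * (j + 1)) (br (i + 1) (j + 1) f g)"
    using assms by (intro br_antisym) (auto simp: E_iff xy)
  then show ?thesis using l_pair[of f \<theta> i g \<eta> j] l_pair[of g \<eta> j f \<theta> i] x y unfolding xy
    by (cases "even i"; cases "even j") (simp_all add: isgn_def add.commute)
qed

lemma l_add_right:
  assumes x: "x \<in> E i" and y: "y \<in> E j" "y' \<in> E j"
  shows "l [(i, x), (j, y + y')] = l [(i, x), (j, y)] + l [(i, x), (j, y')]"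
proof -
  obtain f \<theta> g \<eta> g' \<eta>' where xy: "x = (f, \<theta>)" "y = (g, \<eta>)" "y' = (g', \<eta>')"
    by (cases x, cases y, cases y')
  have f: "f \<in> part 0 (i + 1)" and t: "\<theta> \<in> part (- 1) i" using x by (simp_all add: E_iff xy)
  have "(g + g', \<eta> + \<eta>') \<in> E j" using E_add[OF y] by (simp add: xy)
  then show ?thesis
    using l_pair[of f \<theta> i g \<eta> j] l_pair[of f \<theta> i g' \<eta>' j] l_pair[of f \<theta> i "g + g'" "\<eta> + \<eta>'" j] x y
    unfolding xy by (simp add: br_add_right[OF f] br_add_left[OF t] isgn_def)
qed

lemma l_scale_right:
  assumes x: "x \<in> E i" and y: "y \<in> E j"
  shows "l [(i, x), (j, LD_scale sg sv c y)] = LD_scale sg sv c (l [(i, x), (j, y)])"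
proof -
  obtain f \<theta> g \<eta> where xy: "x = (f, \<theta>)" "y = (g, \<eta>)" by (cases x, cases y)
  have f: "f \<in> part 0 (i + 1)" and t: "\<theta> \<in> part (- 1) i" using x by (simp_all add: E_iff xy)
  interpret F: vector_space "scaleL sg sv" by (rule W.vector_space_fun_scale)
  have "(scaleL sg sv c g, scaleL sg sv c \<eta>) \<in> E j" using E_scale[OF y, of c] by (simp add: xy LD_scale_eq)
  then show ?thesis
    using l_pair[of f \<theta> i g \<eta> j] l_pair[of f \<theta> i "scaleL sg sv c g" "scaleL sg sv c \<eta>" j] x y
    unfolding xy
    by (simp add: LD_scale_eq br_scale_right[OF f] br_scale_left[OF t] isgn_def
        F.scale_right_distrib F.scale_minus_right F.scale_right_diff_distrib)
qed

lemma l_add_left: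
  assumes x: "x \<in> E i" "x' \<in> E i" and y: "y \<in> E j"
  shows "l [(i, x + x'), (j, y)] = l [(i, x), (j, y)] + l [(i, x'), (j, y)]"
  using l_add_right[OF y x] l_symmetric[OF y x(1)] l_symmetric[OF y x(2)] l_symmetric[OF y E_add[OF x]]
  by (simp add: isgn_def)

lemma l_scale_left:
  assumes x: "x \<in> E i" and y: "y \<in> E j"
  shows "l [(i, LD_scale sg sv c x), (j, y)] = LD_scale sg sv c (l [(i, x), (j, y)])"
proof -
  interpret S: vector_space "LD_scale sg sv" by (rule vector_space_LD_scale)
  show ?thesis
    using l_scale_right[OF y x, of c] l_symmetric[OF y x] l_symmetric[OF y E_scale[OF x, of c]]
    by (simp add: isgn_def S.scale_minus_right)
qed

text \<open>The first component is the Jacobi identity for \<open>f\<close>, \<open>g\<close>,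
  \<open>h\<close>. Each term of the second contains exactly one of \<open>\<theta>\<close>,
  \<open>\<eta>\<close>, \<open>\<zeta>\<close>, so it splits into three Jacobi identities with one
  entry from \<open>h_part\<close> each.\<close>

lemma l_Jacobi:
  assumes x: "x \<in> E i" and y: "y \<in> E j" and z: "z \<in> E k"
  shows "l [(i + j + 1, l [(i, x), (j, y)]), (k, z)] + isgn (j * k) (l [(i + k + 1, l [(i, x), (k, z)]), (j, y)]) +
    isgn (i * (j + k)) (l [(j + k + 1, l [(j, y), (k, z)]), (i, x)]) = 0"
proof -
  obtain f \<theta> g \<eta> h \<zeta> where xyz: "x = (f, \<theta>)" "y = (g, \<eta>)" "z = (h, \<zeta>)" by (cases x, cases y, cases z)
  have f: "f \<in> part 0 (i + 1)" and t: "\<theta> \<in> part (- 1) i"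
    and g: "g \<in> part 0 (j + 1)" and e: "\<eta> \<in> part (- 1) j"
    and h: "h \<in> part 0 (k + 1)" and s: "\<zeta> \<in> part (- 1) k"
    using assms by (simp_all add: E_iff xyz)
  have fg: "br (i + 1) (j + 1) f g \<in> part 0 (i + j + 1 + 1)" by (rule br_part[OF f g]) simp_all
  have fh: "br (i + 1) (k + 1) f h \<in> part 0 (i + k + 1 + 1)" by (rule br_part[OF f h]) simp_all
  have gh: "br (j + 1) (k + 1) g h \<in> part 0 (j + k + 1 + 1)" by (rule br_part[OF g h]) simp_all
  note nested = l_pair[OF l_degree[OF x y, unfolded xyz l_pair[OF x[unfolded xyz] y[unfolded xyz]]] z[unfolded xyz]]
    l_pair[OF l_degree[OF x z, unfolded xyz l_pair[OF x[unfolded xyz] z[unfolded xyz]]] y[unfolded xyz]]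
    l_pair[OF l_degree[OF y z, unfolded xyz l_pair[OF y[unfolded xyz] z[unfolded xyz]]] x[unfolded xyz]]
  note expand = br_isgn_left[OF f] br_isgn_left[OF g] br_isgn_left[OF h]
    br_isgn_left[OF t] br_isgn_left[OF e] br_isgn_left[OF s]
    br_isgn_right[OF f] br_isgn_right[OF g] br_isgn_right[OF h]
    br_add_right[OF f] br_add_right[OF g] br_add_right[OF h]
  have J0: "br (i + 1) (j + k + 1 + 1) f (br (j + 1) (k + 1) g h) =
      br (i + j + 1 + 1) (k + 1) (br (i + 1) (j + 1) f g) h +
      isgn ((i + 1) * (j + 1)) (br (j + 1) (i + k + 1 + 1) g (br (i + 1) (k + 1) f h))"
    by (rule br_Jacobi[OF f g h]) simp_all
  \<comment> \<open>The nested bracket is the left argument here; antisymmetry turns it into the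
    form in which \<open>J0\<close> applies.\<close>
  have A1: "br (j + k + 1 + 1) (i + 1) (br (j + 1) (k + 1) g h) f =
      - isgn ((i + 1) * (j + k + 1 + 1)) (br (i + 1) (j + k + 1 + 1) f (br (j + 1) (k + 1) g h))"
    by (rule br_antisym[OF f gh])
  have A2: "br (i + k + 1 + 1) (j + 1) (br (i + 1) (k + 1) f h) g =
      - isgn ((j + 1) * (i + k + 1 + 1)) (br (j + 1) (i + k + 1 + 1) g (br (i + 1) (k + 1) f h))"
    by (rule br_antisym[OF g fh])
  have J1: "br (i + 1) (j + k + 1) f (br (j + 1) k g \<zeta>) =
      br (i + j + 1 + 1) k (br (i + 1) (j + 1) f g) \<zeta> +
      isgn ((i + 1) * (j + 1)) (br (j + 1) (i + k + 1) g (br (i + 1) k f \<zeta>))"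
    by (rule br_Jacobi[OF f g s]) simp_all
  have J2: "br (i + 1) (j + k + 1) f (br (k + 1) j h \<eta>) =
      br (i + k + 1 + 1) j (br (i + 1) (k + 1) f h) \<eta> +
      isgn ((i + 1) * (k + 1)) (br (k + 1) (i + j + 1) h (br (i + 1) j f \<eta>))"
    by (rule br_Jacobi[OF f h e]) simp_all
  have J3: "br (j + 1) (i + k + 1) g (br (k + 1) i h \<theta>) =
      br (j + k + 1 + 1) i (br (j + 1) (k + 1) g h) \<theta> +
      isgn ((j + 1) * (k + 1)) (br (k + 1) (i + j + 1) h (br (j + 1) i g \<theta>))"
    by (rule br_Jacobi[OF g h t]) simp_all
  \<comment> \<open>After the substitutions these eight brackets are the only ones left; as opaque
    names they reduce the claim to parities of \<open>i\<close>, \<open>j\<close>,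
    \<open>k\<close>.\<close>
  define a0 where "a0 = br (i + j + 1 + 1) (k + 1) (br (i + 1) (j + 1) f g) h"
  define b0 where "b0 = br (j + 1) (i + k + 1 + 1) g (br (i + 1) (k + 1) f h)"
  define a1 where "a1 = br (i + j + 1 + 1) k (br (i + 1) (j + 1) f g) \<zeta>"
  define b1 where "b1 = br (j + 1) (i + k + 1) g (br (i + 1) k f \<zeta>)"
  define a2 where "a2 = br (i + k + 1 + 1) j (br (i + 1) (k + 1) f h) \<eta>"
  define b2 where "b2 = br (k + 1) (i + j + 1) h (br (i + 1) j f \<eta>)"
  define a3 where "a3 = br (j + k + 1 + 1) i (br (j + 1) (k + 1) g h) \<theta>"
  define b3 where "b3 = br (k + 1) (i + j + 1) h (br (j + 1) i g \<theta>)"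
  show ?thesis
    unfolding xyz l_pair[OF x[unfolded xyz] y[unfolded xyz]] l_pair[OF x[unfolded xyz] z[unfolded xyz]]
      l_pair[OF y[unfolded xyz] z[unfolded xyz]] nested expand A1 A2 J0 J1 J2 J3
    unfolding a0_def[symmetric] b0_def[symmetric] a1_def[symmetric] b1_def[symmetric]
      a2_def[symmetric] b2_def[symmetric] a3_def[symmetric] b3_def[symmetric]
    by (cases "even i"; cases "even j"; cases "even k") (simp_all add: isgn_def zero_prod_def)
qed

lemma length_2E:
  assumes "length xs = 2"
  obtains i x j y where "xs = [(i, x), (j, y)]"
  using assms by (cases xs; cases "tl xs") (auto simp: numeral_2_eq_2)

theorem L_infinity: "L_infinity_algebra (LD_scale sg sv) E l"
proof -
  interpret S: vector_space "LD_scale sg sv" by (rule vector_space_LD_scale)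
  have S_isgn: "LD_scale sg sv (if even n then 1 else - 1) x = isgn n x" for n x
    by (simp add: isgn_def)
  show ?thesis
  proof
    show "S.subspace (E d)" for d
      by (rule S.subspaceI) (fact E_0 E_add E_scale)+
  next
    fix xs assume "xs \<noteq> []" "homogeneous E xs"
    then show "l xs \<in> E (total_degree xs + 1)"
      using E_0 l_not_pair l_degree by (cases "length xs = 2") (auto elim!: length_2E simp: homogeneous_def)
  next
    fix xs i x y
    assume a: "homogeneous E xs" "i < length xs" "x \<in> E (fst (xs ! i))" "y \<in> E (fst (xs ! i))"
    show "l (xs[i := (fst (xs ! i), x + y)]) = l (xs[i := (fst (xs ! i), x)]) + l (xs[i := (fst (xs ! i), y)])"
    proof (cases "length xs = 2")
      case True
      then obtain m u n v where xs: "xs = [(m, u), (n, v)]" by (rule length_2E)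
      then have "i = 0 \<or> i = 1" using a by auto
      then show ?thesis using a by (auto simp: xs homogeneous_def l_add_left l_add_right)
    qed (simp add: l_not_pair)
  next
    fix xs i x c
    assume a: "homogeneous E xs" "i < length xs" "x \<in> E (fst (xs ! i))"
    show "l (xs[i := (fst (xs ! i), LD_scale sg sv c x)]) = LD_scale sg sv c (l (xs[i := (fst (xs ! i), x)]))"
    proof (cases "length xs = 2")
      case True
      then obtain m u n v where xs: "xs = [(m, u), (n, v)]" by (rule length_2E)
      then have "i = 0 \<or> i = 1" using a by auto
      then show ?thesis using a by (auto simp: xs homogeneous_def l_scale_left l_scale_right)
    qed (simp add: l_not_pair)
  next
    fix xs \<sigma> assume a: "homogeneous E xs" "\<sigma> permutes {..<length xs}"
    show "l xs = LD_scale sg sv (koszul_sign \<sigma> (map fst xs)) (l (permute_list \<sigma> xs))"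
    proof (cases "length xs = 2")
      case True
      then obtain i x j y where xs: "xs = [(i, x), (j, y)]" by (rule length_2E)
      have xy: "x \<in> E i" "y \<in> E j" using a by (auto simp: xs homogeneous_def)
      have "\<sigma> = id \<or> \<sigma> = transpose 0 1" using permutes_2 a(2) True by simp
      then show ?thesis
      proof
        assume \<sigma>: "\<sigma> = transpose 0 1"
        have "permute_list \<sigma> xs = [(j, y), (i, x)]" by (simp add: \<sigma> xs permute_list_def transpose_def upt_rec)
        moreover have "koszul_sign \<sigma> (map fst xs) = (if even (i * j) then 1 else (- 1 :: 'k))"
          unfolding \<sigma> xs using koszul_sign_2[of i j] by simp
        ultimately show ?thesis using l_symmetric[OF xy] by (simp only: S_isgn xs) (simp add: isgn_def)
      qed simp
    qed (simp add: l_not_pair)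
  next
    fix xs assume a: "homogeneous E xs" "xs \<noteq> []"
    let ?t = "\<lambda>i \<sigma>. let ys = permute_list \<sigma> xs; us = take i ys in
      LD_scale sg sv (koszul_sign \<sigma> (map fst xs)) (l ((total_degree us + 1, l us) # drop i ys))"
    \<comment> \<open>The inner bracket needs i = 2 entries, and the outer one takes n - i + 1
      entries, which must be 2; so n = 3.\<close>
    have zero: "?t i \<sigma> = 0" if "i \<noteq> 2 \<or> length xs \<noteq> 3" "i \<in> {1..length xs}" "\<sigma> \<in> unshuffles [i, length xs - i]" for i \<sigma>
    proof -
      let ?ys = "permute_list \<sigma> xs"
      have "\<sigma> permutes {..<length xs}" using that(2,3) by (simp add: unshuffles_def)
      then have ys: "homogeneous E ?ys" using a(1) by (simp add: homogeneous_def)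
      have "l ((total_degree (take i ?ys) + 1, l (take i ?ys)) # drop i ?ys) = 0"
      proof (cases "length xs = i + 1")
        case True
        then have "i \<noteq> 2" using that(1) by auto
        then have 0: "l (take i ?ys) = 0" using True by (intro l_not_pair) simp
        have "length (drop i ?ys) = 1" using True by simp
        then obtain k z where d: "drop i ?ys = [(k, z)]" by (cases "drop i ?ys") auto
        then have "(k, z) \<in> set ?ys" by (metis in_set_dropD list.set_intros(1))
        then have "z \<in> E k" using ys by (auto simp: homogeneous_def)
        \<comment> \<open>A bracket with entry 0 is 0, by additivity at 0 + 0.\<close>
        then show ?thesis using l_add_left[OF E_0 E_0, of z k] unfolding d 0 by simp
      next
        case False
        then show ?thesis using that(2) by (intro l_not_pair) simp
      qed
      then show ?thesis by (simp add: Let_def)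
    qed
    show "(\<Sum>i\<in>{1..length xs}. \<Sum>\<sigma>\<in>unshuffles [i, length xs - i]. ?t i \<sigma>) = 0"
    proof (cases "length xs = 3")
      case False
      then show ?thesis using zero by (intro sum.neutral ballI) blast
    next
      case True
      then obtain i x j y k z where xs: "xs = [(i, x), (j, y), (k, z)]"
        by (auto simp: numeral_3_eq_3 length_Suc_conv)
      have xyz: "x \<in> E i" "y \<in> E j" "z \<in> E k" using a(1) by (auto simp: xs homogeneous_def)
      have "(\<Sum>i\<in>{1..length xs}. \<Sum>\<sigma>\<in>unshuffles [i, length xs - i]. ?t i \<sigma>) =
          (\<Sum>i\<in>{2}. \<Sum>\<sigma>\<in>unshuffles [i, length xs - i]. ?t i \<sigma>)"
        using True zero by (intro sum.mono_neutral_right) (auto intro!: sum.neutral)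
      also have "\<dots> = (\<Sum>\<sigma>\<in>unshuffles [2, 1]. ?t 2 \<sigma>)" using True by simp
      also have "\<dots> = ?t 2 id + ?t 2 (transpose 1 2) + ?t 2 (transpose 0 1 \<circ> transpose 1 2)"
      proof -
        have "id \<noteq> transpose 1 (2::nat)" "id \<noteq> transpose 0 1 \<circ> transpose 1 (2::nat)"
          "transpose 1 2 \<noteq> transpose 0 1 \<circ> transpose 1 (2::nat)"
          by (auto simp: fun_eq_iff transpose_def)
        then show ?thesis unfolding unshuffles_2_1 by (simp del: comp_apply add: add.assoc)
      qed
      also have "?t 2 id = l [(i + j + 1, l [(i, x), (j, y)]), (k, z)]"
        by (simp add: xs)
      also have "?t 2 (transpose 1 2) = isgn (j * k) (l [(i + k + 1, l [(i, x), (k, z)]), (j, y)])"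
        unfolding xs permute_list_3 using koszul_sign_3(1)[of i j k, where ?'k='k]
        by (simp add: isgn_def)
      also have "?t 2 (transpose 0 1 \<circ> transpose 1 2) = isgn (i * (j + k)) (l [(j + k + 1, l [(j, y), (k, z)]), (i, x)])"
        unfolding xs permute_list_3 using koszul_sign_3(2)[of i j k, where ?'k='k]
        by (simp add: isgn_def del: comp_apply)
      also have "l [(i + j + 1, l [(i, x), (j, y)]), (k, z)] + isgn (j * k) (l [(i + k + 1, l [(i, x), (k, z)]), (j, y)]) +
          isgn (i * (j + k)) (l [(j + k + 1, l [(j, y), (k, z)]), (i, x)]) = 0"
        by (rule l_Jacobi[OF xyz])
      finally show ?thesis .
    qed
  qed
qed

section \<open>Maurer-Cartan elements\<close>

text \<open>Only the quadratic term is present. In degree 0 the two mixed contributions to its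
  second component coincide, and the factor 2 is cancelled in characteristic 0.\<close>

lemma maurer_cartan_iff:
  assumes \<alpha>: "(F, D) \<in> E 0"
  shows "maurer_cartan (LD_scale sg sv) E l (F, D) \<longleftrightarrow> br 1 1 F F = 0 \<and> br 1 0 F D = 0"
proof -
  interpret S: vector_space "LD_scale sg sv" by (rule vector_space_LD_scale)
  interpret FS: vector_space "scaleL sg sv" by (rule W.vector_space_fun_scale)
  define t where "t k = LD_scale sg sv (1 / fact k) (l (replicate k (0, (F, D))))" for k
  have t2: "k = 2" if "t k \<noteq> 0" for k
  proof (rule ccontr)
    assume "k \<noteq> 2"
    then have "l (replicate k (0, (F, D))) = 0" by (intro l_not_pair) simp
    then show False using that by (simp add: t_def)
  qed
  have "k \<ge> 1 \<and> t k \<noteq> 0 \<longleftrightarrow> k = 2 \<and> t 2 \<noteq> 0" for k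
    using t2[of k] by (cases "k = 2") auto
  then have K: "{k. k \<ge> 1 \<and> t k \<noteq> 0} = (if t 2 = 0 then {} else {2})" by (simp only:) auto
  then have "maurer_cartan (LD_scale sg sv) E l (F, D) \<longleftrightarrow> t 2 = 0"
    using \<alpha> unfolding maurer_cartan_def t_def[symmetric] Let_def by simp
  also have "\<dots> \<longleftrightarrow> l [(0, (F, D)), (0, (F, D))] = 0"
    by (simp add: t_def numeral_2_eq_2 del: fact_Suc)
  also have "\<dots> \<longleftrightarrow> br 1 1 F F = 0 \<and> br 1 0 F D + br 1 0 F D = 0"
    using l_pair[OF \<alpha> \<alpha>] by (simp add: isgn_def zero_prod_def)
  also have "br 1 0 F D + br 1 0 F D = scaleL sg sv 2 (br 1 0 F D)"
    using FS.scale_left_distrib[of 1 1 "br 1 0 F D"] by simp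
  finally show ?thesis by (simp only: FS.scale_eq_0_iff numeral_neq_zero simp_thms)
qed

end

section \<open>The Maurer-Cartan equations in low arity\<close>

text \<open>For odd degree the bracket of \<open>F\<close> with itself is twice
  \<open>circ 1 F F\<close>, and the latter is the associator of \<open>F\<close> antisymmetrised in
  the first two arguments.\<close>

lemma (in vector_space_char_0) bracket_self_eq_0_iff:
  assumes F: "cochain 1 F"
  shows "bracket 1 1 F F = 0 \<longleftrightarrow>
    (\<forall>x y z. F [F [x, y], z] - F [x, F [y, z]] = F [F [y, x], z] - F [y, F [x, z]])"
proof -
  have circ3: "circ 1 F F [x, y, z] = F [F [x, y], z] - F [x, F [y, z]] - (F [F [y, x], z] - F [y, F [x, z]])" for x y z
  proof -
    \<comment> \<open>Expanding \<open>usum\<close> also produces splittings of the wrong size,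
      which these equations remove.\<close>
    have short: "F [u] = 0" "F [u, v, w] = 0" for u v w by (simp_all add: cochain_vanish[OF F])
    have "F [u - v, w] = F [u, w] - F [v, w]" for u v w
      using lin_plusD[OF cochain_lin_Cons[OF F], of u "- v"] lin_minusD[OF cochain_lin_Cons[OF F]] by simp
    note F_diff = this
    have "circ 1 F F [x, y, z] = F [F [x, y] - F [y, x], z] - (F [x, F [y, z]] - F [y, F [x, z]])"
      using circ_snoc[of 1 F F "[x, y]" z]
      by (simp add: short lin_0D[OF cochain_lin_snoc[OF F, of "[_]", simplified]]
          lin_0D[OF cochain_lin_Cons[OF F]] cochain_vanish[OF F] psgn_def algebra_simps)
    then show ?thesis unfolding F_diff by (simp only: algebra_simps)
  qed
  have "bracket 1 1 F F = circ 1 F F + circ 1 F F" by (simp add: bracket_def psgn_def)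
  moreover have "circ 1 F F + circ 1 F F = 0 \<longleftrightarrow> circ 1 F F = 0"
  proof
    assume a: "circ 1 F F + circ 1 F F = 0"
    have "circ 1 F F xs = 0" for xs
      using fun_cong[OF a, of xs] by (intro eq_minus_self) (simp add: eq_neg_iff_add_eq_0)
    then show "circ 1 F F = 0" by auto
  qed simp
  moreover have "circ 1 F F = 0 \<longleftrightarrow> (\<forall>x y z. circ 1 F F [x, y, z] = 0)"
  proof
    assume a: "\<forall>x y z. circ 1 F F [x, y, z] = 0"
    show "circ 1 F F = 0"
    proof
      fix xs show "circ 1 F F xs = 0 xs"
      proof (cases "length xs = 3")
        case True
        then show ?thesis using a by (auto simp: numeral_3_eq_3 length_Suc_conv)
      qed (use circ_vanish[OF F F] in simp)
    qed
  qed simp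
  ultimately show ?thesis by (simp only: circ3 right_minus_eq)
qed

lemma (in vector_space_char_0) bracket_1_0_eq_0_iff:
  assumes F: "cochain 1 F" and D: "cochain 0 D"
  shows "bracket 1 0 F D = 0 \<longleftrightarrow> (\<forall>x y. D [F [x, y]] = F [D [x], y] + F [x, D [y]])"
proof -
  have "F [u] = 0" "D [u, v] = 0" for u v
    by (simp_all add: cochain_vanish[OF F] cochain_vanish[OF D])
  then have circ2: "bracket 1 0 F D [x, y] = F [D [x], y] + F [x, D [y]] - D [F [x, y]]" for x y
    using circ_snoc[of 0 F D "[x]" y] circ_snoc[of 0 D F "[x]" y]
    by (simp add: bracket_def lin_0D[OF cochain_lin_snoc[OF F, of "[_]", simplified]]
        lin_0D[OF cochain_lin_Cons[OF F]] cochain_vanish[OF D] lin_0D[OF cochain_lin_Cons[OF D]])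
  have "bracket 1 0 F D = 0 \<longleftrightarrow> (\<forall>x y. bracket 1 0 F D [x, y] = 0)"
  proof
    assume a: "\<forall>x y. bracket 1 0 F D [x, y] = 0"
    show "bracket 1 0 F D = 0"
    proof
      fix xs show "bracket 1 0 F D xs = 0 xs"
      proof (cases "length xs = 2")
        case True
        then show ?thesis using a by (auto simp: numeral_2_eq_2 length_Suc_conv)
      qed (use cochain_vanish[OF cochain_bracket[OF F D]] in simp)
    qed
  qed simp
  moreover have "bracket 1 0 F D [x, y] = 0 \<longleftrightarrow> D [F [x, y]] = F [D [x], y] + F [x, D [y]]" for x y
    unfolding circ2 right_minus_eq by (rule eq_commute)
  ultimately show ?thesis by simp
qed

context graded_pair_projection
begin

section \<open>The semidirect product on g + V\<close>

context
  fixes \<pi> :: "'g \<Rightarrow> 'g \<Rightarrow> 'g" and \<rho> :: "'g \<Rightarrow> 'v \<Rightarrow> 'v" and \<mu> :: "'v \<Rightarrow> 'g \<Rightarrow> 'v" and D :: "'g \<Rightarrow> 'v"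
  assumes \<pi>: "bilinear_map sg sg sg \<pi>" and \<rho>: "bilinear_map sg sv sv \<rho>"
    and \<mu>: "bilinear_map sv sg sv \<mu>" and D: "Vector_Spaces.linear sg sv D"
begin

abbreviation "F \<equiv> lift_pi \<pi> + lift_rho \<rho> + lift_mu \<mu>"

lemma F_pair: "F [x, y] = (\<pi> (fst x) (fst y), \<rho> (fst x) (snd y) + \<mu> (snd x) (fst y))"
  by (cases x; cases y) simp

lemma F_not_pair: "length xs \<noteq> 2 \<Longrightarrow> F xs = 0"
proof -
  assume "length xs \<noteq> 2"
  then have "lift_pi \<pi> xs = 0" by (cases "(\<pi>, xs)" rule: lift_pi.cases) auto
  moreover have "lift_rho \<rho> xs = 0"
    using \<open>length xs \<noteq> 2\<close> by (cases "(\<rho>, xs)" rule: lift_rho.cases) auto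
  moreover have "lift_mu \<mu> xs = 0"
    using \<open>length xs \<noteq> 2\<close> by (cases "(\<mu>, xs)" rule: lift_mu.cases) auto
  ultimately show ?thesis by simp
qed

lemma lift_D_single: "lift_D D [x] = (0, D (fst x))"
  by (cases x) simp

lemma lift_D_not_single: "length xs \<noteq> 1 \<Longrightarrow> lift_D D xs = 0"
  by (cases "(D, xs)" rule: lift_D.cases) auto

lemma bilinear_simps:
  "\<pi> (x + x') y = \<pi> x y + \<pi> x' y" "\<pi> x (y + y') = \<pi> x y + \<pi> x y'"
  "\<pi> (sg c x) y = sg c (\<pi> x y)" "\<pi> x (sg c y) = sg c (\<pi> x y)" "\<pi> 0 y = 0" "\<pi> x 0 = 0"
  "\<rho> (x + x') v = \<rho> x v + \<rho> x' v" "\<rho> x (v + v') = \<rho> x v + \<rho> x v'"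
  "\<rho> (sg c x) v = sv c (\<rho> x v)" "\<rho> x (sv c v) = sv c (\<rho> x v)" "\<rho> 0 v = 0" "\<rho> x 0 = 0"
  "\<mu> (v + v') x = \<mu> v x + \<mu> v' x" "\<mu> v (x + x') = \<mu> v x + \<mu> v x'"
  "\<mu> (sv c v) x = sv c (\<mu> v x)" "\<mu> v (sg c x) = sv c (\<mu> v x)" "\<mu> 0 x = 0" "\<mu> v 0 = 0"
  "D (x + x') = D x + D x'" "D (sg c x) = sv c (D x)" "D 0 = 0"
proof -
  have lin: "f (x + y) = f x + f y" "f (s c x) = s' c (f x)" "f 0 = 0"
    if "Vector_Spaces.linear s s' f" for s :: "'k \<Rightarrow> 'a::ab_group_add \<Rightarrow> 'a"
      and s' :: "'k \<Rightarrow> 'b::ab_group_add \<Rightarrow> 'b" and f x y c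
    using module_hom.add module_hom.scale module_hom.zero Vector_Spaces.linear.axioms(3)[OF that]
    by metis+
  note l = \<pi>[unfolded bilinear_map_def] \<rho>[unfolded bilinear_map_def] \<mu>[unfolded bilinear_map_def]
  show "\<pi> (x + x') y = \<pi> x y + \<pi> x' y" "\<pi> (sg c x) y = sg c (\<pi> x y)" "\<pi> 0 y = 0"
    using lin[of sg sg "\<lambda>x. \<pi> x y"] l(1) by auto
  show "\<pi> x (y + y') = \<pi> x y + \<pi> x y'" "\<pi> x (sg c y) = sg c (\<pi> x y)" "\<pi> x 0 = 0"
    using lin[of sg sg "\<pi> x"] l(1) by auto
  show "\<rho> (x + x') v = \<rho> x v + \<rho> x' v" "\<rho> (sg c x) v = sv c (\<rho> x v)" "\<rho> 0 v = 0"
    using lin[of sg sv "\<lambda>x. \<rho> x v"] l(2) by auto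
  show "\<rho> x (v + v') = \<rho> x v + \<rho> x v'" "\<rho> x (sv c v) = sv c (\<rho> x v)" "\<rho> x 0 = 0"
    using lin[of sv sv "\<rho> x"] l(2) by auto
  show "\<mu> (v + v') x = \<mu> v x + \<mu> v' x" "\<mu> (sv c v) x = sv c (\<mu> v x)" "\<mu> 0 x = 0"
    using lin[of sv sv "\<lambda>v. \<mu> v x"] l(3) by auto
  show "\<mu> v (x + x') = \<mu> v x + \<mu> v x'" "\<mu> v (sg c x) = sv c (\<mu> v x)" "\<mu> v 0 = 0"
    using lin[of sg sv "\<mu> v"] l(3) by auto
  show "D (x + x') = D x + D x'" "D (sg c x) = sv c (D x)" "D 0 = 0"
    using lin[OF D] by auto
qed

lemma rho_diff: "\<rho> (x - x') v = \<rho> x v - \<rho> x' v"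
  using bilinear_simps(7)[of "x - x'" x' v] by simp

text \<open>Antisymmetry is vacuous in degree 1: it concerns lists of at least three entries, where
  \<open>F\<close> vanishes.\<close>

lemma cochain_F: "W.cochain 1 F"
proof (rule W.cochainI)
  show "W.lin (\<lambda>x. F (us @ x # vs))" for us vs
  proof (cases "length (us @ undefined # vs) = 2")
    case True
    then consider b where "us = []" "vs = [b]" | a where "us = [a]" "vs = []"
      by (cases us; cases vs) auto
    then show ?thesis
      unfolding W.lin_iff
      by cases (simp_all only: append_Nil append_Cons F_pair,
          simp_all add: prod_scale_eq bilinear_simps vs2.scale_right_distrib)
  next
    case False
    then have "(\<lambda>x. F (us @ x # vs)) = (\<lambda>x. 0)" using F_not_pair by (intro ext) simp
    then show ?thesis by (simp add: W.lin_iff)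
  qed
qed (simp_all only: F_not_pair length_append length_Cons, simp_all add: F_not_pair numeral_2_eq_2)

lemma cochain_lift_D: "W.cochain 0 (lift_D D)"
proof (rule W.cochainI)
  show "W.lin (\<lambda>x. lift_D D (us @ x # vs))" for us vs
  proof (cases "us = [] \<and> vs = []")
    case True
    then show ?thesis unfolding W.lin_iff by (simp add: lift_D_single prod_scale_eq bilinear_simps)
  next
    case False
    then have "(\<lambda>x. lift_D D (us @ x # vs)) = (\<lambda>x. 0)" using lift_D_not_single by (intro ext) simp
    then show ?thesis by (simp add: W.lin_iff)
  qed
qed (simp_all add: lift_D_not_single)

lemma homog_F: "homog 0 F"
  unfolding homog_def
proof (intro allI impI)
  fix ws and xs :: "('g \<times> 'v) list" assume a: "list_all2 wt ws xs"
  show "wt (sum_list ws - 0) (F xs)"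
  proof (cases "length xs = 2")
    case True
    then obtain x y where xs: "xs = [x, y]" by (auto simp: numeral_2_eq_2 length_Suc_conv)
    then obtain v w where ws: "ws = [v, w]" "wt v x" "wt w y" using a by (auto simp: list_all2_Cons2)
    show ?thesis unfolding ws(1) xs F_pair
      using ws(2,3) by (cases "v = 0"; cases "w = 0"; cases "v = 1"; cases "w = 1")
        (auto simp: wt_def bilinear_simps)
  next
    case False
    show ?thesis unfolding F_not_pair[OF False] by (rule wt_0)
  qed
qed

lemma homog_lift_D: "homog (- 1) (lift_D D)"
  unfolding homog_def
proof (intro allI impI)
  fix ws and xs :: "('g \<times> 'v) list" assume a: "list_all2 wt ws xs"
  show "wt (sum_list ws - - 1) (lift_D D xs)"
  proof (cases "length xs = 1")
    case True
    then obtain x where xs: "xs = [x]" by (auto simp: length_Suc_conv)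
    then obtain w where ws: "ws = [w]" "wt w x" using a by (auto simp: list_all2_Cons2)
    then show ?thesis by (auto simp: xs lift_D_single wt_def bilinear_simps)
  qed (simp add: lift_D_not_single)
qed

lemma E_lift: "(F, lift_D D) \<in> E 0"
  unfolding E_iff part_def using cochain_F homog_F cochain_lift_D homog_lift_D by simp

text \<open>The pre-Lie identity of \<open>F\<close> is split by the number of arguments in V. None
  gives the identity of \<open>\<pi>\<close>, the third one gives the representation
  \<open>\<rho>\<close>, the second one the condition on \<open>\<mu>\<close>, and the first one the
  same condition by symmetry. With two or more, all terms vanish.\<close>

theorem maurer_cartan_iff_pre_LieDer_pair:
  "maurer_cartan (LD_scale sg sv) E l (F, lift_D D) \<longleftrightarrow> pre_LieDer_pair sg \<pi> sv D \<rho> (\<lambda>x v. \<mu> v x)"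
proof -
  have "maurer_cartan (LD_scale sg sv) E l (F, lift_D D) \<longleftrightarrow>
      W.bracket 1 1 F F = 0 \<and> W.bracket 1 0 F (lift_D D) = 0"
    using maurer_cartan_iff[OF E_lift] by (simp add: br_def)
  also have "\<dots> \<longleftrightarrow> (\<forall>x y z. F [F [x, y], z] - F [x, F [y, z]] = F [F [y, x], z] - F [y, F [x, z]]) \<and>
      (\<forall>x y. lift_D D [F [x, y]] = F [lift_D D [x], y] + F [x, lift_D D [y]])"
    unfolding W.bracket_self_eq_0_iff[OF cochain_F] W.bracket_1_0_eq_0_iff[OF cochain_F cochain_lift_D] ..
  also have "(\<forall>x y. lift_D D [F [x, y]] = F [lift_D D [x], y] + F [x, lift_D D [y]]) \<longleftrightarrow>
      (\<forall>x y. D (\<pi> x y) = \<rho> x (D y) + \<mu> (D x) y)" (is "_ \<longleftrightarrow> ?der")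
    unfolding F_pair lift_D_single by (simp add: bilinear_simps add.commute)
  also have "(\<forall>x y z. F [F [x, y], z] - F [x, F [y, z]] = F [F [y, x], z] - F [y, F [x, z]]) \<longleftrightarrow>
      (\<forall>x y z. \<pi> (\<pi> x y) z - \<pi> x (\<pi> y z) = \<pi> (\<pi> y x) z - \<pi> y (\<pi> x z)) \<and>
      (\<forall>x y v. \<rho> (\<pi> x y - \<pi> y x) v = \<rho> x (\<rho> y v) - \<rho> y (\<rho> x v)) \<and>
      (\<forall>x y v. \<mu> (\<mu> v x) y - \<mu> v (\<pi> x y) = \<mu> (\<rho> x v) y - \<rho> x (\<mu> v y))"
    (is "?preLie \<longleftrightarrow> ?pre \<and> ?rep \<and> ?mu")
  proof
    assume a: ?preLie
    have ?pre
      using a[unfolded F_pair, rule_format, of "(_, 0)" "(_, 0)" "(_, 0)"] by (simp add: bilinear_simps)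
    moreover have ?rep
    proof (intro allI)
      fix x y v
      show "\<rho> (\<pi> x y - \<pi> y x) v = \<rho> x (\<rho> y v) - \<rho> y (\<rho> x v)"
        using a[unfolded F_pair, rule_format, of "(x, 0)" "(y, 0)" "(0, v)"]
        by (simp add: bilinear_simps rho_diff algebra_simps)
    qed
    moreover have ?mu
    proof (intro allI)
      fix x y v
      show "\<mu> (\<mu> v x) y - \<mu> v (\<pi> x y) = \<mu> (\<rho> x v) y - \<rho> x (\<mu> v y)"
        using a[unfolded F_pair, rule_format, of "(x, 0)" "(0, v)" "(y, 0)"]
        by (simp add: bilinear_simps algebra_simps)
    qed
    ultimately show "?pre \<and> ?rep \<and> ?mu" by blast
  next
    assume a: "?pre \<and> ?rep \<and> ?mu"
    show ?preLie
    proof (intro allI)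
      fix X Y Z :: "'g \<times> 'v"
      obtain x u y v z w where XYZ: "X = (x, u)" "Y = (y, v)" "Z = (z, w)" by (cases X, cases Y, cases Z)
      have "\<rho> (\<pi> x y - \<pi> y x) w = \<rho> x (\<rho> y w) - \<rho> y (\<rho> x w)" using a by blast
      then have r: "\<rho> (\<pi> x y) w = \<rho> (\<pi> y x) w + \<rho> x (\<rho> y w) - \<rho> y (\<rho> x w)"
        unfolding rho_diff by (simp add: algebra_simps)
      \<comment> \<open>Stated for arbitrary vectors, since it is applied to the V-components of
        both X and Y.\<close>
      have m: "\<mu> (\<mu> v x) z = \<mu> v (\<pi> x z) + \<mu> (\<rho> x v) z - \<rho> x (\<mu> v z)" for x v z
        using a by (simp add: algebra_simps)
      show "F [F [X, Y], Z] - F [X, F [Y, Z]] = F [F [Y, X], Z] - F [Y, F [X, Z]]"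
        unfolding F_pair XYZ using a by (simp add: bilinear_simps r m)
    qed
  qed
  also have "(?pre \<and> ?rep \<and> ?mu) \<and> ?der \<longleftrightarrow> pre_LieDer_pair sg \<pi> sv D \<rho> (\<lambda>x v. \<mu> v x)"
  proof -
    have "bilinear_map sg sv sv (\<lambda>x v. \<mu> v x)" using \<mu> by (simp add: bilinear_map_def)
    then show ?thesis
      using \<pi> \<rho> D vs1.vector_space_axioms vs2.vector_space_axioms
      unfolding pre_LieDer_pair_def pre_LieDer_pair_axioms_def pre_Lie_representation_def
        pre_Lie_representation_axioms_def pre_Lie_algebra_def pre_Lie_algebra_axioms_def
        Lie_representation_def sub_adjacent_def by blast
  qed
  finally show ?thesis .
qed

end

end

theorem theorem3p9:
  fixes sg :: "'k::{alg_closed_field, field_char_0} \<Rightarrow> 'g::ab_group_add \<Rightarrow> 'g"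
    and sv :: "'k \<Rightarrow> 'v::ab_group_add \<Rightarrow> 'v"
    and P :: "(('g \<times> 'v) list \<Rightarrow> 'g \<times> 'v) \<Rightarrow> (('g \<times> 'v) list \<Rightarrow> 'g \<times> 'v)"
  assumes "vector_space sg" and "vector_space sv"
    and "is_projection_h sg sv P"
  shows "L_infinity_algebra (LD_scale sg sv) (LD_space sg sv) (LD_brackets sg sv P) \<and>
    (\<forall>\<pi> \<rho> \<mu> D.
       bilinear_map sg sg sg \<pi> \<longrightarrow> bilinear_map sg sv sv \<rho> \<longrightarrow> bilinear_map sv sg sv \<mu> \<longrightarrow>
       Vector_Spaces.linear sg sv D \<longrightarrow>
       (maurer_cartan (LD_scale sg sv) (LD_space sg sv) (LD_brackets sg sv P)
          (lift_pi \<pi> + lift_rho \<rho> + lift_mu \<mu>, lift_D D)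
        \<longleftrightarrow> pre_LieDer_pair sg \<pi> sv D \<rho> (\<lambda>x v. \<mu> v x)))"
proof -
  have "graded_pair_projection sg sv P"
    using assms by (simp add: graded_pair_projection_def graded_pair_def vector_space_pair_def
        graded_pair_projection_axioms_def)
  then interpret graded_pair_projection sg sv P .
  show ?thesis using L_infinity maurer_cartan_iff_pre_LieDer_pair by blast
qed

end
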